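(* Let $X$ be a compact Hausdorff space, $\mu$ a regular Borel probability measure on $X$, and $T:X\to X$ an ergodic automorphism of $(X,\mu)$ (invertible and measure-preserving; $T$ is not assumed continuous). Let $C(X,\mathrm{SL}(2,\mathbb{R}))$ be the space of continuous maps $A:X\to\mathrm{SL}(2,\mathbb{R})$ with the topology of uniform convergence. Then there is a residual set $\mathcal{R}\subset C(X,\mathrm{SL}(2,\mathbb{R}))$ such that every $A\in\mathcal{R}$ either is uniformly hyperbolic or satisfies $\mathrm{LE}(A)=0$.
   Context: For a cocycle $A$ write $A^n(x)=A(T^{n-1}x)\cdots A(x)$ for $n>0$, $A^0=I$, and $A^n(x)=[A(T^nx)]^{-1}\cdots[A(T^{-1}x)]^{-1}$ for $n<0$. The limit $\lambda^+(x)=\lim_{n\to\infty}\frac1n\log\|A^n(x)\|\ge0$ exists $\mu$-a.e., and $\mathrm{LE}(A)=\int_X\lambda^+\,d\mu$. The cocycle $A$ (over $T$) is uniformly hyperbolic if for $\mu$-a.e. $x$ there is a splitting $\mathbb{R}^2=E^u(x)\oplus E^s(x)$, measurable in $x$, with $A(x)E^u(x)=E^u(Tx)$, $A(x)E^s(x)=E^s(Tx)$ a.e., and constants $C>0$, $0<\tau<1$ such that $\|A^n(x)v^s\|\le C\tau^n\|v^s\|$ and $\|A^{-n}(x)v^u\|\le C\tau^n\|v^u\|$ for a.e. $x$, all $v^s\in E^s(x)$, $v^u\in E^u(x)$ and $n\ge0$. *)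

theory Defs
  imports "HOL-Probability.Probability"
begin

definition regular_measure :: "'a::topological_space measure \<Rightarrow> bool" where
  "regular_measure M \<longleftrightarrow>
     (\<forall>B\<in>sets M.
        emeasure M B = (SUP K\<in>{K. compact K \<and> K \<subseteq> B}. emeasure M K) \<and>
        emeasure M B = (INF U\<in>{U. open U \<and> B \<subseteq> U}. emeasure M U))"

definition ergodic_automorphism :: "'a measure \<Rightarrow> ('a \<Rightarrow> 'a) \<Rightarrow> bool" where
  "ergodic_automorphism M T \<longleftrightarrow>
     T ` space M = space M \<and> inj_on T (space M) \<and>
     T \<in> measurable M M \<and> the_inv_into (space M) T \<in> measurable M M \<and>
     distr M M T = M \<and>
     (\<forall>S\<in>sets M. T -` S \<inter> space M = S \<longrightarrow> measure M S = 0 \<or> measure M S = 1)"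

fun cocycle :: "('a \<Rightarrow> 'a) \<Rightarrow> ('a \<Rightarrow> real^2^2) \<Rightarrow> nat \<Rightarrow> 'a \<Rightarrow> real^2^2" where
  "cocycle T A 0 x = mat 1"
| "cocycle T A (Suc n) x = A ((T ^^ n) x) ** cocycle T A n x"

fun cocycle_neg :: "('a \<Rightarrow> 'a) \<Rightarrow> ('a \<Rightarrow> real^2^2) \<Rightarrow> nat \<Rightarrow> 'a \<Rightarrow> real^2^2" where
  "cocycle_neg T A 0 x = mat 1"
| "cocycle_neg T A (Suc n) x = matrix_inv (A ((inv T ^^ Suc n) x)) ** cocycle_neg T A n x"

definition opnorm :: "real^2^2 \<Rightarrow> real" where
  "opnorm B = onorm (\<lambda>v. B *v v)"

definition top_lyap :: "('a \<Rightarrow> 'a) \<Rightarrow> ('a \<Rightarrow> real^2^2) \<Rightarrow> 'a \<Rightarrow> real" where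
  "top_lyap T A x = lim (\<lambda>n. ln (opnorm (cocycle T A n x)) / real n)"

definition LE :: "'a measure \<Rightarrow> ('a \<Rightarrow> 'a) \<Rightarrow> ('a \<Rightarrow> real^2^2) \<Rightarrow> real" where
  "LE M T A = integral\<^sup>L M (top_lyap T A)"

text \<open>Measurability of a closed-set-valued map (Effros measurability).\<close>
definition measurable_setfield :: "'a measure \<Rightarrow> ('a \<Rightarrow> (real^2) set) \<Rightarrow> bool" where
  "measurable_setfield M E \<longleftrightarrow>
     (\<forall>U. open U \<longrightarrow> {x\<in>space M. E x \<inter> U \<noteq> {}} \<in> sets M)"

definition unif_hyperbolic :: "'a measure \<Rightarrow> ('a \<Rightarrow> 'a) \<Rightarrow> ('a \<Rightarrow> real^2^2) \<Rightarrow> bool" where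
  "unif_hyperbolic M T A \<longleftrightarrow>
     (\<exists>Eu Es :: 'a \<Rightarrow> (real^2) set. \<exists>C \<tau> :: real.
        measurable_setfield M Eu \<and> measurable_setfield M Es \<and>
        C > 0 \<and> 0 < \<tau> \<and> \<tau> < 1 \<and>
        (AE x in M.
           subspace (Eu x) \<and> subspace (Es x) \<and>
           Eu x + Es x = UNIV \<and> Eu x \<inter> Es x = {0} \<and>
           (\<lambda>v. A x *v v) ` Eu x = Eu (T x) \<and>
           (\<lambda>v. A x *v v) ` Es x = Es (T x) \<and>
           (\<forall>n. \<forall>v\<in>Es x. norm (cocycle T A n x *v v) \<le> C * \<tau> ^ n * norm v) \<and>
           (\<forall>n. \<forall>v\<in>Eu x. norm (cocycle_neg T A n x *v v) \<le> C * \<tau> ^ n * norm v)))"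

text \<open>The space C(X, SL(2,R)) inside the bounded continuous functions (uniform metric).\<close>
definition SL2C :: "('a::topological_space \<Rightarrow>\<^sub>C (real^2^2)) set" where
  "SL2C = {f. \<forall>x. det (apply_bcontfun f x) = 1}"

definition residual_in :: "'b::topological_space set \<Rightarrow> 'b set \<Rightarrow> bool" where
  "residual_in S R \<longleftrightarrow> R \<subseteq> S \<and>
     (\<exists>U :: nat \<Rightarrow> 'b set. (\<forall>n. openin (top_of_set S) (U n) \<and> S \<subseteq> closure (U n))
        \<and> (\<Inter>n. U n) \<subseteq> R)"

end

theory Submission
  imports Defs
begin

text \<open>
  Let \<open>L(A)\<close> be the infimum over \<open>n\<close> of \<open>1/n\<close> times the integral of \<open>ln \<parallel>A\<^sup>n\<parallel>\<close>. The sets \<open>{L < \<epsilon>}\<close> are open, so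
  \<open>{L < \<epsilon>}\<close> together with the complement of its closure is open and dense, and it suffices to show that
  a cocycle \<open>A\<close> which is not uniformly hyperbolic is a limit of cocycles with arbitrarily small \<open>L\<close>.

  Perturb \<open>A(x)\<close> to \<open>A(x) R(\<theta>)\<close> with rotations \<open>R(\<theta>)\<close>, \<open>|\<theta>| \<le> \<eta>\<close>. If along some orbit segment these controls
  cannot steer every direction to every other one, the arc of reachable directions is a cone that is
  strictly enlarged at each step, which forces \<open>\<parallel>A\<^sup>n\<parallel>\<close> to grow like \<open>c \<kappa>\<^sup>n\<close> with \<open>c, \<kappa>\<close> depending only on \<open>\<eta>\<close>.
  Uniform growth of this kind implies uniform hyperbolicity. Hence for non-hyperbolic \<open>A\<close> every direction can
  be steered to every other one from a set of positive measure, which almost every orbit visits.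

  Let \<open>V n x\<close> be the infimum of \<open>ln \<parallel>\<cdot>\<parallel>\<close> over all controlled products of length \<open>n\<close> at \<open>x\<close>. It is subadditive
  with some mean growth rate \<open>\<gamma>\<close>. Joining two nearly optimal blocks of length \<open>n\<close> by a steering segment that sends
  the expanded direction of the first to the contracted direction of the second gives a product of length
  about \<open>2n\<close> whose norm is at most about \<open>exp (\<gamma> n)\<close>; thus \<open>2\<gamma> \<le> \<gamma>\<close> and \<open>\<gamma> = 0\<close>. Optimal blocks are
  pasted together over a skyscraper with a small base into a measurable perturbation, and this one is
  replaced by a continuous one that is close in \<open>L\<^sup>1\<close>. If there are no sets of small positive measure,
  positive \<open>L\<close> already gives uniform growth.
\<close>


section \<open>Plane linear algebra\<close>

text \<open>\<open>T\<close> is only measurable, so uniformity cannot be drawn from continuity of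
  the dynamics: every constant has to come from \<open>\<eta>\<close> and a bound on
  \<open>A\<close>, and a failure of the growth bound has to be seen on a set of positive measure at
  one fixed time. This is why the cone estimate is quantitative.

  Minimising over controls for each starting point separately separates the geometry from the
  construction of a perturbation, since \<open>V\<close> may use different controls at the same
  point for different starting times. The inequality \<open>2\<gamma> \<le> \<gamma>\<close> arises
  because \<open>\<gamma>\<close> is an infimum of means: length \<open>2n\<close> costs at least
  \<open>2\<gamma>n\<close> on average, while two cancelling blocks cost only about
  \<open>\<gamma>n\<close>.

  Logarithms of norms of determinant-one matrices are nonnegative, so the upper halves of the
  theorems of Birkhoff and Kingman suffice. A measurable control may be replaced by a continuous one
  because, at a fixed time \<open>N\<close>, the mean of
  \<open>ln \<parallel>A\<^sup>N\<parallel>\<close> is Lipschitz in the \<open>L\<^sup>1\<close>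
  distance of uniformly bounded cocycles. The base of the skyscraper must be small since every
  return to it can interrupt a block.\<close>

definition crs :: "real^2 \<Rightarrow> real^2 \<Rightarrow> real" where
  "crs p q = p$1 * q$2 - p$2 * q$1"

definition quarter_turn :: "real^2 \<Rightarrow> real^2" where
  "quarter_turn v = vector [- v$2, v$1]"

definition rot :: "real \<Rightarrow> real^2^2" where
  "rot t = vector [vector [cos t, - sin t], vector [sin t, cos t]]"

lemma vec2_eq_iff: "(v :: 'b^2) = w \<longleftrightarrow> v$1 = w$1 \<and> v$2 = w$2"
  by (simp add: vec_eq_iff forall_2)

lemma norm_vec2: "(norm (v :: real^2))\<^sup>2 = (v$1)\<^sup>2 + (v$2)\<^sup>2"
  unfolding power2_norm_eq_inner by (simp add: inner_vec_def sum_2 power2_eq_square)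

lemma mult_vec2: "(M :: real^2^2) *v v = vector [M$1$1 * v$1 + M$1$2 * v$2, M$2$1 * v$1 + M$2$2 * v$2]"
  by (simp add: vec2_eq_iff matrix_vector_mult_def sum_2)

lemma crs_mult: "crs (M *v p) (M *v q) = det M * crs p q"
  by (simp add: crs_def mult_vec2 det_2 algebra_simps)

lemma crs_sq: "(crs p q)\<^sup>2 + (inner p q)\<^sup>2 = (norm p)\<^sup>2 * (norm q)\<^sup>2"
  unfolding norm_vec2 by (simp add: crs_def inner_vec_def sum_2 power2_eq_square algebra_simps)

lemma crs_le: "\<bar>crs p q\<bar> \<le> norm p * norm q"
proof -
  have "(crs p q)\<^sup>2 \<le> (norm p * norm q)\<^sup>2"
    using crs_sq[of p q] by (simp add: power_mult_distrib) (metis le_add_same_cancel1 zero_le_power2)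
  then show ?thesis by (rule abs_le_square_iff[THEN iffD2, THEN order_trans]) simp
qed

text \<open>For unit vectors \<open>\<bar>crs p q\<bar>\<close> is the sine of the angle between two
  lines, a sign-independent distance of directions. The inequality is the addition formula of the
  sine, written in coordinates.\<close>

lemma crs_triangle:
  assumes "norm p = 1" "norm q = 1" "norm r = 1"
  shows "\<bar>crs p r\<bar> \<le> \<bar>crs p q\<bar> + \<bar>crs q r\<bar>"
proof -
  have "crs p r * (norm q)\<^sup>2 = crs p q * inner q r + inner p q * crs q r"
    unfolding norm_vec2 by (simp add: crs_def inner_vec_def sum_2 power2_eq_square algebra_simps)
  then have "crs p r = crs p q * inner q r + inner p q * crs q r" using assms by simp
  then have "\<bar>crs p r\<bar> \<le> \<bar>crs p q\<bar> * \<bar>inner q r\<bar> + \<bar>inner p q\<bar> * \<bar>crs q r\<bar>"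
    by (metis abs_mult abs_triangle_ineq)
  moreover have "\<bar>inner q r\<bar> \<le> 1" "\<bar>inner p q\<bar> \<le> 1"
    using Cauchy_Schwarz_ineq2[of q r] Cauchy_Schwarz_ineq2[of p q] assms by auto
  ultimately show ?thesis
    by (smt (verit) abs_ge_zero mult_left_le mult_left_le_one_le)
qed

lemma norm_quarter_turn [simp]: "norm (quarter_turn v) = norm v"
proof -
  have "(norm (quarter_turn v))\<^sup>2 = (norm v)\<^sup>2" by (simp add: norm_vec2 quarter_turn_def)
  then show ?thesis by simp
qed

lemma crs_quarter_turn: "crs v (quarter_turn v) = (norm v)\<^sup>2"
  unfolding norm_vec2 by (simp add: crs_def quarter_turn_def power2_eq_square)

lemma orthonormal_decomp:
  assumes "norm s = 1"
  shows "v = inner v s *\<^sub>R s + crs s v *\<^sub>R quarter_turn s"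
proof -
  have *: "s$1 * s$1 + s$2 * s$2 = 1" using assms norm_vec2[of s] by (simp add: power2_eq_square)
  have "v$1 = v$1 * (s$1 * s$1 + s$2 * s$2)" "v$2 = v$2 * (s$1 * s$1 + s$2 * s$2)"
    using * by simp_all
  then show ?thesis
    by (simp add: vec2_eq_iff crs_def quarter_turn_def inner_vec_def sum_2 algebra_simps)
qed

section \<open>The operator norm\<close>

lemma opnorm_bound: "norm (M *v v) \<le> opnorm M * norm v"
  unfolding opnorm_def by (rule onorm) simp

lemma opnorm_nonneg: "0 \<le> opnorm M"
  unfolding opnorm_def by (rule onorm_pos_le) simp

lemma opnorm_le: "(\<And>v. norm (M *v v) \<le> b * norm v) \<Longrightarrow> opnorm M \<le> b"
  unfolding opnorm_def by (rule onorm_le)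

lemma opnorm_mult: "opnorm (M ** N) \<le> opnorm M * opnorm N"
proof (rule opnorm_le)
  fix v
  have "norm (M *v (N *v v)) \<le> opnorm M * (opnorm N * norm v)"
    by (meson opnorm_bound opnorm_nonneg mult_left_mono order_trans)
  then show "norm ((M ** N) *v v) \<le> opnorm M * opnorm N * norm v"
    by (simp add: matrix_vector_mul_assoc mult.assoc)
qed

lemma opnorm_triangle: "opnorm (M + N) \<le> opnorm M + opnorm N"
proof (rule opnorm_le)
  fix v
  show "norm ((M + N) *v v) \<le> (opnorm M + opnorm N) * norm v"
    using opnorm_bound[of M v] opnorm_bound[of N v] norm_triangle_ineq[of "M *v v" "N *v v"]
    by (simp add: matrix_vector_mult_add_rdistrib algebra_simps)
qed

lemma opnorm_diff_le: "opnorm M \<le> opnorm N + opnorm (M - N)"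
  using opnorm_triangle[of N "M - N"] by simp

lemma opnorm_minus_commute: "opnorm (M - N) = opnorm (N - M)"
proof -
  have "(M - N) *v v = - ((N - M) *v v)" for v
    by (simp add: matrix_vector_mult_diff_rdistrib)
  then show ?thesis by (simp add: opnorm_def onorm_neg)
qed

lemma opnorm_le_norm: "opnorm M \<le> 2 * norm (M :: real^2^2)"
proof (rule opnorm_le)
  fix v
  have e: "\<bar>M$i$j\<bar> \<le> norm M" for i j
    by (meson component_le_norm_cart Finite_Cartesian_Product.norm_nth_le order_trans)
  have c: "\<bar>(M *v v)$i\<bar> \<le> norm M * (\<bar>v$1\<bar> + \<bar>v$2\<bar>)" for i
  proof -
    have "\<bar>(M *v v)$i\<bar> = \<bar>M$i$1 * v$1 + M$i$2 * v$2\<bar>" by (simp add: matrix_vector_mult_def sum_2)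
    also have "\<dots> \<le> \<bar>M$i$1\<bar> * \<bar>v$1\<bar> + \<bar>M$i$2\<bar> * \<bar>v$2\<bar>"
      by (metis abs_mult abs_triangle_ineq)
    also have "\<dots> \<le> norm M * \<bar>v$1\<bar> + norm M * \<bar>v$2\<bar>"
      by (intro add_mono mult_right_mono e) auto
    finally show ?thesis by (simp add: algebra_simps)
  qed
  have "(norm (M *v v))\<^sup>2 = \<bar>(M *v v)$1\<bar>\<^sup>2 + \<bar>(M *v v)$2\<bar>\<^sup>2" by (simp add: norm_vec2)
  also have "\<dots> \<le> (norm M * (\<bar>v$1\<bar> + \<bar>v$2\<bar>))\<^sup>2 + (norm M * (\<bar>v$1\<bar> + \<bar>v$2\<bar>))\<^sup>2"
    by (intro add_mono power_mono c) auto
  also have "\<dots> = 2 * (norm M)\<^sup>2 * (\<bar>v$1\<bar> + \<bar>v$2\<bar>)\<^sup>2" by (simp add: power_mult_distrib)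
  also have "\<dots> \<le> 2 * (norm M)\<^sup>2 * (2 * (norm v)\<^sup>2)"
  proof (rule mult_left_mono)
    show "(\<bar>v$1\<bar> + \<bar>v$2\<bar>)\<^sup>2 \<le> 2 * (norm v)\<^sup>2"
      using sum_squares_bound[of "\<bar>v$1\<bar>" "\<bar>v$2\<bar>"] by (simp add: norm_vec2 power2_sum)
  qed simp
  also have "\<dots> = (2 * norm M * norm v)\<^sup>2" by (simp add: power_mult_distrib)
  finally show "norm (M *v v) \<le> 2 * norm M * norm v"
    by (rule power2_le_imp_le) simp
qed

lemma continuous_on_opnorm: "continuous_on UNIV opnorm"
proof -
  have l: "\<bar>opnorm M - opnorm N\<bar> \<le> 2 * norm (M - N)" for M N
    using opnorm_diff_le[of M N] opnorm_diff_le[of N M] opnorm_le_norm[of "M - N"]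
      opnorm_minus_commute[of M N] by linarith
  have "2-lipschitz_on UNIV opnorm"
    by (rule lipschitz_onI) (auto simp: dist_norm l)
  then show ?thesis by (rule lipschitz_on_continuous_on)
qed

lemma opnorm_measurable [measurable]: "opnorm \<in> borel_measurable borel"
  by (intro borel_measurable_continuous_onI continuous_on_opnorm)

section \<open>Determinant one: singular directions and inverses\<close>

lemma det1_inverse:
  fixes M :: "real^2^2"
  assumes "det M = 1"
  shows "matrix_inv M ** M = mat 1" "M ** matrix_inv M = mat 1" "det (matrix_inv M) = 1"
proof -
  have i: "invertible M" using assms by (simp add: invertible_det_nz)
  show 1: "matrix_inv M ** M = mat 1" "M ** matrix_inv M = mat 1"
    using i unfolding invertible_def matrix_inv_def by (metis (mono_tags, lifting) someI_ex)+
  show "det (matrix_inv M) = 1"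
    using det_mul[of "matrix_inv M" M] assms 1 by simp
qed

text \<open>The part of the singular value decomposition that is needed. The least stretching on the
  unit circle is attained by compactness, and preservation of area forces it to be the reciprocal of
  the largest.\<close>

lemma contracted_direction:
  assumes "det M = 1"
  obtains s where "norm s = 1" "norm (M *v s) * opnorm M = 1"
proof -
  have ne: "sphere (0::real^2) 1 \<noteq> {}" by (simp add: sphere_empty)
  have "continuous_on (sphere 0 1) (\<lambda>v. norm (M *v v))"
    by (intro continuous_intros)
  then obtain s where s: "norm s = 1" and min: "\<And>v. norm v = 1 \<Longrightarrow> norm (M *v s) \<le> norm (M *v v)"
    using continuous_attains_inf[OF compact_sphere ne] by (metis dist_0_norm mem_sphere)
  \<comment> \<open>\<open>s\<close> and its quarter turn span a unit square, whose image still has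
    area one.\<close>
  have "1 = \<bar>crs (M *v s) (M *v quarter_turn s)\<bar>"
    using assms s by (simp add: crs_mult crs_quarter_turn)
  also have "\<dots> \<le> norm (M *v s) * norm (M *v quarter_turn s)" by (rule crs_le)
  also have "\<dots> \<le> norm (M *v s) * opnorm M"
    using opnorm_bound[of M "quarter_turn s"] s by (intro mult_left_mono) auto
  finally have ge: "1 \<le> norm (M *v s) * opnorm M" .
  then have pos: "norm (M *v s) > 0" by (cases "norm (M *v s) = 0") auto
  have low: "norm (M *v s) * norm v \<le> norm (M *v v)" for v
  proof (cases "v = 0")
    case False
    have "norm (M *v s) \<le> norm (M *v ((1 / norm v) *\<^sub>R v))" by (rule min) (use False in simp)
    also have "\<dots> = norm (M *v v) / norm v" by (simp add: matrix_vector_mult_scaleR divide_inverse)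
    finally show ?thesis using False by (simp add: field_simps)
  qed simp
  have "opnorm M \<le> 1 / norm (M *v s)"
  proof (rule opnorm_le)
    fix u
    \<comment> \<open>The vector whose image is perpendicular to \<open>M *v u\<close> and equally
      long: together with \<open>u\<close> it spans the area \<open>(norm (M *v u))\<^sup>2\<close>,
      while \<open>low\<close> bounds its length.\<close>
    define w where "w = matrix_inv M *v quarter_turn (M *v u)"
    have Mw: "M *v w = quarter_turn (M *v u)"
      using det1_inverse[OF assms] by (simp add: w_def matrix_vector_mul_assoc)
    have "(norm (M *v u))\<^sup>2 = crs (M *v u) (M *v w)" by (simp add: Mw crs_quarter_turn)
    also have "\<dots> = crs u w" using assms by (simp add: crs_mult)
    also have "\<dots> \<le> norm u * norm w" using crs_le[of u w] by linarith
    also have "\<dots> \<le> norm u * (norm (M *v u) / norm (M *v s))"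
      using low[of w] pos by (intro mult_left_mono) (auto simp: Mw field_simps)
    finally have "(norm (M *v u))\<^sup>2 \<le> norm (M *v u) * (norm u / norm (M *v s))"
      by (simp add: field_simps)
    then show "norm (M *v u) \<le> 1 / norm (M *v s) * norm u"
      by (cases "norm (M *v u) = 0") (auto simp: power2_eq_square simp del: times_divide_eq_right)
  qed
  then have "norm (M *v s) * opnorm M \<le> 1" using pos by (simp add: field_simps)
  with ge s that show thesis by (metis order_antisym)
qed

lemma opnorm_ge_1:
  assumes "det M = 1"
  shows "opnorm M \<ge> 1"
proof -
  obtain s where s: "norm s = 1" "norm (M *v s) * opnorm M = 1"
    using contracted_direction[OF assms] by blast
  have "1 \<le> opnorm M * opnorm M"
    using s opnorm_bound[of M s] opnorm_nonneg[of M] by (metis mult.right_neutral mult_right_mono)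
  then show ?thesis using opnorm_nonneg[of M] mult_left_le[of "opnorm M" "opnorm M"]
    by (smt (verit) mult_le_one)
qed

text \<open>Area again: the image of \<open>s\<close> is so short that any \<open>v\<close> at a
  definite angle to \<open>s\<close> must be stretched to compensate. Read backwards, a vector with
  small image lies close to \<open>s\<close>; this is how norms are turned into angles.\<close>

lemma contracted_lower:
  assumes "det M = 1" "norm (M *v s) * opnorm M = 1"
  shows "opnorm M * \<bar>crs s v\<bar> \<le> norm (M *v v)"
proof -
  have "\<bar>crs s v\<bar> = \<bar>crs (M *v s) (M *v v)\<bar>" using assms by (simp add: crs_mult)
  also have "\<dots> \<le> norm (M *v s) * norm (M *v v)" by (rule crs_le)
  finally have "opnorm M * \<bar>crs s v\<bar> \<le> opnorm M * (norm (M *v s) * norm (M *v v))"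
    using opnorm_nonneg[of M] by (rule mult_left_mono)
  also have "\<dots> = norm (M *v v)" using assms(2) by (simp add: mult.assoc[symmetric] mult.commute)
  finally show ?thesis .
qed

lemma contracted_upper:
  assumes "norm s = 1" "norm (M *v s) * opnorm M = 1" "norm v = 1"
  shows "norm (M *v v) \<le> 1 / opnorm M + opnorm M * \<bar>crs s v\<bar>"
proof -
  have "M *v v = M *v (inner v s *\<^sub>R s + crs s v *\<^sub>R quarter_turn s)"
    using orthonormal_decomp[OF assms(1), of v] by simp
  also have "\<dots> = inner v s *\<^sub>R (M *v s) + crs s v *\<^sub>R (M *v quarter_turn s)"
    by (simp add: matrix_vector_right_distrib matrix_vector_mult_scaleR)
  finally have "norm (M *v v) \<le> \<bar>inner v s\<bar> * norm (M *v s) + \<bar>crs s v\<bar> * norm (M *v quarter_turn s)"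
    by (metis norm_scaleR norm_triangle_ineq real_norm_def)
  also have "\<dots> \<le> 1 * norm (M *v s) + \<bar>crs s v\<bar> * opnorm M"
    using Cauchy_Schwarz_ineq2[of v s] assms opnorm_bound[of M "quarter_turn s"]
    by (intro add_mono mult_right_mono mult_left_mono) auto
  also have "norm (M *v s) = 1 / opnorm M"
    using assms(2) by (metis mult_zero_right nonzero_eq_divide_eq zero_neq_one)
  finally show ?thesis by (simp add: mult.commute)
qed

text \<open>The images of \<open>v\<close> and of its quarter turn span the area
  \<open>(norm v)\<^sup>2\<close>, and the second image has length at most
  \<open>opnorm M * norm v\<close>.\<close>

lemma det1_norm_le:
  assumes "det M = 1"
  shows "norm v \<le> opnorm M * norm (M *v v)"
proof -
  have "(norm v)\<^sup>2 = crs (M *v v) (M *v quarter_turn v)"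
    using assms by (simp add: crs_mult crs_quarter_turn)
  also have "\<dots> \<le> norm (M *v v) * norm (M *v quarter_turn v)"
    using crs_le[of "M *v v" "M *v quarter_turn v"] by linarith
  also have "\<dots> \<le> norm (M *v v) * (opnorm M * norm v)"
    using opnorm_bound[of M "quarter_turn v"] by (intro mult_left_mono) auto
  finally have "norm v * norm v \<le> norm v * (opnorm M * norm (M *v v))"
    by (simp add: power2_eq_square algebra_simps)
  then show ?thesis
    by (cases "v = 0") (auto simp: opnorm_nonneg)
qed

lemma opnorm_matrix_inv:
  assumes "det M = 1"
  shows "opnorm (matrix_inv M) = opnorm M"
proof -
  have *: "opnorm (matrix_inv N) \<le> opnorm N" if "det N = 1" for N
  proof (rule opnorm_le)
    fix v
    show "norm (matrix_inv N *v v) \<le> opnorm N * norm v"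
      using det1_norm_le[OF that, of "matrix_inv N *v v"] det1_inverse[OF that]
      by (simp add: matrix_vector_mul_assoc)
  qed
  have "matrix_inv (matrix_inv M) = M"
    using det1_inverse[OF assms] det1_inverse[OF det1_inverse(3)[OF assms]]
    by (metis matrix_mul_assoc matrix_mul_lid matrix_mul_rid)
  then show ?thesis using *[OF assms] *[OF det1_inverse(3)[OF assms]] by simp
qed

section \<open>Rotations\<close>

lemma det_rot [simp]: "det (rot t) = 1"
  using sin_cos_squared_add2[of t] by (simp add: rot_def det_2 power2_eq_square)

lemma norm_rot [simp]: "norm (rot t *v v) = norm v"
proof -
  have "(norm (rot t *v v))\<^sup>2 = ((cos t)\<^sup>2 + (sin t)\<^sup>2) * (norm v)\<^sup>2"
    unfolding norm_vec2 mult_vec2 rot_def vector_2 by algebra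
  then show ?thesis by simp
qed

lemma opnorm_rot [simp]: "opnorm (rot t) = 1"
  using opnorm_le[of "rot t" 1] opnorm_ge_1[of "rot t"] by simp

lemma rot_0 [simp]: "rot 0 = mat 1"
  by (simp add: rot_def mat_def vec2_eq_iff)

lemma opnorm_rot_diff: "opnorm (rot s - rot t) \<le> 2 * \<bar>s - t\<bar>"
proof (rule opnorm_le)
  fix v
  have c: "\<bar>cos s - cos t\<bar> \<le> \<bar>s - t\<bar>" and d: "\<bar>sin s - sin t\<bar> \<le> \<bar>s - t\<bar>"
    using abs_sin_x_le_abs_x[of "(s - t) / 2"] abs_sin_x_le_abs_x[of "(t - s) / 2"]
      mult_mono[of "\<bar>sin ((s - t) / 2)\<bar>" "\<bar>s - t\<bar> / 2" "\<bar>cos ((s + t) / 2)\<bar>" 1]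
      mult_mono[of "\<bar>sin ((t - s) / 2)\<bar>" "\<bar>s - t\<bar> / 2" "\<bar>sin ((s + t) / 2)\<bar>" 1]
    by (simp_all add: sin_diff_sin cos_diff_cos abs_mult abs_minus_commute mult_ac)
  have "(rot s - rot t) *v v = (cos s - cos t) *\<^sub>R v + (sin s - sin t) *\<^sub>R quarter_turn v"
    by (simp add: vec2_eq_iff rot_def mult_vec2 quarter_turn_def algebra_simps)
  then have "norm ((rot s - rot t) *v v) \<le> \<bar>cos s - cos t\<bar> * norm v + \<bar>sin s - sin t\<bar> * norm v"
    by (metis norm_quarter_turn norm_scaleR norm_triangle_ineq real_norm_def)
  also have "\<dots> \<le> \<bar>s - t\<bar> * norm v + \<bar>s - t\<bar> * norm v"
    by (intro add_mono mult_right_mono c d) auto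
  finally show "norm ((rot s - rot t) *v v) \<le> 2 * \<bar>s - t\<bar> * norm v" by (simp add: mult_ac)
qed

section \<open>Uniform growth yields a contracted direction\<close>

lemma cocycle_add: "cocycle T A (m + n) x = cocycle T A m ((T ^^ n) x) ** cocycle T A n x"
proof (induction m)
  case (Suc m)
  then show ?case by (simp add: matrix_mul_assoc funpow_add)
qed simp

lemma opnorm_mat_1: "opnorm (mat 1) = 1"
  using opnorm_rot[of 0] by simp

fun matprod :: "(nat \<Rightarrow> real^2^2) \<Rightarrow> nat \<Rightarrow> real^2^2" where
  "matprod B 0 = mat 1"
| "matprod B (Suc n) = B n ** matprod B n"

lemma cocycle_matprod: "cocycle T A n x = matprod (\<lambda>i. A ((T ^^ i) x)) n"
  by (induction n) auto

lemma det_matprod: "(\<And>i. det (B i) = 1) \<Longrightarrow> det (matprod B n) = 1"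
  by (induction n) (auto simp: det_mul)

lemma opnorm_matprod_le:
  assumes "\<And>i. opnorm (B i) \<le> \<Lambda>"
  shows "opnorm (matprod B n) \<le> \<Lambda> ^ n"
proof (induction n)
  case (Suc n)
  have "0 \<le> \<Lambda>" using assms opnorm_nonneg order_trans by blast
  have "opnorm (matprod B (Suc n)) \<le> opnorm (B n) * opnorm (matprod B n)"
    by (simp add: opnorm_mult)
  also have "\<dots> \<le> \<Lambda> * \<Lambda> ^ n"
    by (intro mult_mono Suc opnorm_nonneg \<open>0 \<le> \<Lambda>\<close> assms)
  finally show ?case by simp
qed (simp add: opnorm_mat_1)

lemma det_cocycle: "(\<And>y. det (A y) = 1) \<Longrightarrow> det (cocycle T A n x) = 1"
  unfolding cocycle_matprod by (rule det_matprod)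

lemma opnorm_cocycle_le: "(\<And>y. opnorm (A y) \<le> \<Lambda>) \<Longrightarrow> opnorm (cocycle T A n x) \<le> \<Lambda> ^ n"
  unfolding cocycle_matprod by (rule opnorm_matprod_le)

abbreviation log_growth :: "('a \<Rightarrow> 'a) \<Rightarrow> ('a \<Rightarrow> real^2^2) \<Rightarrow> nat \<Rightarrow> 'a \<Rightarrow> real" where
  "log_growth T A n x \<equiv> ln (opnorm (cocycle T A n x))"

text \<open>Bounded along some unbounded sequence of times only. In this weak form the property is
  shift invariant and survives a limit of contracted directions; \<open>uniform_decay\<close>
  upgrades it to exponential decay, so it describes the stable space without constants.\<close>

definition recurrent_bounded :: "('a \<Rightarrow> 'a) \<Rightarrow> ('a \<Rightarrow> real^2^2) \<Rightarrow> 'a \<Rightarrow> real^2 \<Rightarrow> bool" where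
  "recurrent_bounded T A x v \<longleftrightarrow> (\<exists>B. \<forall>N. \<exists>n\<ge>N. norm (cocycle T A n x *v v) \<le> B)"

lemma recurrent_bounded_step:
  "recurrent_bounded T A (T x) (A x *v v) \<longleftrightarrow> recurrent_bounded T A x v"
proof -
  have e: "cocycle T A n (T x) *v (A x *v v) = cocycle T A (Suc n) x *v v" for n
    using cocycle_add[of T A n 1 x] by (simp add: matrix_vector_mul_assoc)
  show ?thesis
  proof
    assume "recurrent_bounded T A (T x) (A x *v v)"
    then obtain B where "\<And>N. \<exists>n\<ge>N. norm (cocycle T A (Suc n) x *v v) \<le> B"
      unfolding recurrent_bounded_def e by blast
    then show "recurrent_bounded T A x v"
      unfolding recurrent_bounded_def by (meson Suc_leD Suc_le_mono)
  next
    assume "recurrent_bounded T A x v"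
    then obtain B where B: "\<And>N. \<exists>n\<ge>N. norm (cocycle T A n x *v v) \<le> B"
      unfolding recurrent_bounded_def by blast
    have "\<exists>n\<ge>N. norm (cocycle T A (Suc n) x *v v) \<le> B" for N
    proof -
      obtain n where "n \<ge> Suc N" "norm (cocycle T A n x *v v) \<le> B" using B by blast
      then show ?thesis by (intro exI[of _ "n - 1"]) auto
    qed
    then show "recurrent_bounded T A (T x) (A x *v v)"
      unfolding recurrent_bounded_def e by blast
  qed
qed

lemma recurrent_bounded_iterate:
  "recurrent_bounded T A ((T ^^ n) x) (cocycle T A n x *v v) \<longleftrightarrow> recurrent_bounded T A x v"
proof (induction n)
  case (Suc n)
  then show ?case
    using recurrent_bounded_step[of T A "(T ^^ n) x" "cocycle T A n x *v v"]
    by (simp add: matrix_vector_mul_assoc)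
qed simp

text \<open>Growth is assumed from the single point \<open>x\<close>; other points of the orbit, and
  the inverse dynamics, enter as further instances with the same constants.\<close>

locale growing_orbit =
  fixes T :: "'a \<Rightarrow> 'a" and A :: "'a \<Rightarrow> real^2^2" and x :: 'a and c \<kappa> \<Lambda> :: real
  assumes det1: "\<And>y. det (A y) = 1"
    and bounded: "\<And>y. opnorm (A y) \<le> \<Lambda>"
    and c_pos: "c > 0" and kappa_gt1: "\<kappa> > 1"
    and growth: "\<And>n. c * \<kappa> ^ n \<le> opnorm (cocycle T A n x)"
begin

abbreviation a where "a n \<equiv> opnorm (cocycle T A n x)"

definition s where
  "s n = (SOME s. norm s = 1 \<and> norm (cocycle T A n x *v s) * a n = 1)"

lemma s_unit: "norm (s n) = 1" and s_contracted: "norm (cocycle T A n x *v s n) * a n = 1"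
proof -
  have "\<exists>s. norm s = 1 \<and> norm (cocycle T A n x *v s) * a n = 1"
    by (rule contracted_direction[OF det_cocycle[of A T n x, OF det1]]) blast
  from someI_ex[OF this] show "norm (s n) = 1" "norm (cocycle T A n x *v s n) * a n = 1"
    by (auto simp: s_def)
qed

lemma a_ge1: "a n \<ge> 1"
  by (intro opnorm_ge_1 det_cocycle det1)

lemma Lambda_ge1: "\<Lambda> \<ge> 1"
  using opnorm_ge_1[OF det1] bounded order_trans by blast

text \<open>Undoing one factor costs at most \<open>\<Lambda>\<close>, so \<open>s (Suc n)\<close>
  is still short at time \<open>n\<close>, of length at most \<open>\<Lambda> / a (Suc n)\<close>.
  By \<open>contracted_lower\<close> it is then close to \<open>s n\<close>.\<close>

lemma s_Suc: "a n * \<bar>crs (s n) (s (Suc n))\<bar> \<le> \<Lambda> / a (Suc n)"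
proof -
  have "a n * \<bar>crs (s n) (s (Suc n))\<bar> \<le> norm (cocycle T A n x *v s (Suc n))"
    by (intro contracted_lower det_cocycle det1 s_contracted)
  also have "\<dots> \<le> opnorm (A ((T ^^ n) x)) * norm (A ((T ^^ n) x) *v (cocycle T A n x *v s (Suc n)))"
    by (rule det1_norm_le[OF det1])
  also have "\<dots> \<le> \<Lambda> * norm (cocycle T A (Suc n) x *v s (Suc n))"
    using bounded by (simp add: matrix_vector_mul_assoc mult_right_mono)
  also have "norm (cocycle T A (Suc n) x *v s (Suc n)) = 1 / a (Suc n)"
    using s_contracted[of "Suc n"] a_ge1[of "Suc n"] by (simp add: field_simps)
  finally show ?thesis by simp
qed

text \<open>\<open>K / \<kappa> ^ m\<close> collects \<open>1 / (c * \<kappa> ^ m)\<close>, which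
  bounds \<open>1 / a m\<close>, and the geometric series of
  \<open>\<Lambda> / (c * \<kappa> ^ Suc k)\<close> over \<open>k \<ge> m\<close>, which bounds the
  total turn of the contracted directions scaled by \<open>a m\<close>.\<close>

definition K where "K = (1 + \<Lambda> / (\<kappa> - 1)) / c"

text \<open>At a record time the weight \<open>a k\<close> that comes with each angle in
  \<open>s_Suc\<close> may be lowered to \<open>a m\<close>. The angles then sum to a geometric
  series, kept in telescoped form so that the induction closes.\<close>

lemma s_dist:
  assumes rec: "\<And>k. k \<ge> m \<Longrightarrow> a m \<le> a k"
  shows "a m * \<bar>crs (s m) (s (m + j))\<bar> \<le> \<Lambda> / (c * (\<kappa> - 1)) * (1 / \<kappa> ^ m - 1 / \<kappa> ^ (m + j))"
proof (induction j)
  case 0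
  show ?case by (simp add: crs_def mult.commute)
next
  case (Suc j)
  let ?n = "m + j"
  have pos: "c * \<kappa> ^ Suc ?n > 0" using c_pos kappa_gt1 by simp
  have "a m * \<bar>crs (s ?n) (s (Suc ?n))\<bar> \<le> a ?n * \<bar>crs (s ?n) (s (Suc ?n))\<bar>"
    by (intro mult_right_mono rec) auto
  also have "\<dots> \<le> \<Lambda> / a (Suc ?n)" by (rule s_Suc)
  also have "\<dots> \<le> \<Lambda> / (c * \<kappa> ^ Suc ?n)"
    using growth[of "Suc ?n"] Lambda_ge1 pos a_ge1[of "Suc ?n"] by (intro divide_left_mono) auto
  also have "\<dots> = \<Lambda> / (c * (\<kappa> - 1)) * (1 / \<kappa> ^ ?n - 1 / \<kappa> ^ Suc ?n)"
    using kappa_gt1 c_pos by (simp add: field_simps)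
  finally have 1: "a m * \<bar>crs (s ?n) (s (Suc ?n))\<bar> \<le> \<Lambda> / (c * (\<kappa> - 1)) * (1 / \<kappa> ^ ?n - 1 / \<kappa> ^ Suc ?n)" .
  have "a m * \<bar>crs (s m) (s (Suc ?n))\<bar> \<le> a m * (\<bar>crs (s m) (s ?n)\<bar> + \<bar>crs (s ?n) (s (Suc ?n))\<bar>)"
    by (intro mult_left_mono crs_triangle s_unit opnorm_nonneg)
  also have "\<dots> = a m * \<bar>crs (s m) (s ?n)\<bar> + a m * \<bar>crs (s ?n) (s (Suc ?n))\<bar>"
    by (simp add: algebra_simps)
  also have "\<dots> \<le> \<Lambda> / (c * (\<kappa> - 1)) * (1 / \<kappa> ^ m - 1 / \<kappa> ^ ?n) + \<Lambda> / (c * (\<kappa> - 1)) * (1 / \<kappa> ^ ?n - 1 / \<kappa> ^ Suc ?n)"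
    by (intro add_mono 1 Suc)
  also have "\<dots> = \<Lambda> / (c * (\<kappa> - 1)) * (1 / \<kappa> ^ m - 1 / \<kappa> ^ Suc ?n)"
    by (simp only: distrib_left[symmetric]) simp
  finally show ?case by simp
qed

lemma s_record_upper:
  assumes rec: "\<And>k. k \<ge> m \<Longrightarrow> a m \<le> a k" and "norm v = 1" "n \<ge> m"
  shows "norm (cocycle T A m x *v v) \<le> K / \<kappa> ^ m + a m * \<bar>crs (s n) v\<bar>"
proof -
  have pos: "c * \<kappa> ^ m > 0" using c_pos kappa_gt1 by simp
  have i: "1 / a m \<le> 1 / (c * \<kappa> ^ m)"
    using growth[of m] pos a_ge1[of m] by (intro divide_left_mono) auto
  have "a m * \<bar>crs (s m) (s n)\<bar> \<le> \<Lambda> / (c * (\<kappa> - 1)) * (1 / \<kappa> ^ m - 1 / \<kappa> ^ n)"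
    using s_dist[OF rec, of "n - m"] \<open>n \<ge> m\<close> by simp
  also have "\<dots> \<le> \<Lambda> / (c * (\<kappa> - 1)) * (1 / \<kappa> ^ m)"
    using Lambda_ge1 c_pos kappa_gt1 by (intro mult_left_mono) auto
  finally have d: "a m * \<bar>crs (s m) (s n)\<bar> \<le> \<Lambda> / (c * (\<kappa> - 1)) * (1 / \<kappa> ^ m)" .
  have "norm (cocycle T A m x *v v) \<le> 1 / a m + a m * \<bar>crs (s m) v\<bar>"
    by (intro contracted_upper s_unit s_contracted assms)
  also have "\<dots> \<le> 1 / a m + a m * (\<bar>crs (s m) (s n)\<bar> + \<bar>crs (s n) v\<bar>)"
    by (intro add_left_mono mult_left_mono crs_triangle s_unit assms opnorm_nonneg)
  also have "\<dots> \<le> 1 / (c * \<kappa> ^ m) + \<Lambda> / (c * (\<kappa> - 1)) * (1 / \<kappa> ^ m) + a m * \<bar>crs (s n) v\<bar>"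
    using i d by (simp add: algebra_simps)
  also have "1 / (c * \<kappa> ^ m) + \<Lambda> / (c * (\<kappa> - 1)) * (1 / \<kappa> ^ m) = K / \<kappa> ^ m"
    using c_pos kappa_gt1 by (simp add: K_def field_simps)
  finally show ?thesis .
qed

text \<open>A bounded image at a late time \<open>n\<close> forces \<open>v\<close> within
  \<open>B / a n\<close> of \<open>s n\<close>. Letting \<open>n\<close> run through the recurrence
  times makes this error vanish in \<open>s_record_upper\<close>.\<close>

lemma recurrent_bounded_at_record:
  assumes rec: "\<And>k. k \<ge> m \<Longrightarrow> a m \<le> a k" and v: "norm v = 1" and "recurrent_bounded T A x v"
  shows "norm (cocycle T A m x *v v) \<le> K / \<kappa> ^ m"
proof (rule field_le_epsilon)
  fix e :: real assume "e > 0"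
  obtain B where B: "\<And>N. \<exists>n\<ge>N. norm (cocycle T A n x *v v) \<le> B"
    using assms unfolding recurrent_bounded_def by blast
  have B0: "B \<ge> 0" using B[of 0] norm_ge_zero order_trans by blast
  obtain N where N: "\<kappa> ^ N > a m * B / (e * c)"
    using real_arch_pow[OF kappa_gt1] by blast
  obtain n where n: "n \<ge> max N m" "norm (cocycle T A n x *v v) \<le> B" using B by blast
  have "a n \<ge> c * \<kappa> ^ N"
    using growth[of n] n power_increasing[of N n \<kappa>] kappa_gt1 c_pos
    by (meson less_imp_le max.boundedE mult_left_mono order_trans)
  with N have an: "a m * B < e * a n" using \<open>e > 0\<close> c_pos
    by (smt (verit, ccfv_SIG) divide_less_eq mult.assoc mult.commute mult_le_cancel_left_pos mult_pos_pos)
  have "a n * \<bar>crs (s n) v\<bar> \<le> B"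
    using contracted_lower[OF det_cocycle[OF det1] s_contracted[of n], of v] n by linarith
  then have "a m * (a n * \<bar>crs (s n) v\<bar>) \<le> a m * B"
    using a_ge1[of m] by (intro mult_left_mono) auto
  also note an
  finally have "a n * (a m * \<bar>crs (s n) v\<bar>) < a n * e" by (simp add: mult_ac)
  then have "a m * \<bar>crs (s n) v\<bar> \<le> e" using a_ge1[of n]
    by (smt (verit, best) mult_left_mono)
  then show "norm (cocycle T A m x *v v) \<le> K / \<kappa> ^ m + e"
    using s_record_upper[OF rec v, of n] n by auto
qed

text \<open>The minimum over the window \<open>{L..N}\<close> is a minimum over the whole future,
  because after \<open>N\<close> the guaranteed growth exceeds \<open>\<Lambda> ^ L\<close>, an
  upper bound for \<open>a L\<close>.\<close>

lemma record_exists: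
  assumes "\<And>k. k > N \<Longrightarrow> \<Lambda> ^ L < c * \<kappa> ^ k" "L \<le> N"
  obtains m where "L \<le> m" "m \<le> N" "\<And>k. k \<ge> m \<Longrightarrow> a m \<le> a k"
proof -
  have "\<exists>m. is_arg_min (\<lambda>n. a n) (\<lambda>k. k \<in> {L..N}) m"
    by (rule ex_is_arg_min_if_finite) (use assms(2) in auto)
  then obtain m where m: "m \<in> {L..N}" "\<And>k. k \<in> {L..N} \<Longrightarrow> a m \<le> a k"
    unfolding is_arg_min_linorder by blast
  have "a m \<le> a k" if "k \<ge> m" for k
  proof (cases "k \<le> N")
    case False
    have "a m \<le> a L" using m assms(2) by simp
    also have "\<dots> \<le> \<Lambda> ^ L" by (rule opnorm_cocycle_le[OF bounded])
    also have "\<dots> < c * \<kappa> ^ k" using False assms by simp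
    finally show ?thesis using growth[of k] by linarith
  qed (use m that in auto)
  with m that show thesis by auto
qed

end

lemma eventually_pow_gt:
  assumes "(c::real) > 0" "\<kappa> > 1"
  obtains N where "L \<le> N" "\<And>k. k > N \<Longrightarrow> b < c * \<kappa> ^ k"
proof -
  obtain N where N: "b / c < \<kappa> ^ N" using real_arch_pow[OF assms(2)] by blast
  have "b < c * \<kappa> ^ k" if "k > max N L" for k
  proof -
    have "b < c * \<kappa> ^ N" using N assms by (simp add: field_simps)
    also have "\<dots> \<le> c * \<kappa> ^ k" using assms that by (intro mult_left_mono power_increasing) auto
    finally show ?thesis .
  qed
  then show thesis using that[of "max N L"] by auto
qed

context growing_orbit
begin

text \<open>The vector is an accumulation point of the contracted directions. At a record
  \<open>m\<close> the estimate for \<open>s n\<close> is uniform in \<open>n \<ge> m\<close> and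
  passes to the limit, and there are records beyond every time.\<close>

lemma recurrent_bounded_exists: obtains v where "v \<noteq> 0" "recurrent_bounded T A x v"
proof -
  have "\<forall>n. s n \<in> sphere 0 1" by (simp add: s_unit)
  then obtain l r where l: "l \<in> sphere 0 1" and r: "strict_mono r" and lim: "(s \<circ> r) \<longlonglongrightarrow> l"
    using compact_sphere[of "0::real^2" 1] unfolding compact_def by metis
  have b: "norm (cocycle T A m x *v l) \<le> K / \<kappa> ^ m" if rec: "\<And>k. k \<ge> m \<Longrightarrow> a m \<le> a k" for m
  proof -
    have "(\<lambda>n. norm (cocycle T A m x *v (s \<circ> r) n)) \<longlonglongrightarrow> norm (cocycle T A m x *v l)"
      by (intro tendsto_norm bounded_linear.tendsto[OF matrix_vector_mul_bounded_linear] lim)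
    moreover have "norm (cocycle T A m x *v (s \<circ> r) n) \<le> K / \<kappa> ^ m" if "n \<ge> m" for n
      using s_record_upper[OF rec s_unit, of "r n" "r n"] seq_suble[OF r, of n] that
      by (simp add: crs_def mult.commute)
    ultimately show ?thesis by (intro LIMSEQ_le_const2) auto
  qed
  have K0: "K \<ge> 0" using c_pos kappa_gt1 Lambda_ge1 by (simp add: K_def)
  have "\<exists>n\<ge>N. norm (cocycle T A n x *v l) \<le> K" for N
  proof -
    obtain N' where "N \<le> N'" "\<And>k. k > N' \<Longrightarrow> \<Lambda> ^ N < c * \<kappa> ^ k"
      using eventually_pow_gt[OF c_pos kappa_gt1] by metis
    then obtain m where m: "N \<le> m" "\<And>k. k \<ge> m \<Longrightarrow> a m \<le> a k" using record_exists by metis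
    have "norm (cocycle T A m x *v l) \<le> K / \<kappa> ^ m" by (rule b[OF m(2)])
    also have "\<dots> \<le> K" using divide_left_mono[of 1 "\<kappa> ^ m" K] K0 kappa_gt1 by simp
    finally show ?thesis using m by blast
  qed
  then have "recurrent_bounded T A x l" unfolding recurrent_bounded_def by blast
  moreover have "l \<noteq> 0" using l by auto
  ultimately show thesis using that by blast
qed

end

lemma recurrent_bounded_scale:
  "k \<noteq> 0 \<Longrightarrow> recurrent_bounded T A x v \<Longrightarrow> recurrent_bounded T A x (k *\<^sub>R v)"
  unfolding recurrent_bounded_def matrix_vector_mult_scaleR norm_scaleR
  by (meson abs_ge_zero mult_left_mono)

text \<open>The norms \<open>a n\<close> need not grow monotonically, so the angle estimate between consecutive
  contracted directions is only useful at record times, where \<open>a m \<le> a k\<close> for all later \<open>k\<close>. Records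
  occur in every window \<open>[L, N]\<close>, hence a vector that does not escape shrinks by half within bounded
  time, from every point of the orbit.\<close>
lemma uniform_decay:
  fixes c \<kappa> \<Lambda> :: real
  assumes c: "c > 0" and kappa: "\<kappa> > 1" and Lam: "\<Lambda> \<ge> 1"
  obtains C \<tau> :: real where "C > 0" "0 < \<tau>" "\<tau> < 1"
    "\<And>(T :: 'a \<Rightarrow> 'a) A x v n. (\<And>i. growing_orbit T A ((T ^^ i) x) c \<kappa> \<Lambda>) \<Longrightarrow>
       recurrent_bounded T A x v \<Longrightarrow> norm (cocycle T A n x *v v) \<le> C * \<tau> ^ n * norm v"
proof -
  define K' where "K' = (1 + \<Lambda> / (\<kappa> - 1)) / c"
  have K0: "K' > 0" using c kappa Lam by (simp add: K'_def divide_pos_pos add_pos_pos)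
  \<comment> \<open>Past \<open>L\<close> the bound \<open>K' / \<kappa> ^ m\<close> at a record is
    at most one half.\<close>
  obtain L where L: "2 * K' < \<kappa> ^ L" "L \<ge> 1"
  proof -
    obtain L where "2 * K' < \<kappa> ^ L" using real_arch_pow[OF kappa] by blast
    also have "\<dots> \<le> \<kappa> ^ Suc L" using kappa by (intro power_increasing) auto
    finally show ?thesis using that[of "Suc L"] by auto
  qed
  obtain N where N: "L \<le> N" "\<And>k. k > N \<Longrightarrow> \<Lambda> ^ L < c * \<kappa> ^ k"
    using eventually_pow_gt[OF c kappa] by metis
  have N1: "N \<ge> 1" using N L by linarith
  \<comment> \<open>A halving happens after at most \<open>N\<close> steps, so the rate per step is
    the \<open>N\<close>-th root of one half.\<close>
  define \<tau> where "\<tau> = root N (1/2)"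
  have tauN: "\<tau> ^ N = 1/2" using N1 by (simp add: \<tau>_def)
  have tau: "0 < \<tau>" "\<tau> < 1" using N1 by (simp_all add: \<tau>_def)
  have tauge: "\<tau> ^ m \<ge> 1/2" if "m \<le> N" for m
    using power_decreasing[OF that, of \<tau>] tau tauN by simp
  \<comment> \<open>The factor \<open>2\<close> undoes \<open>\<tau> ^ n \<ge> 1/2\<close>, and
    \<open>\<Lambda> ^ N\<close> covers the times up to \<open>N\<close>, before a halving is
    guaranteed.\<close>
  define C where "C = 2 * \<Lambda> ^ N"
  have C0: "C > 0" using Lam by (simp add: C_def)
  have drop: "\<exists>m. 1 \<le> m \<and> m \<le> N \<and> norm (cocycle T A m x *v v) \<le> norm v / 2"
    if g: "growing_orbit T A x c \<kappa> \<Lambda>" and P: "recurrent_bounded T A x v" and "v \<noteq> 0"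
    for T :: "'a \<Rightarrow> 'a" and A x v
  proof -
    interpret growing_orbit T A x c \<kappa> \<Lambda> by (rule g)
    obtain m where m: "L \<le> m" "m \<le> N" "\<And>k. k \<ge> m \<Longrightarrow> a m \<le> a k"
      using record_exists[OF N(2) N(1)] by metis
    let ?u = "(1 / norm v) *\<^sub>R v"
    have "norm (cocycle T A m x *v ?u) \<le> K' / \<kappa> ^ m"
      using recurrent_bounded_at_record[OF m(3), of ?u] recurrent_bounded_scale[OF _ P, of "1 / norm v"] \<open>v \<noteq> 0\<close>
      by (simp add: K_def K'_def)
    also have "\<dots> \<le> 1/2"
    proof -
      have "2 * K' \<le> \<kappa> ^ m" using L power_increasing[OF m(1), of \<kappa>] kappa by linarith
      then show ?thesis using kappa by (simp add: field_simps)
    qed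
    finally have "norm (cocycle T A m x *v v) \<le> norm v / 2"
      using \<open>v \<noteq> 0\<close> by (simp add: matrix_vector_mult_scaleR field_simps)
    then show ?thesis using m L by (intro exI[of _ m]) auto
  qed
  have "norm (cocycle T A n x *v v) \<le> C * \<tau> ^ n * norm v"
    if "\<And>i. growing_orbit T A ((T ^^ i) x) c \<kappa> \<Lambda>" "recurrent_bounded T A x v"
    for T :: "'a \<Rightarrow> 'a" and A x v n
    using that
  proof (induction n arbitrary: x v rule: less_induct)
    case (less n)
    have g: "growing_orbit T A x c \<kappa> \<Lambda>" using less.prems(1)[of 0] by simp
    interpret growing_orbit T A x c \<kappa> \<Lambda> by (rule g)
    show ?case
    proof (cases "v = 0")
      case True
      then show ?thesis by simp
    next
      case v: False
      show ?thesis
      proof (cases "n \<le> N")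
        case True
        have "norm (cocycle T A n x *v v) \<le> \<Lambda> ^ n * norm v"
          by (meson bounded mult_right_mono norm_ge_zero opnorm_bound opnorm_cocycle_le order_trans)
        also have "\<dots> \<le> \<Lambda> ^ N * norm v"
          using True Lam by (intro mult_right_mono power_increasing) auto
        also have "\<dots> \<le> C * \<tau> ^ n * norm v"
          using tauge[OF True] Lam by (intro mult_right_mono) (auto simp: C_def)
        finally show ?thesis .
      next
        case False
        obtain m where m: "1 \<le> m" "m \<le> N" "norm (cocycle T A m x *v v) \<le> norm v / 2"
          using drop[OF g less.prems(2) v] by blast
        have "norm (cocycle T A (n - m) ((T ^^ m) x) *v (cocycle T A m x *v v))
            \<le> C * \<tau> ^ (n - m) * norm (cocycle T A m x *v v)"
        proof (rule less.IH)
          show "growing_orbit T A ((T ^^ i) ((T ^^ m) x)) c \<kappa> \<Lambda>" for i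
            using less.prems(1)[of "i + m"] by (simp add: funpow_add)
        qed (use m False less.prems in \<open>auto simp: recurrent_bounded_iterate\<close>)
        also have "\<dots> \<le> C * \<tau> ^ (n - m) * (norm v * \<tau> ^ m)"
        proof (intro mult_left_mono)
          show "norm (cocycle T A m x *v v) \<le> norm v * \<tau> ^ m"
            using m(3) mult_left_mono[OF tauge[OF m(2)], of "norm v"] by simp
        qed (use C0 tau in auto)
        also have "\<dots> = C * \<tau> ^ n * norm v"
          using m False by (simp add: power_add[symmetric] mult_ac)
        finally show ?thesis
          using cocycle_add[of T A "n - m" m x] m False by (simp add: matrix_vector_mul_assoc)
      qed
    qed
  qed
  then show thesis using that[of C \<tau>] C0 tau by blast
qed

section \<open>Steering directions by small rotations\<close>

definition unitv :: "real \<Rightarrow> real^2" where "unitv t = vector [cos t, sin t]"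

lemma crs_unitv: "crs (unitv s) (unitv t) = sin (t - s)"
  by (simp add: crs_def unitv_def sin_diff mult.commute)

lemma rot_unitv: "rot s *v unitv t = unitv (s + t)"
  by (simp add: rot_def unitv_def mult_vec2 cos_add sin_add vec2_eq_iff)

lemma norm_unitv [simp]: "norm (unitv t) = 1"
proof -
  have "(norm (unitv t))\<^sup>2 = 1" unfolding norm_vec2 by (simp add: unitv_def)
  then show ?thesis by (smt (verit) norm_ge_zero power2_eq_1_iff)
qed

lemma unitv_pi: "unitv (t + pi) = - unitv t"
  by (simp add: unitv_def vec2_eq_iff)

lemma unitv_2pi_int: "unitv (t + 2 * pi * of_int k) = unitv t"
  by (simp add: unitv_def vec2_eq_iff cos_add sin_add sin_int_2pin cos_int_2pin)

text \<open>The angle is taken in a prescribed window of length \<open>2 * pi\<close>, so that arcs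
  can be handled as real intervals.\<close>

lemma polar_from:
  fixes v :: "real^2"
  assumes "v \<noteq> 0"
  obtains t where "q \<le> t" "t < q + 2 * pi" "v = norm v *\<^sub>R unitv t"
proof -
  let ?u = "(1 / norm v) *\<^sub>R v"
  have "(norm ?u)\<^sup>2 = 1" using assms by simp
  then have "(?u$1)\<^sup>2 + (?u$2)\<^sup>2 = 1" unfolding norm_vec2 .
  then obtain t where "?u$1 = cos t" "?u$2 = sin t" using sincos_total_2pi by metis
  then have "?u = unitv t" by (simp add: vec2_eq_iff unitv_def)
  moreover have "norm v *\<^sub>R ?u = v" using assms by simp
  ultimately have v: "v = norm v *\<^sub>R unitv t" by simp
  define k where "k = \<lceil>(q - t) / (2 * pi)\<rceil>"
  have "(q - t) / (2 * pi) \<le> of_int k" "of_int k < (q - t) / (2 * pi) + 1"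
    unfolding k_def by linarith+
  then have "q \<le> t + 2 * pi * of_int k" "t + 2 * pi * of_int k < q + 2 * pi"
    by (simp_all add: field_simps)
  then show thesis using that[of "t + 2 * pi * of_int k"] v by (simp add: unitv_2pi_int)
qed

lemma unitv_cone:
  "sin (p - q) *\<^sub>R unitv t = sin (p - t) *\<^sub>R unitv q + sin (t - q) *\<^sub>R unitv p"
  unfolding vec2_eq_iff unitv_def
  by (simp add: sin_diff algebra_simps)

text \<open>With half-sum \<open>y\<close> and \<open>d = cos (a - b)\<close> the quotient is
  \<open>(d - cos (2 * y)) / (2 * sin (2 * y))\<close>; enlarging keeps \<open>d\<close> and moves
  \<open>y\<close> to \<open>y + \<eta>\<close>. The ratio is smallest for \<open>d = 1\<close>,
  where it is \<open>tan (y + \<eta>) / tan y\<close>, and this is at least the stated factor, with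
  equality when \<open>2 * y + \<eta>\<close> is a right angle.\<close>

lemma arc_expansion:
  fixes a b \<eta> :: real
  assumes "0 < a" "0 < b" "0 < \<eta>" "a + b + 2 * \<eta> < pi"
  shows "(1 + sin \<eta>) / (1 - sin \<eta>) * (sin a * sin b / sin (a + b))
     \<le> sin (a + \<eta>) * sin (b + \<eta>) / sin (a + b + 2 * \<eta>)"
proof -
  define y where "y = a / 2 + b / 2"
  have "0 < y" using assms by (simp add: y_def)
  moreover have "y + \<eta> < pi / 2" using assms unfolding y_def by linarith
  ultimately have y: "0 < y" "y + \<eta> < pi / 2" .
  have eta: "0 < \<eta>" "\<eta> < pi / 2" using y assms by auto
  have sy: "sin y > 0" "cos y > 0" using y eta by (auto intro!: sin_gt_zero cos_gt_zero)
  have sye: "sin (y + \<eta>) > 0" "cos (y + \<eta>) > 0" using y eta by (auto intro!: sin_gt_zero cos_gt_zero)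
  have se: "sin \<eta> > 0" "sin \<eta> < 1"
    using eta sin_gt_zero[of \<eta>] sin_monotone_2pi[of \<eta> "pi/2"] by auto
  have ab: "a + b = 2 * y" "a + b + 2 * \<eta> = 2 * (y + \<eta>)" by (auto simp: y_def)
  define d where "d = cos (a - b)"
  have p1: "sin a * sin b = (d - cos (2 * y)) / 2"
    using sin_times_sin[of a b] by (simp add: d_def ab)
  have p2: "sin (a + \<eta>) * sin (b + \<eta>) = (d - cos (2 * (y + \<eta>))) / 2"
  proof -
    have "a + \<eta> + (b + \<eta>) = 2 * (y + \<eta>)" "a + \<eta> - (b + \<eta>) = a - b" by (auto simp: y_def)
    then show ?thesis using sin_times_sin[of "a + \<eta>" "b + \<eta>"] by (simp only: d_def)
  qed
  have d1: "d \<le> 1" by (simp add: d_def)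
  have "sin a > 0" "sin b > 0" using assms by (auto intro!: sin_gt_zero)
  then have dpos: "d - cos (2 * y) > 0" using p1 by (metis half_gt_zero_iff mult_pos_pos)
  have c2: "cos (2 * y) = 1 - 2 * (sin y)\<^sup>2" "cos (2 * (y + \<eta>)) = 1 - 2 * (sin (y + \<eta>))\<^sup>2"
    by (rule cos_double_sin)+
  have mono: "sin y \<le> sin (y + \<eta>)" using y eta by (intro sin_monotone_2pi_le) auto
  then have sq: "(sin y)\<^sup>2 \<le> (sin (y + \<eta>))\<^sup>2" using sy by (intro power_mono) auto
  \<comment> \<open>Reduction to the symmetric case \<open>d = 1\<close>, where the two sides
    agree.\<close>
  have r1: "(d - cos (2 * y)) * (sin (y + \<eta>))\<^sup>2 \<le> (d - cos (2 * (y + \<eta>))) * (sin y)\<^sup>2"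
  proof -
    have "(1 - d) * (sin y)\<^sup>2 \<le> (1 - d) * (sin (y + \<eta>))\<^sup>2"
      using sq d1 by (intro mult_left_mono) auto
    then show ?thesis unfolding c2 by (simp add: algebra_simps)
  qed
  \<comment> \<open>The bound for \<open>tan (y + \<eta>) / tan y\<close> in product form; the only
    loss is \<open>sin (2 * y + \<eta>) \<le> 1\<close>.\<close>
  have r2: "(1 + sin \<eta>) * (sin y * cos (y + \<eta>)) \<le> (1 - sin \<eta>) * (sin (y + \<eta>) * cos y)"
  proof -
    have e1: "sin (y + \<eta>) * cos y = (sin (2 * y + \<eta>) + sin \<eta>) / 2"
      using sin_times_cos[of "y + \<eta>" y] by (simp add: algebra_simps)
    have e2: "sin y * cos (y + \<eta>) = (sin (2 * y + \<eta>) - sin \<eta>) / 2"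
      using cos_times_sin[of "y + \<eta>" y] by (simp add: algebra_simps)
    have "sin (2 * y + \<eta>) * sin \<eta> \<le> 1 * sin \<eta>" using se by (intro mult_right_mono) auto
    then show ?thesis unfolding e1 e2 by (simp add: field_simps)
  qed
  have r2': "(1 + sin \<eta>) / (1 - sin \<eta>) \<le> sin (y + \<eta>) * cos y / (sin y * cos (y + \<eta>))"
    using r2 se sy sye by (simp add: field_simps)
  have "(1 + sin \<eta>) / (1 - sin \<eta>) * (sin a * sin b / sin (a + b))
     \<le> sin (y + \<eta>) * cos y / (sin y * cos (y + \<eta>)) * ((d - cos (2 * y)) / 2 / (2 * sin y * cos y))"
    unfolding p1 ab sin_double using r2' dpos sy by (intro mult_right_mono) auto
  also have "\<dots> = (d - cos (2 * y)) * (sin (y + \<eta>))\<^sup>2 / (4 * (sin y)\<^sup>2 * sin (y + \<eta>) * cos (y + \<eta>))"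
    using sy sye by (simp add: field_simps power2_eq_square)
  also have "\<dots> \<le> (d - cos (2 * (y + \<eta>))) * (sin y)\<^sup>2 / (4 * (sin y)\<^sup>2 * sin (y + \<eta>) * cos (y + \<eta>))"
    using r1 sy sye by (intro divide_right_mono) auto
  also have "\<dots> = sin (a + \<eta>) * sin (b + \<eta>) / sin (a + b + 2 * \<eta>)"
    unfolding p2 ab(2) sin_double using sy sye by (simp add: field_simps)
  finally show ?thesis .
qed

text \<open>For a given sum the quotient is largest at \<open>a = b\<close>, with value
  \<open>tan y / 2\<close> at the half-sum \<open>y\<close>, and the room left for
  \<open>2 * \<eta>\<close> keeps \<open>y\<close> below \<open>pi / 2 - \<eta>\<close>.\<close>

lemma arc_product_le:
  fixes a b \<eta> :: real
  assumes "0 < a" "0 < b" "0 < \<eta>" "a + b + 2 * \<eta> < pi"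
  shows "sin a * sin b / sin (a + b) \<le> 1 / (2 * tan \<eta>)"
proof -
  define y where "y = a / 2 + b / 2"
  have "0 < y" using assms by (simp add: y_def)
  moreover have "y < pi / 2 - \<eta>" using assms unfolding y_def by linarith
  ultimately have y: "0 < y" "y < pi / 2 - \<eta>" .
  have eta: "\<eta> < pi / 2" using y assms by auto
  have sy: "sin y > 0" "cos y > 0" using y assms by (auto intro!: sin_gt_zero cos_gt_zero)
  have ab: "a + b = 2 * y" by (simp add: y_def)
  have "sin a * sin b = (cos (a - b) - cos (2 * y)) / 2"
    using sin_times_sin[of a b] by (simp add: ab)
  also have "\<dots> \<le> (1 - cos (2 * y)) / 2" by simp
  also have "\<dots> = (sin y)\<^sup>2" by (simp add: cos_double_sin)
  finally have "sin a * sin b / sin (a + b) \<le> (sin y)\<^sup>2 / (2 * sin y * cos y)"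
    unfolding ab sin_double using sy by (intro divide_right_mono) auto
  also have "\<dots> = tan y / 2" using sy by (simp add: tan_def power2_eq_square)
  also have "tan y \<le> tan (pi / 2 - \<eta>)" using y assms by (intro tan_mono_le) auto
  also have "tan (pi / 2 - \<eta>) = 1 / tan \<eta>"
    by (simp add: tan_def sin_diff cos_diff)
  finally show ?thesis by simp
qed

section \<open>Controlled products and the arc of reachable directions\<close>

fun controlled :: "('a \<Rightarrow> 'a) \<Rightarrow> ('a \<Rightarrow> real^2^2) \<Rightarrow> (nat \<Rightarrow> real) \<Rightarrow> nat \<Rightarrow> 'a \<Rightarrow> real^2^2" where
  "controlled T A \<theta> 0 x = mat 1"
| "controlled T A \<theta> (Suc n) x = A ((T ^^ n) x) ** rot (\<theta> n) ** controlled T A \<theta> n x"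


lemma controlled_add:
  "controlled T A (\<lambda>i. if i < n then \<theta> i else \<phi> (i - n)) (m + n) x
     = controlled T A \<phi> m ((T ^^ n) x) ** controlled T A \<theta> n x"
proof (induction m)
  case 0
  have "controlled T A (\<lambda>i. if i < n then \<theta> i else \<phi> (i - n)) k x = controlled T A \<theta> k x" if "k \<le> n" for k
    using that by (induction k) auto
  then show ?case by simp
next
  case (Suc m)
  then show ?case by (simp add: matrix_mul_assoc funpow_add)
qed

lemma controlled_zero: "controlled T A (\<lambda>_. 0) n x = cocycle T A n x"
  by (induction n) auto

lemma det_controlled: "(\<And>y. det (A y) = 1) \<Longrightarrow> det (controlled T A \<theta> n x) = 1"
  by (induction n) (auto simp: det_mul)

text \<open>Directions are points of the projective line, hence the factor \<open>r\<close> of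
  either sign.\<close>

definition reaches :: "('a \<Rightarrow> 'a) \<Rightarrow> ('a \<Rightarrow> real^2^2) \<Rightarrow> real \<Rightarrow> nat \<Rightarrow> 'a \<Rightarrow> real^2 \<Rightarrow> real^2 \<Rightarrow> bool" where
  "reaches T A \<eta> n x v w \<longleftrightarrow>
     (\<exists>\<theta> r. (\<forall>i. \<bar>\<theta> i\<bar> \<le> \<eta>) \<and> controlled T A \<theta> n x *v v = r *\<^sub>R w)"

lemma reaches_step:
  assumes "reaches T A \<eta> n x v w" "\<bar>t\<bar> \<le> \<eta>" "A ((T ^^ n) x) *v (rot t *v w) = r *\<^sub>R u"
  shows "reaches T A \<eta> (Suc n) x v u"
proof -
  obtain \<theta> k where \<theta>: "\<And>i. \<bar>\<theta> i\<bar> \<le> \<eta>" "controlled T A \<theta> n x *v v = k *\<^sub>R w"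
    using assms(1) unfolding reaches_def by blast
  let ?\<theta> = "\<lambda>i. if i < n then \<theta> i else (\<lambda>_. t) (i - n)"
  have "controlled T A ?\<theta> (1 + n) x *v v
      = (controlled T A (\<lambda>_. t) 1 ((T ^^ n) x) ** controlled T A \<theta> n x) *v v"
    using controlled_add[of T A n \<theta> "\<lambda>_. t" 1 x] by (simp only:)
  also have "\<dots> = A ((T ^^ n) x) *v (rot t *v (k *\<^sub>R w))"
    by (simp add: matrix_vector_mul_assoc[symmetric] \<theta>)
  also have "\<dots> = (k * r) *\<^sub>R u" by (simp add: matrix_vector_mult_scaleR assms(3))
  finally show ?thesis using \<theta>(1) assms(2)
    unfolding reaches_def by (intro exI[of _ ?\<theta>] exI[of _ "k * r"]) auto
qed

lemma sin_pos_arc: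
  assumes "sin t > 0" "0 \<le> t" "t < 2 * pi" shows "0 < t" "t < pi"
proof -
  show "0 < t" using assms by (cases "t = 0") auto
  show "t < pi" using assms sin_le_zero[of t] by (meson not_le)
qed

lemma sin_nonneg_arc:
  assumes "sin t \<ge> 0" "0 \<le> t" "t < 2 * pi" shows "t \<le> pi"
  using assms sin_lt_zero[of t] by (meson not_le)

text \<open>Determinant one preserves orientation, which keeps the image arc shorter than
  \<open>pi\<close>. The \<open>crs\<close> terms and \<open>sin (P - Q)\<close> are areas:
  normalising the images of the end vectors by their lengths \<open>k\<close> and \<open>l\<close>
  divides numerator and denominator by the same \<open>k * l\<close>, hence the invariance of the
  quotient.\<close>

lemma arc_image:
  assumes det1: "det B = 1" and QP: "Q < P" "P < Q + pi"
  obtains q p where "q < p" "p < q + pi"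
    "\<And>t. q \<le> t \<Longrightarrow> t \<le> p \<Longrightarrow> \<exists>s r. Q \<le> s \<and> s \<le> P \<and> B *v unitv s = r *\<^sub>R unitv t"
    "\<And>y. crs (unitv Q) y > 0 \<Longrightarrow> crs (unitv q) (B *v y) > 0"
    "\<And>y. crs y (unitv P) > 0 \<Longrightarrow> crs (B *v y) (unitv p) > 0"
    "\<And>y. crs (unitv q) (B *v y) * crs (B *v y) (unitv p) / sin (p - q)
        = crs (unitv Q) y * crs y (unitv P) / sin (P - Q)"
proof -
  have inj: "B *v u \<noteq> 0" if "u \<noteq> 0" for u
    using det1_norm_le[OF det1, of u] that by auto
  have une: "unitv t \<noteq> 0" for t using norm_unitv[of t] by force
  define k l where "k = norm (B *v unitv Q)" and "l = norm (B *v unitv P)"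
  have kl: "k > 0" "l > 0" using inj[OF une] by (auto simp: k_def l_def)
  obtain q where q: "B *v unitv Q = k *\<^sub>R unitv q" using polar_from[OF inj[OF une]] k_def by metis
  obtain p where p: "q \<le> p" "p < q + 2 * pi" "B *v unitv P = l *\<^sub>R unitv p"
    using polar_from[OF inj[OF une]] l_def by metis
  have crs_scale: "crs (c *\<^sub>R u) w = c * crs u w" "crs u (c *\<^sub>R w) = c * crs u w" for c u w
    by (simp_all add: crs_def algebra_simps)
  have crs_add: "crs (u + u') w = crs u w + crs u' w" "crs w (u + u') = crs w u + crs w u'" for u u' w
    by (simp_all add: crs_def algebra_simps)
  have sPQ: "sin (P - Q) > 0" using QP by (intro sin_gt_zero) auto
  have "k * (l * sin (p - q)) = crs (B *v unitv Q) (B *v unitv P)" by (simp add: q p crs_scale crs_unitv)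
  also have "\<dots> = sin (P - Q)" by (simp add: crs_mult det1 crs_unitv)
  finally have sin_eq: "k * (l * sin (p - q)) = sin (P - Q)" .
  then have spq: "sin (p - q) > 0" using sPQ kl by (metis zero_less_mult_pos)
  have qp: "q < p" "p < q + pi" using sin_pos_arc[OF spq] p by auto
  have crsq: "crs (unitv q) (B *v y) = crs (unitv Q) y / k" for y
  proof -
    have "k * crs (unitv q) (B *v y) = crs (B *v unitv Q) (B *v y)" by (simp add: q crs_scale)
    also have "\<dots> = crs (unitv Q) y" by (simp add: crs_mult det1)
    finally show ?thesis using kl by (simp add: field_simps)
  qed
  have crsp: "crs (B *v y) (unitv p) = crs y (unitv P) / l" for y
  proof -
    have "l * crs (B *v y) (unitv p) = crs (B *v y) (B *v unitv P)" by (simp add: p crs_scale)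
    also have "\<dots> = crs y (unitv P)" by (simp add: crs_mult det1)
    finally show ?thesis using kl by (simp add: field_simps)
  qed
  have reach: "\<exists>s r. Q \<le> s \<and> s \<le> P \<and> B *v unitv s = r *\<^sub>R unitv t" if t: "q \<le> t" "t \<le> p" for t
  proof -
    \<comment> \<open>Coordinates of the preimage of \<open>unitv t\<close>, up to the factor
      \<open>sin (p - q)\<close>: the coefficients of \<open>unitv_cone\<close> divided by the
      stretching of the end vectors. They are nonnegative, so \<open>w\<close> points into the arc
      from \<open>Q\<close> to \<open>P\<close>.\<close>
    define \<alpha> \<beta> where "\<alpha> = sin (p - t) / k" and "\<beta> = sin (t - q) / l"
    have ab: "\<alpha> \<ge> 0" "\<beta> \<ge> 0" unfolding \<alpha>_def \<beta>_def using kl t qp by (auto intro!: divide_nonneg_pos sin_ge_zero)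
    define w where "w = \<alpha> *\<^sub>R unitv Q + \<beta> *\<^sub>R unitv P"
    have "B *v w = (\<alpha> * k) *\<^sub>R unitv q + (\<beta> * l) *\<^sub>R unitv p"
      by (simp add: w_def matrix_vector_right_distrib matrix_vector_mult_scaleR q p)
    also have "\<dots> = sin (p - q) *\<^sub>R unitv t"
      using kl by (simp add: unitv_cone[of p q t] \<alpha>_def \<beta>_def)
    finally have Bw: "B *v w = sin (p - q) *\<^sub>R unitv t" .
    then have w0: "w \<noteq> 0" using spq une by auto
    then obtain s where s: "Q \<le> s" "s < Q + 2 * pi" "w = norm w *\<^sub>R unitv s" using polar_from by metis
    have nw: "norm w > 0" using w0 by simp
    have "norm w * sin (s - Q) = crs (unitv Q) w" using s(3) by (metis crs_scale(2) crs_unitv)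
    also have "\<dots> = \<beta> * sin (P - Q)" by (simp add: w_def crs_scale crs_add crs_unitv)
    finally have "sin (s - Q) \<ge> 0" using nw ab sPQ
      by (metis mult_nonneg_nonneg less_imp_le zero_le_mult_iff not_le)
    then have s1: "s - Q \<le> pi" using s by (intro sin_nonneg_arc) auto
    have "norm w * sin (P - s) = crs w (unitv P)" using s(3) by (metis crs_scale(1) crs_unitv)
    also have "\<dots> = \<alpha> * sin (P - Q)" by (simp add: w_def crs_scale crs_add crs_unitv)
    finally have s2: "sin (P - s) \<ge> 0" using nw ab sPQ
      by (metis mult_nonneg_nonneg less_imp_le zero_le_mult_iff not_le)
    have "s \<le> P"
    proof (rule ccontr)
      assume "\<not> s \<le> P"
      then have "sin (s - P) > 0" using s1 QP by (intro sin_gt_zero) auto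
      then show False using s2 sin_minus[of "s - P"] by simp
    qed
    moreover have "B *v unitv s = (sin (p - q) / norm w) *\<^sub>R unitv t"
    proof -
      have "norm w *\<^sub>R (B *v unitv s) = sin (p - q) *\<^sub>R unitv t"
        using Bw s(3) by (metis matrix_vector_mult_scaleR)
      then have "(1 / norm w) *\<^sub>R (norm w *\<^sub>R (B *v unitv s)) = (1 / norm w) *\<^sub>R (sin (p - q) *\<^sub>R unitv t)"
        by simp
      then show ?thesis using nw by simp
    qed
    ultimately show ?thesis using s by blast
  qed
  show thesis
  proof (rule that[OF qp reach])
    show "crs (unitv q) (B *v y) * crs (B *v y) (unitv p) / sin (p - q)
        = crs (unitv Q) y * crs y (unitv P) / sin (P - Q)" for y
      unfolding crsq crsp sin_eq[symmetric] using kl spq by (simp add: field_simps)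
  qed (use kl crsq crsp in auto)
qed

text \<open>An arc of length \<open>pi\<close> meets every line, since one of two opposite unit
  vectors may be chosen.\<close>

lemma arc_covers:
  assumes det1: "det B = 1" and QP: "Q + pi \<le> P" and w: "w \<noteq> 0"
  obtains s r where "Q \<le> s" "s \<le> P" "B *v unitv s = r *\<^sub>R w"
proof -
  define u where "u = matrix_inv B *v w"
  have Bu: "B *v u = w" using det1_inverse[OF det1] by (simp add: u_def matrix_vector_mul_assoc)
  then have u0: "u \<noteq> 0" using w by auto
  then obtain s where s: "Q \<le> s" "s < Q + 2 * pi" "u = norm u *\<^sub>R unitv s" using polar_from by metis
  have "(1 / norm u) *\<^sub>R (norm u *\<^sub>R unitv s) = unitv s" using u0 by simp
  then have us: "unitv s = (1 / norm u) *\<^sub>R u" using s(3) by simp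
  show thesis
  proof (cases "s < Q + pi")
    case True
    then show thesis using that[of s "1 / norm u"] s QP by (simp add: us matrix_vector_mult_scaleR Bu)
  next
    case False
    have "unitv (s - pi) = - unitv s" using unitv_pi[of "s - pi"] by simp
    then have "unitv (s - pi) = (- 1 / norm u) *\<^sub>R u" by (simp add: us)
    then have "B *v unitv (s - pi) = (- 1 / norm u) *\<^sub>R w"
      by (simp only: matrix_vector_mult_scaleR Bu)
    then show thesis using that[of "s - pi" "- 1 / norm u"] s False QP by simp
  qed
qed

lemma cone_polar:
  assumes "q < p" "p < q + pi" "crs (unitv q) y > 0" "crs y (unitv p) > 0"
  obtains \<xi> where "q < \<xi>" "\<xi> < p" "\<And>t. crs (unitv t) y = norm y * sin (\<xi> - t)"
    "\<And>t. crs y (unitv t) = norm y * sin (t - \<xi>)"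
proof -
  define h where "h = norm y"
  have "y \<noteq> 0" using assms by (auto simp: crs_def)
  then obtain \<xi> where xi: "q \<le> \<xi>" "\<xi> < q + 2 * pi" "y = h *\<^sub>R unitv \<xi>"
    using polar_from h_def by metis
  have h: "h > 0" using \<open>y \<noteq> 0\<close> by (simp add: h_def)
  have cq: "crs (unitv t) y = h * sin (\<xi> - t)" and cp: "crs y (unitv t) = h * sin (t - \<xi>)" for t
    unfolding xi(3) crs_unitv[symmetric] by (simp_all add: crs_def algebra_simps)
  have sp: "sin (\<xi> - q) > 0" "sin (p - \<xi>) > 0" using assms h unfolding cq cp by (simp_all add: zero_less_mult_iff)
  then have x1: "q < \<xi>" "\<xi> < q + pi" using sin_pos_arc[of "\<xi> - q"] xi by auto
  have "\<xi> < p"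
  proof (rule ccontr)
    assume "\<not> \<xi> < p"
    then have "sin (\<xi> - p) \<ge> 0" using x1 assms by (intro sin_ge_zero) auto
    then show False using sp(2) sin_minus[of "\<xi> - p"] by simp
  qed
  then show thesis using that x1 cq cp by (simp add: h_def)
qed

lemma reaches_all_step:
  assumes det1: "\<And>y. det (A y) = 1" and "0 \<le> \<eta>"
    and all: "\<forall>w. w \<noteq> 0 \<longrightarrow> reaches T A \<eta> n x v w" and w: "w \<noteq> 0"
  shows "reaches T A \<eta> (Suc n) x v w"
proof -
  let ?B = "A ((T ^^ n) x)"
  let ?u = "matrix_inv ?B *v w"
  have Bu: "?B *v ?u = w" using det1_inverse[OF det1] by (simp add: matrix_vector_mul_assoc)
  then have "?u \<noteq> 0" using w by (metis matrix_vector_mult_0_right)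
  then show ?thesis
    using all Bu assms by (intro reaches_step[of T A \<eta> n x v ?u 0 1]) auto
qed

text \<open>The angle \<open>s\<close> in the enlarged arc splits into the nearest point of the arc
  already reached and a remainder, which is the rotation used at this step.\<close>

lemma reaches_arc_step:
  assumes reach: "\<forall>t. q \<le> t \<and> t \<le> p \<longrightarrow> reaches T A \<eta> n x v (unitv t)" and "q < p" "0 < \<eta>"
    and s: "q - \<eta> \<le> s" "s \<le> p + \<eta>" "A ((T ^^ n) x) *v unitv s = r *\<^sub>R w"
  shows "reaches T A \<eta> (Suc n) x v w"
proof -
  let ?t = "max q (min p s)"
  have t: "q \<le> ?t" "?t \<le> p" "\<bar>s - ?t\<bar> \<le> \<eta>" using assms by (auto simp: max_def min_def)
  show ?thesis
    by (rule reaches_step[of T A \<eta> n x v "unitv ?t" "s - ?t" r])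
      (use reach t s in \<open>auto simp: rot_unitv\<close>)
qed

text \<open>Feeding the extreme controls \<open>\<plusminus>\<eta>\<close> into the cocycle enlarges the arc of reachable directions by
  \<open>\<eta>\<close> on either side at each step. As long as the arc does not cover the projective line, the quantity
  \<open>crs (unitv q) y * crs y (unitv p) / sin (p - q)\<close> is invariant under the matrices and multiplied by
  at least \<open>(1 + sin \<eta>) / (1 - sin \<eta>)\<close> under the enlargement; here \<open>y\<close> follows the unperturbed orbit.\<close>
lemma reachable_arc:
  fixes T :: "'a \<Rightarrow> 'a"
  assumes det1: "\<And>y. det (A y) = 1" and eta: "0 < \<eta>" "\<eta> < pi / 2" and v: "norm v = 1"
  defines "\<rho> \<equiv> (1 + sin \<eta>) / (1 - sin \<eta>)"
  shows "(\<forall>w. w \<noteq> 0 \<longrightarrow> reaches T A \<eta> (Suc n) x v w) \<or>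
    (\<exists>q p. q < p \<and> p < q + pi \<and> (\<forall>t. q \<le> t \<and> t \<le> p \<longrightarrow> reaches T A \<eta> (Suc n) x v (unitv t)) \<and>
       crs (unitv q) (cocycle T A (Suc n) x *v v) > 0 \<and> crs (cocycle T A (Suc n) x *v v) (unitv p) > 0 \<and>
       tan \<eta> / 2 * \<rho> ^ n \<le> crs (unitv q) (cocycle T A (Suc n) x *v v)
         * crs (cocycle T A (Suc n) x *v v) (unitv p) / sin (p - q))"
proof (induction n)
  case 0
  have v0: "v \<noteq> 0" using v by auto
  obtain \<xi> where xi: "v = unitv \<xi>" using polar_from[OF v0] v by (metis scaleR_one)
  have "\<xi> - \<eta> < \<xi> + \<eta>" "\<xi> + \<eta> < \<xi> - \<eta> + pi" using eta by auto
  then obtain q p where qp: "q < p" "p < q + pi"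
    "\<And>t. q \<le> t \<Longrightarrow> t \<le> p \<Longrightarrow> \<exists>s r. \<xi> - \<eta> \<le> s \<and> s \<le> \<xi> + \<eta> \<and> A x *v unitv s = r *\<^sub>R unitv t"
    "\<And>y. crs (unitv (\<xi> - \<eta>)) y > 0 \<Longrightarrow> crs (unitv q) (A x *v y) > 0"
    "\<And>y. crs y (unitv (\<xi> + \<eta>)) > 0 \<Longrightarrow> crs (A x *v y) (unitv p) > 0"
    "\<And>y. crs (unitv q) (A x *v y) * crs (A x *v y) (unitv p) / sin (p - q)
        = crs (unitv (\<xi> - \<eta>)) y * crs y (unitv (\<xi> + \<eta>)) / sin ((\<xi> + \<eta>) - (\<xi> - \<eta>))"
    by (rule arc_image[OF det1[of x]]) blast
  have "reaches T A \<eta> 0 x v v"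
    unfolding reaches_def using eta by (intro exI[of _ "\<lambda>_. 0"] exI[of _ 1]) auto
  then have r: "reaches T A \<eta> (Suc 0) x v (unitv t)" if "q \<le> t" "t \<le> p" for t
  proof -
    obtain s r where s: "\<xi> - \<eta> \<le> s" "s \<le> \<xi> + \<eta>" "A x *v unitv s = r *\<^sub>R unitv t" using qp(3)[OF \<open>q \<le> t\<close> \<open>t \<le> p\<close>] by blast
    show ?thesis
      by (rule reaches_step[OF \<open>reaches T A \<eta> 0 x v v\<close>, of "s - \<xi>" r]) (use s in \<open>auto simp: xi rot_unitv\<close>)
  qed
  have se: "sin \<eta> > 0" "cos \<eta> > 0" using eta by (auto intro!: sin_gt_zero cos_gt_zero)
  \<comment> \<open>The first rotations by \<open>\<plusminus>\<eta>\<close> give the value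
    \<open>(sin \<eta>)\<^sup>2 / sin (2 * \<eta>) = tan \<eta> / 2\<close>.\<close>
  have "crs (unitv q) (A x *v v) * crs (A x *v v) (unitv p) / sin (p - q) = tan \<eta> / 2"
    unfolding qp(6) using se by (simp add: xi crs_unitv tan_def flip: mult_2) (simp add: sin_double)
  moreover have "crs (unitv q) (A x *v v) > 0" "crs (A x *v v) (unitv p) > 0"
    using qp(4)[of v] qp(5)[of v] se by (auto simp: xi crs_unitv)
  ultimately show ?case using qp(1,2) r by (intro disjI2 exI[of _ q] exI[of _ p]) auto
next
  case (Suc n)
  let ?B = "A ((T ^^ Suc n) x)" and ?y = "cocycle T A (Suc n) x *v v"
  have y': "cocycle T A (Suc (Suc n)) x *v v = ?B *v ?y"
    by (simp add: matrix_vector_mul_assoc matrix_mul_assoc)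
  show ?case
    using Suc.IH
  proof (elim disjE exE conjE)
    assume all: "\<forall>w. w \<noteq> 0 \<longrightarrow> reaches T A \<eta> (Suc n) x v w"
    have "reaches T A \<eta> (Suc (Suc n)) x v w" if "w \<noteq> 0" for w
      by (rule reaches_all_step[of A, OF det1 _ all that]) (use eta in simp)
    then show ?thesis by blast
  next
    fix q p
    assume qp: "q < p" "p < q + pi"
      and reach: "\<forall>t. q \<le> t \<and> t \<le> p \<longrightarrow> reaches T A \<eta> (Suc n) x v (unitv t)"
      and pos: "crs (unitv q) ?y > 0" "crs ?y (unitv p) > 0"
      and F: "tan \<eta> / 2 * \<rho> ^ n \<le> crs (unitv q) ?y * crs ?y (unitv p) / sin (p - q)"
    note reach' = reaches_arc_step[OF reach qp(1) eta(1)]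
    show ?thesis
    proof (cases "q - \<eta> + pi \<le> p + \<eta>")
      case True
      then have "reaches T A \<eta> (Suc (Suc n)) x v w" if "w \<noteq> 0" for w
        using arc_covers[OF det1 True that] reach' by metis
      then show ?thesis by blast
    next
      case False
      have "q - \<eta> < p + \<eta>" "p + \<eta> < q - \<eta> + pi" using False qp eta by auto
      then obtain q' p' where q'p': "q' < p'" "p' < q' + pi"
        "\<And>t. q' \<le> t \<Longrightarrow> t \<le> p' \<Longrightarrow> \<exists>s r. q - \<eta> \<le> s \<and> s \<le> p + \<eta> \<and> ?B *v unitv s = r *\<^sub>R unitv t"
        "\<And>y. crs (unitv (q - \<eta>)) y > 0 \<Longrightarrow> crs (unitv q') (?B *v y) > 0"
        "\<And>y. crs y (unitv (p + \<eta>)) > 0 \<Longrightarrow> crs (?B *v y) (unitv p') > 0"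
        "\<And>y. crs (unitv q') (?B *v y) * crs (?B *v y) (unitv p') / sin (p' - q')
            = crs (unitv (q - \<eta>)) y * crs y (unitv (p + \<eta>)) / sin ((p + \<eta>) - (q - \<eta>))"
        by (rule arc_image[OF det1[of "(T ^^ Suc n) x"]]) blast
      obtain \<xi> where x1: "q < \<xi>" and x2: "\<xi> < p"
        and cq: "\<And>t. crs (unitv t) ?y = norm ?y * sin (\<xi> - t)"
        and cp: "\<And>t. crs ?y (unitv t) = norm ?y * sin (t - \<xi>)"
        using cone_polar[OF qp pos] by metis
      have h: "norm ?y > 0" using pos by (auto simp: crs_def)
      \<comment> \<open>\<open>\<xi>\<close> is the angle of the unperturbed vector; its distances
        to the two ends are the \<open>a\<close> and \<open>b\<close> of
        \<open>arc_expansion\<close>, and the factor \<open>(norm ?y)\<^sup>2\<close> is common to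
        both sides.\<close>
      have "\<rho> * (sin (\<xi> - q) * sin (p - \<xi>) / sin (\<xi> - q + (p - \<xi>)))
          \<le> sin (\<xi> - q + \<eta>) * sin (p - \<xi> + \<eta>) / sin (\<xi> - q + (p - \<xi>) + 2 * \<eta>)"
        unfolding \<rho>_def by (rule arc_expansion) (use x1 x2 eta False in auto)
      then have ex: "\<rho> * (crs (unitv q) ?y * crs ?y (unitv p) / sin (p - q))
         \<le> crs (unitv (q - \<eta>)) ?y * crs ?y (unitv (p + \<eta>)) / sin ((p + \<eta>) - (q - \<eta>))"
        unfolding cq cp using mult_left_mono[of _ _ "(norm ?y)\<^sup>2"]
        by (fastforce simp: algebra_simps power2_eq_square)
      have rho: "\<rho> \<ge> 0" unfolding \<rho>_def using sin_ge_minus_one[of \<eta>] sin_le_one[of \<eta>]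
        by (intro divide_nonneg_nonneg) linarith+
      have "tan \<eta> / 2 * \<rho> ^ Suc n \<le> \<rho> * (crs (unitv q) ?y * crs ?y (unitv p) / sin (p - q))"
        using mult_left_mono[OF F rho] by (simp add: mult_ac)
      also note ex
      also have "crs (unitv (q - \<eta>)) ?y * crs ?y (unitv (p + \<eta>)) / sin ((p + \<eta>) - (q - \<eta>))
         = crs (unitv q') (?B *v ?y) * crs (?B *v ?y) (unitv p') / sin (p' - q')"
        by (rule q'p'(6)[symmetric])
      finally have F': "tan \<eta> / 2 * \<rho> ^ Suc n \<le> crs (unitv q') (?B *v ?y) * crs (?B *v ?y) (unitv p') / sin (p' - q')" .
      have "crs (unitv (q - \<eta>)) ?y > 0" "crs ?y (unitv (p + \<eta>)) > 0"
        unfolding cq cp using h x1 x2 eta False qp by (auto intro!: mult_pos_pos sin_gt_zero)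
      then have "crs (unitv q') (?B *v ?y) > 0" "crs (?B *v ?y) (unitv p') > 0" using q'p' by blast+
      then show ?thesis unfolding y'
        using q'p'(1,2,3) reach' F' by (intro disjI2 exI[of _ q'] exI[of _ p']) metis
    qed
  qed
qed

text \<open>If the arc at time \<open>Suc n\<close>, enlarged by one more rotation, were still
  shorter than \<open>pi\<close>, then \<open>arc_product_le\<close> would cap the quotient of
  \<open>reachable_arc\<close> by \<open>(norm y)\<^sup>2 / (2 * tan \<eta>)\<close> with
  \<open>y\<close> the unperturbed image of \<open>v\<close>, which is too short for that. So the
  enlargement covers all directions; it takes the extra step to \<open>Suc (Suc n)\<close>.\<close>

lemma reaches_or_growth:
  fixes T :: "'a \<Rightarrow> 'a"
  assumes det1: "\<And>y. det (A y) = 1" and eta: "0 < \<eta>" "\<eta> < pi / 2" and v: "norm v = 1"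
    and less: "(norm (cocycle T A (Suc n) x *v v))\<^sup>2 < (tan \<eta>)\<^sup>2 * ((1 + sin \<eta>) / (1 - sin \<eta>)) ^ n"
    and w: "w \<noteq> 0"
  shows "reaches T A \<eta> (Suc (Suc n)) x v w"
proof -
  let ?B = "A ((T ^^ Suc n) x)" and ?y = "cocycle T A (Suc n) x *v v" and ?\<rho> = "(1 + sin \<eta>) / (1 - sin \<eta>)"
  have te: "tan \<eta> > 0" using eta by (intro tan_gt_zero)
  show ?thesis
    using reachable_arc[of A \<eta> v T n x, OF det1 eta v]
  proof (elim disjE exE conjE)
    assume all: "\<forall>w. w \<noteq> 0 \<longrightarrow> reaches T A \<eta> (Suc n) x v w"
    show ?thesis by (rule reaches_all_step[of A, OF det1 _ all w]) (use eta in simp)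
  next
    fix q p
    assume qp: "q < p" "p < q + pi"
      and reach: "\<forall>t. q \<le> t \<and> t \<le> p \<longrightarrow> reaches T A \<eta> (Suc n) x v (unitv t)"
      and pos: "crs (unitv q) ?y > 0" "crs ?y (unitv p) > 0"
      and F: "tan \<eta> / 2 * ?\<rho> ^ n \<le> crs (unitv q) ?y * crs ?y (unitv p) / sin (p - q)"
    have False if small: "p + \<eta> < q - \<eta> + pi"
    proof -
      obtain \<xi> where x1: "q < \<xi>" and x2: "\<xi> < p"
        and cq: "\<And>t. crs (unitv t) ?y = norm ?y * sin (\<xi> - t)"
        and cp: "\<And>t. crs ?y (unitv t) = norm ?y * sin (t - \<xi>)"
        using cone_polar[OF qp pos] by metis
      have "sin (\<xi> - q) * sin (p - \<xi>) / sin (\<xi> - q + (p - \<xi>)) \<le> 1 / (2 * tan \<eta>)"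
        by (rule arc_product_le) (use x1 x2 eta small in auto)
      then have "(norm ?y)\<^sup>2 * (sin (\<xi> - q) * sin (p - \<xi>) / sin (p - q)) \<le> (norm ?y)\<^sup>2 * (1 / (2 * tan \<eta>))"
        by (intro mult_left_mono) auto
      then have "crs (unitv q) ?y * crs ?y (unitv p) / sin (p - q) \<le> (norm ?y)\<^sup>2 / (2 * tan \<eta>)"
        unfolding cq cp by (simp add: power2_eq_square mult_ac)
      with F have "tan \<eta> / 2 * ?\<rho> ^ n \<le> (norm ?y)\<^sup>2 / (2 * tan \<eta>)" by linarith
      then have "(tan \<eta>)\<^sup>2 * ?\<rho> ^ n \<le> (norm ?y)\<^sup>2"
        using te by (simp add: field_simps power2_eq_square)
      then show False using less by simp
    qed
    then have "q - \<eta> + pi \<le> p + \<eta>" by (meson not_le)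
    then obtain s r where s: "q - \<eta> \<le> s" "s \<le> p + \<eta>" "?B *v unitv s = r *\<^sub>R w"
      using arc_covers[OF det1 _ w] by metis
    then show ?thesis by (rule reaches_arc_step[OF reach qp(1) eta(1)])
  qed
qed

section \<open>Ergodic upper bounds for subadditive processes\<close>

lemma orbit_sum_split:
  fixes f :: "'a \<Rightarrow> real"
  assumes "k \<le> m"
  shows "(\<Sum>i<m. f ((T ^^ i) x)) = (\<Sum>i<k. f ((T ^^ i) x)) + (\<Sum>i<m - k. f ((T ^^ i) ((T ^^ k) x)))"
proof -
  have "(\<Sum>i<m. f ((T ^^ i) x)) = (\<Sum>i<k. f ((T ^^ i) x)) + (\<Sum>i=k..<m. f ((T ^^ i) x))"
    using assms by (metis atLeast0LessThan sum.atLeastLessThan_concat zero_le)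
  also have "(\<Sum>i=k..<m. f ((T ^^ i) x)) = (\<Sum>i=0..<m - k. f ((T ^^ (i + k)) x))"
    using assms sum.shift_bounds_nat_ivl[of "\<lambda>i. f ((T ^^ i) x)" 0 k "m - k"] by simp
  finally show ?thesis by (simp add: funpow_add atLeast0LessThan)
qed

section \<open>Recurrence and the upper half of Birkhoff's theorem\<close>

locale ergodic_system = prob_space M for M :: "'a measure" +
  fixes T :: "'a \<Rightarrow> 'a"
  assumes space_UNIV: "space M = UNIV" and bij_T: "bij T"
    and T_meas [measurable]: "T \<in> measurable M M"
    and inv_T_meas [measurable]: "inv T \<in> measurable M M"
    and preserving: "distr M M T = M"
    and ergodic: "\<And>S. S \<in> sets M \<Longrightarrow> T -` S = S \<Longrightarrow> prob S = 0 \<or> prob S = 1"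
begin

lemma funpow_meas [measurable]: "T ^^ n \<in> measurable M M"
  by (induction n) (auto intro: measurable_comp)

lemma funpow_meas' [measurable]: "(\<lambda>x. (T ^^ n) x) \<in> measurable M M"
  using funpow_meas by simp

lemma inv_T_cancel [simp]: "inv T (T x) = x" "T (inv T x) = x"
  using bij_T by (auto simp: bij_is_inj bij_is_surj surj_f_inv_f)

lemma prob_vimage: "S \<in> sets M \<Longrightarrow> prob (T -` S) = prob S"
  using measure_distr[of T M M S] by (simp add: preserving space_UNIV)

lemma vimage_sets: "S \<in> sets M \<Longrightarrow> T -` S \<in> sets M"
  using measurable_sets[OF T_meas, of S] by (simp add: space_UNIV)

lemma funpow_vimage_sets: "S \<in> sets M \<Longrightarrow> (T ^^ n) -` S \<in> sets M"
  using measurable_sets[OF funpow_meas, of S n] by (simp add: space_UNIV)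

lemma prob_funpow_vimage: "S \<in> sets M \<Longrightarrow> prob ((T ^^ n) -` S) = prob S"
proof (induction n)
  case (Suc n)
  have "(T ^^ Suc n) -` S = T -` ((T ^^ n) -` S)" by (auto simp: funpow_swap1)
  then show ?case using Suc prob_vimage[OF funpow_vimage_sets, of S n] by (simp only:)
qed simp

lemma integral_T:
  fixes f :: "'a \<Rightarrow> real"
  assumes [measurable]: "f \<in> borel_measurable M"
  shows "(\<integral>x. f ((T ^^ n) x) \<partial>M) = expectation f"
proof (induction n)
  case (Suc n)
  have "(\<integral>x. f ((T ^^ Suc n) x) \<partial>M) = (\<integral>x. f ((T ^^ n) x) \<partial>distr M M T)"
    by (subst integral_distr) (auto simp: funpow_swap1)
  then show ?case using Suc by (simp add: preserving)
qed simp

lemma AE_orbit: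
  assumes "AE x in M. P x"
  shows "AE x in M. \<forall>n. P ((T ^^ n) x)"
proof -
  have "AE x in M. P ((T ^^ n) x)" for n
  proof (induction n)
    case (Suc n)
    then have "AE x in distr M M T. P ((T ^^ n) x)" unfolding preserving .
    from AE_distrD[OF T_meas this] show ?case by (simp add: funpow_swap1)
  qed (use assms in simp)
  then show ?thesis by (simp add: AE_all_countable)
qed

text \<open>The preimages of \<open>S\<close> increase and all have the measure of \<open>S\<close>;
  their union is strictly invariant, as \<open>ergodic\<close> demands.\<close>

lemma forward_invariant_trivial:
  assumes S: "S \<in> sets M" and fwd: "\<And>x. x \<in> S \<Longrightarrow> T x \<in> S"
  shows "prob S = 0 \<or> prob S = 1"
proof -
  define U where "U = (\<Union>n. (T ^^ n) -` S)"
  have U: "U \<in> sets M" unfolding U_def using funpow_vimage_sets[OF S] by auto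
  have mono: "(T ^^ n) -` S \<subseteq> (T ^^ Suc n) -` S" for n using fwd by auto
  have inc: "incseq (\<lambda>n. (T ^^ n) -` S)" using mono by (rule incseq_SucI)
  have "T -` U = U"
  proof -
    have "x \<in> T -` U \<longleftrightarrow> (\<exists>n. (T ^^ Suc n) x \<in> S)" for x by (simp add: U_def funpow_swap1)
    moreover have "x \<in> U \<longleftrightarrow> (\<exists>n. (T ^^ Suc n) x \<in> S)" for x
    proof
      assume "x \<in> U"
      then obtain n where "(T ^^ n) x \<in> S" by (auto simp: U_def)
      then have "(T ^^ Suc n) x \<in> S" using fwd by simp
      then show "\<exists>n. (T ^^ Suc n) x \<in> S" by blast
    next
      assume "\<exists>n. (T ^^ Suc n) x \<in> S"
      then show "x \<in> U" unfolding U_def by blast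
    qed
    ultimately show ?thesis by blast
  qed
  then have "prob U = 0 \<or> prob U = 1" by (rule ergodic[OF U])
  moreover have "(\<lambda>n. prob ((T ^^ n) -` S)) \<longlonglongrightarrow> prob U"
    unfolding U_def by (rule finite_Lim_measure_incseq[OF _ inc]) (use funpow_vimage_sets[OF S] in auto)
  then have "prob U = prob S"
    unfolding prob_funpow_vimage[OF S] by (simp add: LIMSEQ_const_iff)
  ultimately show ?thesis by simp
qed

lemma AE_not_in_prob_0: "S \<in> sets M \<Longrightarrow> prob S = 0 \<Longrightarrow> AE x in M. x \<notin> S"
  by (intro AE_not_in) (simp add: emeasure_eq_measure null_sets_def)

text \<open>Points that never visit \<open>S\<close> form a forward invariant set disjoint from
  \<open>S\<close>, which therefore cannot have full measure.\<close>

lemma AE_hits: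
  assumes S: "S \<in> sets M" and pos: "prob S > 0"
  shows "AE x in M. \<exists>n. (T ^^ n) x \<in> S"
proof -
  define N where "N = space M - (\<Union>n. (T ^^ n) -` S)"
  have N: "N \<in> sets M" unfolding N_def using funpow_vimage_sets[OF S] by auto
  have "T x \<in> N" if "x \<in> N" for x
  proof -
    have "(T ^^ Suc n) x \<notin> S" for n using that by (simp add: N_def del: funpow.simps)
    then show ?thesis by (simp add: N_def space_UNIV funpow_swap1)
  qed
  then have "prob N = 0 \<or> prob N = 1" by (rule forward_invariant_trivial[OF N])
  moreover have "prob N \<noteq> 1"
  proof
    assume "prob N = 1"
    have "S \<inter> N = {}" 
    proof -
      have "x \<in> (\<Union>n. (T ^^ n) -` S)" if "x \<in> S" for x using that by (intro UN_I[of 0]) auto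
      then show ?thesis unfolding N_def by blast
    qed
    then have "prob (S \<union> N) = prob S + prob N" using finite_measure_Union[OF S N] by simp
    then show False using pos \<open>prob N = 1\<close> prob_le_1[of "S \<union> N"] by linarith
  qed
  ultimately have "prob N = 0" by simp
  then have "AE x in M. x \<notin> N" by (rule AE_not_in_prob_0[OF N])
  then show ?thesis by (auto simp: N_def)
qed

lemma prob_tendsto_zero:
  assumes meas: "\<And>n::nat. B n \<in> sets M" and dec: "\<And>n. B (Suc n) \<subseteq> B n"
    and null: "AE x in M. \<exists>n. x \<notin> B n" and "\<epsilon> > 0"
  obtains n where "prob (B n) < \<epsilon>"
proof -
  have "(\<lambda>n. prob (B n)) \<longlonglongrightarrow> prob (\<Inter>n. B n)"
    by (rule finite_Lim_measure_decseq) (use meas dec in \<open>auto intro: decseq_SucI\<close>)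
  moreover have "prob (\<Inter>n. B n) = 0"
  proof -
    have "AE x in M. x \<notin> (\<Inter>n. B n)" using null by auto
    then have "(\<Inter>n. B n) \<in> null_sets M" using meas by (subst AE_iff_null_sets) auto
    then show ?thesis by (simp add: measure_eq_0_null_sets)
  qed
  ultimately have "\<forall>\<^sub>F n in sequentially. prob (B n) < \<epsilon>"
    using \<open>\<epsilon> > 0\<close> by (auto dest: order_tendstoD)
  then show thesis using that by (auto simp: eventually_sequentially)
qed

lemma integrable_bounded:
  fixes f :: "'a \<Rightarrow> real"
  assumes "f \<in> borel_measurable M" "\<And>x. 0 \<le> f x" "\<And>x. f x \<le> C"
  shows "integrable M f"
  by (rule integrable_const_bound[of _ C]) (use assms in auto)

text \<open>Orbits are covered with short blocks. If the sums exceeded \<open>c * n\<close> by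
  unbounded amounts almost everywhere, then outside a small set every point would start a block of
  length at most \<open>N\<close> with average at least \<open>c\<close>. Raising \<open>f\<close>
  by \<open>c\<close> on the small set makes this true everywhere, and integration gives
  \<open>c \<le> expectation f\<close> up to a small error.\<close>

lemma birkhoff_upper:
  fixes f :: "'a \<Rightarrow> real"
  assumes f [measurable]: "f \<in> borel_measurable M" and f0: "\<And>x. 0 \<le> f x" and fC: "\<And>x. f x \<le> C"
    and c: "expectation f < c"
  shows "AE x in M. \<exists>K. \<forall>n. (\<Sum>i<n. f ((T ^^ i) x)) \<le> c * real n + K"
proof -
  define S where "S n x = (\<Sum>i<n. f ((T ^^ i) x))" for n x
  have S_meas [measurable]: "S n \<in> borel_measurable M" for n unfolding S_def by measurable
  have S_Suc: "S (Suc n) x = f x + S n (T x)" for n x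
    unfolding S_def by (subst sum.lessThan_Suc_shift) (simp add: funpow_swap1)
  have "0 \<le> expectation f" using f0 by (intro integral_nonneg_AE) auto
  then have c0: "c > 0" using c by linarith
  \<comment> \<open>Asking for every offset \<open>K\<close> makes the set exactly invariant, since
    a shift by one step changes the excess over \<open>c * n\<close> by a bounded amount.\<close>
  define E where "E = {x \<in> space M. \<forall>K::nat. \<exists>n. S n x > c * real n + real K}"
  have E: "E \<in> sets M" unfolding E_def by measurable
  have "T -` E = E"
  proof -
    have "x \<in> E" if "T x \<in> E" for x
    proof -
      have "\<exists>n. S n x > c * real n + real K" for K
      proof -
        obtain K' :: nat where K': "real K + c \<le> real K'" using real_arch_simple by blast
        obtain n where "S n (T x) > c * real n + real K'" using \<open>T x \<in> E\<close> by (auto simp: E_def)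
        then have "S (Suc n) x > c * real (Suc n) + real K"
          using K' f0[of x] by (simp add: S_Suc algebra_simps)
        then show ?thesis by blast
      qed
      then show ?thesis by (simp add: E_def space_UNIV)
    qed
    moreover have "T x \<in> E" if "x \<in> E" for x
    proof -
      have "\<exists>n. S n (T x) > c * real n + real K" for K
      proof -
        obtain K' :: nat where K': "real K + C \<le> real K'" using real_arch_simple by blast
        obtain n where n: "S n x > c * real n + real K'" using \<open>x \<in> E\<close> by (auto simp: E_def)
        have "C \<ge> 0" using f0 fC order_trans by blast
        then have "n \<noteq> 0" using n by (cases n) (auto simp: S_def)
        then obtain m where m: "n = Suc m" by (cases n) auto
        have "S m (T x) > c * real m + real K"
          using n K' fC[of x] c0 by (simp add: m S_Suc algebra_simps)
        then show ?thesis by blast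
      qed
      then show ?thesis by (simp add: E_def space_UNIV)
    qed
    ultimately show ?thesis by auto
  qed
  then consider "prob E = 0" | "prob E = 1" using ergodic[OF E] by blast
  then show ?thesis
  proof cases
    case 1
    then have "AE x in M. x \<notin> E" by (rule AE_not_in_prob_0[OF E])
    then show ?thesis
    proof eventually_elim
      case (elim x)
      then obtain K :: nat where "\<And>n. \<not> S n x > c * real n + real K" by (auto simp: E_def space_UNIV)
      then show ?case by (intro exI[of _ "real K"]) (auto simp: S_def not_less)
    qed
  next
    case 2
    define B where "B N = {x \<in> space M. \<forall>n. 1 \<le> n \<and> n \<le> N \<longrightarrow> S n x < c * real n}" for N
    have B_meas [measurable]: "B N \<in> sets M" for N unfolding B_def by measurable
    have AEE: "AE x in M. x \<in> E" using 2 E by (simp add: prob_eq_1)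
    have bnd: "c \<le> expectation f + c * prob (B N)" for N
    proof -
      define f' where "f' x = f x + c * indicator (B N) x" for x
      have f'_meas [measurable]: "f' \<in> borel_measurable M" unfolding f'_def by measurable
      have f'0: "f' x \<ge> 0" "f' x \<ge> f x" for x using f0 c0 by (auto simp: f'_def)
      have f'C: "f' x \<le> C + c" for x using fC[of x] c0 by (auto simp: f'_def indicator_def)
      \<comment> \<open>Greedy covering: jump over blocks with average at least \<open>c\<close>; at
        most the last \<open>N\<close> times remain uncovered.\<close>
      have low: "c * (real m - real N) \<le> (\<Sum>i<m. f' ((T ^^ i) x))" for m x
      proof (induction m arbitrary: x rule: less_induct)
        case (less m)
        show ?case
        proof (cases "m \<le> N")
          case True
          then have "c * (real m - real N) \<le> 0" using c0 by (simp add: mult_le_0_iff)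
          also have "\<dots> \<le> (\<Sum>i<m. f' ((T ^^ i) x))" by (intro sum_nonneg f'0)
          finally show ?thesis .
        next
          case False
          obtain k where k: "1 \<le> k" "k \<le> N \<or> k = 1" "c * real k \<le> (\<Sum>i<k. f' ((T ^^ i) x))"
          proof (cases "x \<in> B N")
            case True
            then show thesis using that[of 1] f0[of x] by (simp add: f'_def)
          next
            case False
            then obtain n where n: "1 \<le> n" "n \<le> N" "S n x \<ge> c * real n"
              by (auto simp: B_def space_UNIV not_less)
            have "S n x \<le> (\<Sum>i<n. f' ((T ^^ i) x))" unfolding S_def by (intro sum_mono f'0)
            then show thesis using that[of n] n by auto
          qed
          then have "k \<le> m" using False by auto
          have "c * (real (m - k) - real N) \<le> (\<Sum>i<m - k. f' ((T ^^ i) ((T ^^ k) x)))"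
            using less[of "m - k" "(T ^^ k) x"] k \<open>k \<le> m\<close> by auto
          then show ?thesis using k(3) \<open>k \<le> m\<close> unfolding orbit_sum_split[OF \<open>k \<le> m\<close>]
            by (simp add: of_nat_diff algebra_simps)
        qed
      qed
      have int': "integrable M (\<lambda>x. f' ((T ^^ i) x))" for i
        by (rule integrable_bounded[of _ "C + c"]) (use f'0 f'C in auto)
      have "c * (real m - real N) \<le> real m * (\<integral>x. f' x \<partial>M)" for m
      proof -
        have "c * (real m - real N) = (\<integral>x. c * (real m - real N) \<partial>M)" by (simp add: prob_space)
        also have "\<dots> \<le> (\<integral>x. (\<Sum>i<m. f' ((T ^^ i) x)) \<partial>M)"
          by (intro integral_mono low) (use int' in auto)
        also have "\<dots> = (\<Sum>i<m. (\<integral>x. f' ((T ^^ i) x) \<partial>M))" using int' by (intro Bochner_Integration.integral_sum) auto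
        also have "\<dots> = real m * (\<integral>x. f' x \<partial>M)" by (simp add: integral_T[OF f'_meas])
        finally show ?thesis .
      qed
      then have *: "real m * (c - (\<integral>x. f' x \<partial>M)) \<le> c * real N" for m by (simp add: algebra_simps)
      have "c \<le> (\<integral>x. f' x \<partial>M)"
      proof (rule ccontr)
        assume "\<not> c \<le> (\<integral>x. f' x \<partial>M)"
        then have d: "c - (\<integral>x. f' x \<partial>M) > 0" by simp
        obtain m :: nat where "c * real N < real m * (c - (\<integral>x. f' x \<partial>M))"
          using reals_Archimedean3[OF d] by blast
        with *[of m] show False by linarith
      qed
      also have "(\<integral>x. f' x \<partial>M) = expectation f + c * prob (B N)"
      proof -
        have "integrable M f" by (rule integrable_bounded[of _ C]) (use f0 fC in auto)
        moreover have "integrable M (\<lambda>x. c * indicator (B N) x :: real)"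
          by (intro integrable_mult_right integrable_real_indicator) (auto simp: emeasure_eq_measure)
        ultimately show ?thesis unfolding f'_def by (simp add: emeasure_eq_measure)
      qed
      finally show ?thesis .
    qed
    have "AE x in M. \<exists>N. x \<notin> B N"
      using AEE
    proof eventually_elim
      case (elim x)
      then obtain n where n: "S n x > c * real n + real (0::nat)" unfolding E_def by blast
      then have "n \<ge> 1" by (cases n) (auto simp: S_def)
      then have "x \<notin> B n" using n by (auto simp: B_def)
      then show ?case by blast
    qed
    moreover have "B (Suc N) \<subseteq> B N" for N by (auto simp: B_def)
    moreover have "(c - expectation f) / c > 0" using c c0 by simp
    ultimately obtain N where "prob (B N) < (c - expectation f) / c"
      using prob_tendsto_zero[of B] B_meas by metis
    then have "c * prob (B N) < c - expectation f" using c0 by (simp add: field_simps)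
    with bnd[of N] show ?thesis by linarith
  qed
qed

end

section \<open>The upper half of Kingman's theorem\<close>

locale subadditive_process = ergodic_system +
  fixes V :: "nat \<Rightarrow> 'a \<Rightarrow> real" and C :: real
  assumes V_meas [measurable]: "\<And>n. V n \<in> borel_measurable M"
    and V_nonneg: "\<And>n x. 0 \<le> V n x"
    and V_le: "\<And>n x. V n x \<le> real n * C"
    and V_add: "\<And>m n x. V (m + n) x \<le> V n x + V m ((T ^^ n) x)"
begin

lemma C_nonneg: "0 \<le> C"
  using V_nonneg[of 1] V_le[of 1] by (metis mult_1 of_nat_1 order_trans)

lemma V_integrable: "integrable M (V n)"
  by (rule integrable_bounded[of _ "real n * C"]) (use V_nonneg V_le in auto)

text \<open>Summing the decompositions over all \<open>p\<close> offsets telescopes.\<close>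
lemma block_average:
  assumes "p \<ge> 1"
  shows "real p * V (p + j) x \<le> (\<Sum>t<j. V p ((T ^^ t) x)) + 2 * (real p)\<^sup>2 * C"
proof -
  define H where "H k x = (\<Sum>s<p. V (k - s) ((T ^^ s) x))" for k x
  \<comment> \<open>Only one term of \<open>H (Suc k) x\<close> and one of \<open>H k (T x)\<close>
    do not cancel, and a single use of subadditivity compares them.\<close>
  have step: "H (Suc k) x \<le> V p x + H k (T x)" if "p \<le> k" for k x
  proof -
    obtain q where q: "p = Suc q" using assms by (cases p) auto
    have "H (Suc k) x = V (Suc k) x + (\<Sum>s<q. V (k - s) ((T ^^ s) (T x)))"
      unfolding H_def q by (subst sum.lessThan_Suc_shift) (simp add: funpow_swap1)
    moreover have "H k (T x) = (\<Sum>s<q. V (k - s) ((T ^^ s) (T x))) + V (k - q) ((T ^^ q) (T x))"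
      unfolding H_def q by simp
    moreover have "V (Suc k) x \<le> V p x + V (k - q) ((T ^^ q) (T x))"
      using V_add[of "k - q" p x] that q by (simp add: funpow_swap1)
    ultimately show ?thesis by linarith
  qed
  have Hsum: "H (p + j) x \<le> (\<Sum>t<j. V p ((T ^^ t) x)) + H p ((T ^^ j) x)"
  proof (induction j arbitrary: x)
    case (Suc j)
    have "H (p + Suc j) x \<le> V p x + H (p + j) (T x)" using step[of "p + j" x] by simp
    also have "\<dots> \<le> V p x + ((\<Sum>t<j. V p ((T ^^ t) (T x))) + H p ((T ^^ j) (T x)))"
      using Suc by simp
    also have "\<dots> = (\<Sum>t<Suc j. V p ((T ^^ t) x)) + H p ((T ^^ Suc j) x)"
      by (subst sum.lessThan_Suc_shift) (simp add: funpow_swap1)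
    finally show ?case .
  qed simp
  have Hp: "H p y \<le> (real p)\<^sup>2 * C" for y
  proof -
    have "H p y \<le> (\<Sum>s<p. real p * C)" unfolding H_def
    proof (rule sum_mono)
      fix s
      have "V (p - s) ((T ^^ s) y) \<le> real (p - s) * C" by (rule V_le)
      also have "\<dots> \<le> real p * C" using C_nonneg by (intro mult_right_mono) auto
      finally show "V (p - s) ((T ^^ s) y) \<le> real p * C" .
    qed
    then show ?thesis by (simp add: power2_eq_square)
  qed
  have "real p * V (p + j) x = (\<Sum>s<p. V (p + j) x)" by simp
  also have "\<dots> \<le> (\<Sum>s<p. real p * C + V (p + j - s) ((T ^^ s) x))"
  proof (rule sum_mono)
    fix s assume "s \<in> {..<p}"
    then have "V (p + j) x \<le> V s x + V (p + j - s) ((T ^^ s) x)"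
      using V_add[of "p + j - s" s x] by simp
    moreover have "V s x \<le> real p * C"
      using V_le[of s x] C_nonneg \<open>s \<in> {..<p}\<close> by (smt (verit) lessThan_iff mult_right_mono of_nat_less_iff)
    ultimately show "V (p + j) x \<le> real p * C + V (p + j - s) ((T ^^ s) x)" by linarith
  qed
  also have "\<dots> = (real p)\<^sup>2 * C + H (p + j) x" by (simp add: H_def sum.distrib power2_eq_square)
  finally show ?thesis using Hsum Hp[of "(T ^^ j) x"] by linarith
qed

text \<open>\<open>block_average\<close> divided by \<open>p\<close> bounds \<open>V n\<close> by an
  orbit sum of \<open>V p / p\<close>, to which \<open>birkhoff_upper\<close> applies. The constant
  depends on the point and absorbs the times below \<open>p\<close> and the boundary blocks.\<close>

lemma kingman_upper:
  assumes p: "p \<ge> 1" and c: "expectation (V p) < c * real p"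
  shows "AE x in M. \<exists>K. \<forall>n. V n x \<le> c * real n + K"
proof -
  have "AE x in M. \<exists>K. \<forall>n. (\<Sum>i<n. V p ((T ^^ i) x)) \<le> c * real p * real n + K"
    by (rule birkhoff_upper[OF V_meas V_nonneg V_le c])
  then show ?thesis
  proof eventually_elim
    case (elim x)
    then obtain K where K: "\<And>n. (\<Sum>i<n. V p ((T ^^ i) x)) \<le> c * real p * real n + K" by blast
    have "0 \<le> expectation (V p)" using V_nonneg by (intro integral_nonneg_AE) auto
    then have c0: "c > 0" using c p by (metis le_less_trans mult.commute of_nat_0_le_iff zero_less_mult_pos2 mult_nonpos_nonneg not_le)
    have "V n x \<le> c * real n + (\<bar>K\<bar> + 2 * (real p)\<^sup>2 * C + real p * C)" for n
    proof (cases "n \<ge> p")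
      case True
      then obtain j where j: "n = p + j" using le_Suc_ex by blast
      have "real p * V n x \<le> c * real p * real j + K + 2 * (real p)\<^sup>2 * C"
        using block_average[OF p, of j x] K[of j] by (simp add: j)
      also have "\<dots> \<le> real p * (c * real n) + real p * (\<bar>K\<bar> + 2 * (real p)\<^sup>2 * C)"
      proof -
        have "c * real p * real j \<le> real p * (c * real n)"
          using c0 p by (simp add: j algebra_simps)
        moreover have "K + 2 * (real p)\<^sup>2 * C \<le> 1 * (\<bar>K\<bar> + 2 * (real p)\<^sup>2 * C)" by simp
        moreover have "\<dots> \<le> real p * (\<bar>K\<bar> + 2 * (real p)\<^sup>2 * C)"
          using p C_nonneg by (intro mult_right_mono) auto
        ultimately show ?thesis by linarith
      qed
      finally have "real p * V n x \<le> real p * (c * real n + (\<bar>K\<bar> + 2 * (real p)\<^sup>2 * C))"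
        by (simp add: algebra_simps)
      then have "V n x \<le> c * real n + (\<bar>K\<bar> + 2 * (real p)\<^sup>2 * C)" using p by simp
      then show ?thesis using C_nonneg by (smt (verit) mult_nonneg_nonneg of_nat_0_le_iff)
    next
      case False
      have "V n x \<le> real n * C" by (rule V_le)
      also have "\<dots> \<le> real p * C" using False C_nonneg by (intro mult_right_mono) auto
      finally show ?thesis using C_nonneg c0 by (smt (verit) mult_nonneg_nonneg of_nat_0_le_iff zero_le_power2)
    qed
    then show ?case by blast
  qed
qed

text \<open>Outside a set of small measure the constant of \<open>kingman_upper\<close> becomes
  uniform, because the exceptional sets decrease to a null set.\<close>

lemma kingman_upper_prob:
  assumes "p \<ge> 1" "expectation (V p) < c * real p" "\<epsilon> > 0"
  obtains K :: nat where "prob {x \<in> space M. \<exists>n. V n x > c * real n + real K} < \<epsilon>"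
proof -
  have "AE x in M. \<exists>K::nat. x \<notin> {x \<in> space M. \<exists>n. V n x > c * real n + real K}"
    using kingman_upper[OF assms(1,2)]
  proof eventually_elim
    case (elim x)
    then obtain K where K: "\<And>n. V n x \<le> c * real n + K" by blast
    obtain k :: nat where "K \<le> real k" using real_arch_simple by blast
    then have "\<not> V n x > c * real n + real k" for n using K[of n] by linarith
    then show ?case by blast
  qed
  moreover have "{x \<in> space M. \<exists>n. V n x > c * real n + real (Suc K)}
      \<subseteq> {x \<in> space M. \<exists>n. V n x > c * real n + real K}" for K
  proof -
    have "c * real n + real K < V n x" if "c * real n + real (Suc K) < V n x" for n x using that by simp
    then show ?thesis by blast
  qed
  ultimately show thesis
    using prob_tendsto_zero[of "\<lambda>K. {x \<in> space M. \<exists>n. V n x > c * real n + real K}" \<epsilon> thesis]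
      assms(3) that by auto
qed

end

section \<open>Optimally controlled growth\<close>

lemma continuous_on_matrix_mult:
  fixes f g :: "'a::topological_space \<Rightarrow> real^2^2"
  assumes "continuous_on S f" "continuous_on S g"
  shows "continuous_on S (\<lambda>x. f x ** g x)"
  unfolding matrix_matrix_mult_def
  by (intro continuous_on_vec_lambda continuous_on_sum continuous_on_mult continuous_on_component assms)

lemma borel_measurable_matrix_mult [measurable (raw)]:
  fixes f g :: "'a \<Rightarrow> real^2^2"
  assumes "f \<in> borel_measurable M" "g \<in> borel_measurable M"
  shows "(\<lambda>x. f x ** g x) \<in> borel_measurable M"
  using assms by (rule borel_measurable_continuous_Pair)
    (intro continuous_on_matrix_mult continuous_on_fst continuous_on_snd continuous_on_id)

lemma continuous_on_rot: "continuous_on S f \<Longrightarrow> continuous_on S (\<lambda>x. rot (f x))"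
proof -
  assume "continuous_on S f"
  have "rot t = (\<chi> i j. if i = 1 then (if j = 1 then cos t else - sin t) else (if j = 1 then sin t else cos t))" for t
    by (simp add: vec2_eq_iff rot_def)
  moreover have "continuous_on S (\<lambda>x. if i = 1 then (if j = 1 then cos (f x) else - sin (f x))
      else (if j = 1 then sin (f x) else cos (f x)))" for i j :: 2
    using \<open>continuous_on S f\<close> by (cases "i = 1"; cases "j = 1") (auto intro!: continuous_on_minus continuous_on_compose2[of UNIV cos] continuous_on_compose2[of UNIV sin]
        continuous_at_imp_continuous_on isCont_cos isCont_sin)
  ultimately show ?thesis by (auto intro!: continuous_on_vec_lambda)
qed

lemma borel_measurable_rot [measurable (raw)]:
  assumes "f \<in> borel_measurable M"
  shows "(\<lambda>x. rot (f x)) \<in> borel_measurable M"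
proof -
  have "rot \<in> borel_measurable borel"
    by (intro borel_measurable_continuous_onI) (use continuous_on_rot[of UNIV "\<lambda>x. x"] in simp)
  then show ?thesis using assms by (rule measurable_compose_rev)
qed

lemma opnorm_mult_rot_le: "opnorm (B ** rot t) \<le> opnorm B"
  using opnorm_mult[of B "rot t"] by simp

lemma matrix_diff_mult:
  fixes A B C :: "real^2^2"
  shows "A ** (B - C) = A ** B - A ** C" "(A - B) ** C = A ** C - B ** C"
  by (simp_all add: vec2_eq_iff matrix_matrix_mult_def sum_2 algebra_simps)

lemma controlled_matprod: "controlled T A \<theta> n x = matprod (\<lambda>i. A ((T ^^ i) x) ** rot (\<theta> i)) n"
  by (induction n) auto

lemma controlled_opnorm_le: "(\<And>y. opnorm (A y) \<le> \<Lambda>) \<Longrightarrow> opnorm (controlled T A \<theta> n x) \<le> \<Lambda> ^ n"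
  unfolding controlled_matprod by (rule opnorm_matprod_le) (rule order_trans[OF opnorm_mult_rot_le])

lemma matprod_diff:
  assumes "\<And>i. opnorm (B i) \<le> \<Lambda>" "\<And>i. opnorm (D i) \<le> \<Lambda>" "1 \<le> \<Lambda>"
  shows "opnorm (matprod B n - matprod D n) \<le> \<Lambda> ^ n * (\<Sum>i<n. opnorm (B i - D i))"
proof (induction n)
  case 0
  have "opnorm (0 :: real^2^2) \<le> 0" by (rule opnorm_le) simp
  then show ?case by simp
next
  case (Suc n)
  have "matprod B (Suc n) - matprod D (Suc n) = B n ** (matprod B n - matprod D n) + (B n - D n) ** matprod D n"
    by (simp add: matrix_diff_mult)
  then have "opnorm (matprod B (Suc n) - matprod D (Suc n))
      \<le> opnorm (B n) * opnorm (matprod B n - matprod D n) + opnorm (B n - D n) * opnorm (matprod D n)"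
    by (simp only:) (intro order_trans[OF opnorm_triangle] add_mono opnorm_mult)
  also have "\<dots> \<le> \<Lambda> * (\<Lambda> ^ n * (\<Sum>i<n. opnorm (B i - D i))) + opnorm (B n - D n) * \<Lambda> ^ n"
    using assms by (intro add_mono mult_mono Suc opnorm_matprod_le opnorm_nonneg) auto
  also have "\<dots> \<le> \<Lambda> * (\<Lambda> ^ n * (\<Sum>i<n. opnorm (B i - D i))) + opnorm (B n - D n) * \<Lambda> ^ Suc n"
    using assms by (intro add_left_mono mult_left_mono power_increasing opnorm_nonneg) auto
  also have "\<dots> = \<Lambda> ^ Suc n * (\<Sum>i<Suc n. opnorm (B i - D i))" by (simp add: algebra_simps)
  finally show ?case .
qed

text \<open>Norms of determinant-one products are at least \<open>1\<close>, where the logarithm is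
  1-Lipschitz, so \<open>matprod_diff\<close> carries over. The error is a sum of pointwise
  distances, so in the mean only the \<open>L\<^sup>1\<close> distance of two cocycles
  enters.\<close>

lemma ln_opnorm_matprod_diff:
  assumes "\<And>i. opnorm (B i) \<le> \<Lambda>" "\<And>i. opnorm (D i) \<le> \<Lambda>" "1 \<le> \<Lambda>"
    and "\<And>i. det (B i) = 1" "\<And>i. det (D i) = 1"
  shows "ln (opnorm (matprod B n)) \<le> ln (opnorm (matprod D n)) + \<Lambda> ^ n * (\<Sum>i<n. opnorm (B i - D i))"
proof -
  let ?a = "opnorm (matprod B n)" and ?b = "opnorm (matprod D n)"
  let ?e = "\<Lambda> ^ n * (\<Sum>i<n. opnorm (B i - D i))"
  have b: "?b \<ge> 1" and a: "?a \<ge> 1" using assms by (auto intro!: opnorm_ge_1 det_matprod)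
  have e0: "?e \<ge> 0" using assms by (intro mult_nonneg_nonneg sum_nonneg opnorm_nonneg) auto
  have "?a \<le> ?b + ?e"
    using opnorm_diff_le[of "matprod B n" "matprod D n"] matprod_diff[of B \<Lambda> D n] assms by fastforce
  moreover have "?b * (1 + ?e / ?b) = ?b + ?e" using b by (simp add: distrib_left)
  ultimately have "ln ?a \<le> ln (?b * (1 + ?e / ?b))" using a by (intro ln_mono) auto
  also have "\<dots> = ln ?b + ln (1 + ?e / ?b)" using b e0
    by (intro ln_mult_pos) (auto intro!: add_pos_nonneg divide_nonneg_nonneg)
  also have "ln (1 + ?e / ?b) \<le> ?e / ?b" using b e0 by (intro ln_add_one_self_le_self) auto
  also have "?e / ?b \<le> ?e / 1" using b e0 by (intro divide_left_mono) auto
  finally show ?thesis by simp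
qed

text \<open>Zero controls may be added before and after the steering segment, since invertible
  matrices carry nonzero vectors and targets along. This gives a common steering time for points
  that enter the good set at different times \<open>r\<close>.\<close>

lemma reaches_total_extend:
  assumes det1: "\<And>y. det (A y) = 1" and eta: "0 \<le> \<eta>"
    and total: "\<And>v w. norm v = 1 \<Longrightarrow> w \<noteq> 0 \<Longrightarrow> reaches T A \<eta> m ((T ^^ r) y) v w"
    and v: "v \<noteq> 0" and w: "w \<noteq> 0"
  shows "reaches T A \<eta> (k + (m + r)) y v w"
proof -
  let ?W0 = "cocycle T A r y" and ?W2 = "cocycle T A k ((T ^^ (m + r)) y)"
  have d: "det ?W0 = 1" "det ?W2 = 1" by (intro det_cocycle det1)+
  let ?v = "?W0 *v v" and ?w = "matrix_inv ?W2 *v w"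
  have v0: "?v \<noteq> 0" using det1_norm_le[OF d(1), of v] v by auto
  have Ww: "?W2 *v ?w = w" using det1_inverse[OF d(2)] by (simp add: matrix_vector_mul_assoc)
  then have w0: "?w \<noteq> 0" using w by (metis matrix_vector_mult_0_right)
  have "reaches T A \<eta> m ((T ^^ r) y) ((1 / norm ?v) *\<^sub>R ?v) ?w"
    by (rule total) (use v0 w0 in auto)
  then obtain \<theta> \<rho> where \<theta>: "\<And>i. \<bar>\<theta> i\<bar> \<le> \<eta>"
    "controlled T A \<theta> m ((T ^^ r) y) *v ((1 / norm ?v) *\<^sub>R ?v) = \<rho> *\<^sub>R ?w"
    unfolding reaches_def by blast
  have "norm ?v *\<^sub>R (controlled T A \<theta> m ((T ^^ r) y) *v ((1 / norm ?v) *\<^sub>R ?v)) = norm ?v *\<^sub>R (\<rho> *\<^sub>R ?w)"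
    using \<theta>(2) by simp
  then have \<theta>2: "controlled T A \<theta> m ((T ^^ r) y) *v ?v = (norm ?v * \<rho>) *\<^sub>R ?w"
    using v0 by (simp add: matrix_vector_mult_scaleR)
  define \<theta>1 where "\<theta>1 = (\<lambda>i. if i < r then (\<lambda>_. 0) i else \<theta> (i - r))"
  define \<theta>' where "\<theta>' = (\<lambda>i. if i < m + r then \<theta>1 i else (\<lambda>_. 0) (i - (m + r)))"
  have "controlled T A \<theta>' (k + (m + r)) y
      = controlled T A (\<lambda>_. 0) k ((T ^^ (m + r)) y) ** controlled T A \<theta>1 (m + r) y"
    unfolding \<theta>'_def by (rule controlled_add)
  also have "controlled T A \<theta>1 (m + r) y = controlled T A \<theta> m ((T ^^ r) y) ** controlled T A (\<lambda>_. 0) r y"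
    unfolding \<theta>1_def by (rule controlled_add)
  finally have "controlled T A \<theta>' (k + (m + r)) y *v v = ?W2 *v (controlled T A \<theta> m ((T ^^ r) y) *v ?v)"
    by (simp only: controlled_zero matrix_vector_mul_assoc matrix_mul_assoc)
  also have "\<dots> = (norm ?v * \<rho>) *\<^sub>R w" unfolding \<theta>2 matrix_vector_mult_scaleR Ww ..
  finally show ?thesis
    unfolding reaches_def using \<theta>(1) eta by (intro exI[of _ \<theta>'] exI[of _ "norm ?v * \<rho>"]) (auto simp: \<theta>'_def \<theta>1_def)
qed

text \<open>Sending the most expanded direction of \<open>P1\<close> to the most contracted one of \<open>P2\<close> makes the two
  expansions cancel instead of multiply.\<close>
lemma opnorm_cancellation:
  assumes d: "det P1 = 1" "det P2 = 1"
    and s1: "norm s1 = 1" "norm (P1 *v s1) * opnorm P1 = 1"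
    and s2: "norm s2 = 1" "norm (P2 *v s2) * opnorm P2 = 1"
    and W: "W *v (P1 *v quarter_turn s1) = \<rho> *\<^sub>R s2" "opnorm W \<le> b"
  shows "opnorm (P2 ** (W ** P1)) \<le> b * (opnorm P1 + opnorm P2)"
proof (rule opnorm_le)
  fix v :: "real^2"
  let ?u = "quarter_turn s1" and ?\<sigma>1 = "opnorm P1" and ?\<sigma>2 = "opnorm P2"
  have o1: "?\<sigma>1 \<ge> 1" "?\<sigma>2 \<ge> 1" using d by (auto intro: opnorm_ge_1)
  have n1: "norm (P1 *v s1) \<le> 1" using s1(2) o1 by (smt (verit) mult_le_cancel_left1 norm_ge_zero)
  have n2: "norm (P2 *v s2) \<le> 1" using s2(2) o1 by (smt (verit) mult_le_cancel_left1 norm_ge_zero)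
  have b0: "b \<ge> 0" using W(2) opnorm_nonneg order_trans by blast
  have a1: "norm (P2 *v (W *v (P1 *v s1))) \<le> b * ?\<sigma>2"
  proof -
    have "norm (P2 *v (W *v (P1 *v s1))) \<le> ?\<sigma>2 * (opnorm W * norm (P1 *v s1))"
      by (meson opnorm_bound opnorm_nonneg mult_left_mono order_trans)
    also have "\<dots> \<le> ?\<sigma>2 * (b * 1)"
      using W n1 b0 o1 by (intro mult_left_mono mult_mono) auto
    finally show ?thesis by (simp add: mult.commute)
  qed
  have rho: "\<bar>\<rho>\<bar> \<le> b * ?\<sigma>1"
  proof -
    have "\<bar>\<rho>\<bar> = norm (W *v (P1 *v ?u))" using W(1) s2 by simp
    also have "\<dots> \<le> opnorm W * (?\<sigma>1 * norm ?u)"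
      by (meson opnorm_bound opnorm_nonneg mult_left_mono order_trans)
    also have "\<dots> \<le> b * (?\<sigma>1 * 1)" using W s1 b0 o1 by (intro mult_mono) auto
    finally show ?thesis by simp
  qed
  have a2: "norm (P2 *v (W *v (P1 *v ?u))) \<le> b * ?\<sigma>1"
  proof -
    have "norm (P2 *v (W *v (P1 *v ?u))) = \<bar>\<rho>\<bar> * norm (P2 *v s2)"
      by (simp add: W(1) matrix_vector_mult_scaleR)
    also have "\<dots> \<le> (b * ?\<sigma>1) * 1" using rho n2 b0 o1 by (intro mult_mono) auto
    finally show ?thesis by simp
  qed
  let ?Q = "P2 ** (W ** P1)"
  have Q: "?Q *v w = P2 *v (W *v (P1 *v w))" for w by (simp add: matrix_vector_mul_assoc matrix_mul_assoc)
  have "?Q *v v = ?Q *v (inner v s1 *\<^sub>R s1 + crs s1 v *\<^sub>R ?u)"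
    using orthonormal_decomp[OF s1(1), of v] by simp
  also have "\<dots> = inner v s1 *\<^sub>R (?Q *v s1) + crs s1 v *\<^sub>R (?Q *v ?u)"
    by (simp add: matrix_vector_right_distrib matrix_vector_mult_scaleR)
  finally have "norm (?Q *v v) \<le> \<bar>inner v s1\<bar> * norm (?Q *v s1) + \<bar>crs s1 v\<bar> * norm (?Q *v ?u)"
    by (metis norm_scaleR norm_triangle_ineq real_norm_def)
  also have "\<dots> \<le> norm v * (b * ?\<sigma>2) + norm v * (b * ?\<sigma>1)"
    using Cauchy_Schwarz_ineq2[of v s1] crs_le[of s1 v] s1 a1 a2 unfolding Q
    by (intro add_mono mult_mono) auto
  finally show "norm (?Q *v v) \<le> b * (?\<sigma>1 + ?\<sigma>2) * norm v" by (simp add: algebra_simps)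
qed

section \<open>The control problem and its value\<close>

locale controlled_system = ergodic_system M T for M :: "'a measure" and T +
  fixes A :: "'a \<Rightarrow> real^2^2" and \<Lambda> \<eta> :: real
  assumes A_meas [measurable]: "A \<in> borel_measurable M"
    and det1: "\<And>x. det (A x) = 1"
    and A_bounded: "\<And>x. opnorm (A x) \<le> \<Lambda>"
    and eta: "0 < \<eta>" "\<eta> < pi / 2"
begin

lemma Lambda_ge1: "\<Lambda> \<ge> 1"
  using opnorm_ge_1[OF det1] A_bounded order_trans by blast

text \<open>A countable dense family of admissible controls: finite lists of rationals, clamped to
  \<open>\<plusminus>\<eta>\<close>. Countability makes the infimum \<open>V\<close> measurable and
  lets near-optimal controls be chosen measurably, by least index.\<close>

definition grid :: "nat \<Rightarrow> nat \<Rightarrow> real" where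
  "grid k i = max (- \<eta>) (min \<eta> (if i < length (from_nat k :: rat list) then of_rat (from_nat k ! i) else 0))"

definition V :: "nat \<Rightarrow> 'a \<Rightarrow> real" where
  "V n x = (INF k. ln (opnorm (controlled T A (grid k) n x)))"

lemma grid_le: "\<bar>grid k i\<bar> \<le> \<eta>"
  using eta by (auto simp: grid_def)

lemma grid_dense:
  assumes "\<And>i. \<bar>\<theta> i\<bar> \<le> \<eta>" "e > 0"
  obtains k where "\<And>i. i < n \<Longrightarrow> \<bar>grid k i - \<theta> i\<bar> \<le> e"
proof -
  have "\<exists>r::rat. \<bar>of_rat r - \<theta> i\<bar> < e" for i
  proof -
    obtain r where "\<theta> i - e < of_rat r" "of_rat r < \<theta> i + e"
      using of_rat_dense[of "\<theta> i - e" "\<theta> i + e"] \<open>e > 0\<close> by auto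
    then show ?thesis by (intro exI[of _ r]) (simp add: abs_less_iff)
  qed
  then obtain r :: "nat \<Rightarrow> rat" where r: "\<And>i. \<bar>of_rat (r i) - \<theta> i\<bar> < e" by metis
  define k where "k = to_nat (map r [0..<n])"
  have "\<bar>grid k i - \<theta> i\<bar> \<le> e" if "i < n" for i
    using r[of i] assms(1)[of i] that by (auto simp: grid_def k_def)
  then show thesis using that by blast
qed

lemma ln_controlled_nonneg: "0 \<le> ln (opnorm (controlled T A \<theta> n x))"
  by (intro ln_ge_zero opnorm_ge_1 det_controlled det1)

lemma ln_controlled_le: "ln (opnorm (controlled T A \<theta> n x)) \<le> real n * ln \<Lambda>"
proof -
  have "opnorm (controlled T A \<theta> n x) \<ge> 1" by (intro opnorm_ge_1 det_controlled det1)
  then have "ln (opnorm (controlled T A \<theta> n x)) \<le> ln (\<Lambda> ^ n)"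
    using controlled_opnorm_le[of A \<Lambda> T \<theta> n x, OF A_bounded] by (intro ln_mono) auto
  then show ?thesis using Lambda_ge1 by (simp add: ln_realpow)
qed

lemma V_bdd: "bdd_below (range (\<lambda>k. ln (opnorm (controlled T A (grid k) n x))))"
  by (rule bdd_belowI[of _ 0]) (auto simp: ln_controlled_nonneg)

lemma V_le_grid: "V n x \<le> ln (opnorm (controlled T A (grid k) n x))"
  unfolding V_def by (rule cINF_lower[OF V_bdd]) simp

lemma V_attained: "e > 0 \<Longrightarrow> \<exists>k. ln (opnorm (controlled T A (grid k) n x)) \<le> V n x + e"
proof -
  assume "e > 0"
  then have "(INF k. ln (opnorm (controlled T A (grid k) n x))) < V n x + e" by (simp add: V_def)
  then show ?thesis using cINF_less_iff[OF _ V_bdd] by (meson UNIV_not_empty less_imp_le)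
qed

text \<open>A product of fixed length is Lipschitz in its controls, so restricting the infimum to
  the dense family \<open>grid\<close> loses nothing.\<close>

lemma V_le_controlled:
  assumes \<theta>: "\<And>i. \<bar>\<theta> i\<bar> \<le> \<eta>"
  shows "V n x \<le> ln (opnorm (controlled T A \<theta> n x))"
proof (rule field_le_epsilon)
  fix e :: real assume "e > 0"
  \<comment> \<open>\<open>2 * \<Lambda> * e'\<close> is the error per factor and
    \<open>\<Lambda> ^ n\<close> its amplification; \<open>real n + 1\<close> in place of
    \<open>real n\<close> avoids division by zero.\<close>
  define e' where "e' = e / (\<Lambda> ^ n * (2 * \<Lambda> * (real n + 1)))"
  have den: "\<Lambda> ^ n * (2 * \<Lambda> * (real n + 1)) > 0" using Lambda_ge1 by (intro mult_pos_pos) auto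
  have "e' > 0" using den \<open>e > 0\<close> by (simp add: e'_def)
  then obtain k where k: "\<And>i. i < n \<Longrightarrow> \<bar>grid k i - \<theta> i\<bar> \<le> e'" using grid_dense[of \<theta> e' n, OF \<theta>] by metis
  let ?B = "\<lambda>i. A ((T ^^ i) x) ** rot (grid k i)" and ?D = "\<lambda>i. A ((T ^^ i) x) ** rot (\<theta> i)"
  have diff: "opnorm (?B i - ?D i) \<le> 2 * \<Lambda> * e'" if "i < n" for i
  proof -
    have "opnorm (?B i - ?D i) = opnorm (A ((T ^^ i) x) ** (rot (grid k i) - rot (\<theta> i)))"
      by (simp add: matrix_diff_mult)
    also have "\<dots> \<le> opnorm (A ((T ^^ i) x)) * opnorm (rot (grid k i) - rot (\<theta> i))" by (rule opnorm_mult)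
    also have "\<dots> \<le> \<Lambda> * (2 * \<bar>grid k i - \<theta> i\<bar>)"
      using Lambda_ge1 by (intro mult_mono A_bounded opnorm_rot_diff opnorm_nonneg) auto
    also have "\<dots> \<le> \<Lambda> * (2 * e')" using k[OF that] Lambda_ge1 by (intro mult_left_mono) auto
    finally show ?thesis by simp
  qed
  have "V n x \<le> ln (opnorm (matprod ?B n))" using V_le_grid[of n x k] by (simp add: controlled_matprod)
  also have "\<dots> \<le> ln (opnorm (matprod ?D n)) + \<Lambda> ^ n * (\<Sum>i<n. opnorm (?B i - ?D i))"
    by (rule ln_opnorm_matprod_diff)
      (auto simp: det_mul det1 Lambda_ge1 intro!: order_trans[OF opnorm_mult_rot_le A_bounded])
  also have "\<dots> \<le> ln (opnorm (matprod ?D n)) + \<Lambda> ^ n * (\<Sum>i<n. 2 * \<Lambda> * e')"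
    using Lambda_ge1 diff by (intro add_left_mono mult_left_mono sum_mono) auto
  also have "\<Lambda> ^ n * (\<Sum>i<n. 2 * \<Lambda> * e') \<le> \<Lambda> ^ n * (2 * \<Lambda> * (real n + 1)) * e'"
    using \<open>e' > 0\<close> Lambda_ge1 by (simp add: algebra_simps)
  also have "\<dots> = e" using den unfolding e'_def by (metis less_irrefl nonzero_mult_div_cancel_left times_divide_eq_right)
  finally show "V n x \<le> ln (opnorm (controlled T A \<theta> n x)) + e" by (simp add: controlled_matprod)
qed

lemma controlled_meas [measurable]: "(\<lambda>x. controlled T A \<theta> n x) \<in> borel_measurable M"
  by (induction n) simp_all

lemma cocycle_meas [measurable]: "(\<lambda>x. cocycle T A n x) \<in> borel_measurable M"
  by (induction n) simp_all

lemma V_subadd: "V (m + n) x \<le> V n x + V m ((T ^^ n) x)"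
proof (rule field_le_epsilon)
  fix e :: real assume "e > 0"
  then have "e / 2 > 0" by simp
  obtain k where k: "ln (opnorm (controlled T A (grid k) n x)) \<le> V n x + e / 2"
    using V_attained[OF \<open>e / 2 > 0\<close>] by blast
  obtain l where l: "ln (opnorm (controlled T A (grid l) m ((T ^^ n) x))) \<le> V m ((T ^^ n) x) + e / 2"
    using V_attained[OF \<open>e / 2 > 0\<close>] by blast
  let ?\<theta> = "\<lambda>i. if i < n then grid k i else grid l (i - n)"
  let ?P = "controlled T A (grid k) n x" and ?Q = "controlled T A (grid l) m ((T ^^ n) x)"
  have P: "opnorm ?P \<ge> 1" "opnorm ?Q \<ge> 1" "opnorm (?Q ** ?P) \<ge> 1"
    by (auto intro!: opnorm_ge_1 simp: det_mul det_controlled[of A, OF det1])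
  have "V (m + n) x \<le> ln (opnorm (controlled T A ?\<theta> (m + n) x))"
    by (rule V_le_controlled) (auto simp: grid_le)
  also have "\<dots> = ln (opnorm (?Q ** ?P))" by (simp add: controlled_add)
  also have "\<dots> \<le> ln (opnorm ?Q * opnorm ?P)" using P opnorm_mult[of ?Q ?P] by (intro ln_mono) auto
  also have "\<dots> = ln (opnorm ?Q) + ln (opnorm ?P)" using P by (intro ln_mult_pos) auto
  finally show "V (m + n) x \<le> V n x + V m ((T ^^ n) x) + e" using k l by linarith
qed

lemma V_process: "subadditive_process M T V (ln \<Lambda>)"
proof unfold_locales
  show "V n \<in> borel_measurable M" for n
    unfolding V_def by (intro borel_measurable_cINF_real) auto
  show "0 \<le> V n x" for n x unfolding V_def by (rule cINF_greatest) (auto simp: ln_controlled_nonneg)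
  show "V n x \<le> real n * ln \<Lambda>" for n x using V_le_grid[of n x 0] ln_controlled_le order_trans by blast
qed (rule V_subadd)

sublocale V: subadditive_process M T V "ln \<Lambda>" by (rule V_process)

lemma cocycle_process: "subadditive_process M T (log_growth T A) (ln \<Lambda>)"
proof unfold_locales
  show "log_growth T A (m + n) x \<le> log_growth T A n x + log_growth T A m ((T ^^ n) x)" for m n x
  proof -
    let ?P = "cocycle T A n x" and ?Q = "cocycle T A m ((T ^^ n) x)"
    have P: "opnorm ?P \<ge> 1" "opnorm ?Q \<ge> 1" "opnorm (?Q ** ?P) \<ge> 1"
      by (auto intro!: opnorm_ge_1 simp: det_mul det_cocycle[of A, OF det1])
    have "log_growth T A (m + n) x \<le> ln (opnorm ?Q * opnorm ?P)"
      unfolding cocycle_add using P opnorm_mult[of ?Q ?P] by (intro ln_mono) auto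
    also have "\<dots> = ln (opnorm ?Q) + ln (opnorm ?P)" using P by (intro ln_mult_pos) auto
    finally show ?thesis by simp
  qed
qed (use ln_controlled_nonneg[of "\<lambda>_. 0"] ln_controlled_le[of "\<lambda>_. 0"] in \<open>auto simp: controlled_zero\<close>)

text \<open>\<open>h\<close> enters once instead of twice: this is
  \<open>opnorm_cancellation\<close> for near-optimal controls on both blocks. The term
  \<open>real Q * ln \<Lambda>\<close> pays for the steering segment, \<open>ln 2\<close> for the
  sum of two norms and \<open>1\<close> for near-optimality.\<close>

lemma V_cancellation:
  assumes total: "\<And>v w. v \<noteq> 0 \<Longrightarrow> w \<noteq> 0 \<Longrightarrow> reaches T A \<eta> Q ((T ^^ n) x) v w"
    and h: "V n x \<le> h" "V n ((T ^^ (Q + n)) x) \<le> h"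
  shows "V (n + (Q + n)) x \<le> real Q * ln \<Lambda> + ln 2 + h + 1"
proof -
  obtain k where k: "ln (opnorm (controlled T A (grid k) n x)) \<le> V n x + 1"
    using V_attained[of 1] by auto
  obtain l where l: "ln (opnorm (controlled T A (grid l) n ((T ^^ (Q + n)) x))) \<le> V n ((T ^^ (Q + n)) x) + 1"
    using V_attained[of 1] by auto
  let ?P1 = "controlled T A (grid k) n x" and ?P2 = "controlled T A (grid l) n ((T ^^ (Q + n)) x)"
  have d: "det ?P1 = 1" "det ?P2 = 1" by (intro det_controlled det1)+
  have o1: "opnorm ?P1 \<ge> 1" "opnorm ?P2 \<ge> 1" using d by (auto intro: opnorm_ge_1)
  have P1: "opnorm ?P1 \<le> exp (h + 1)"
  proof -
    have "exp (ln (opnorm ?P1)) \<le> exp (h + 1)" using k h by simp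
    then show ?thesis using o1 by simp
  qed
  have P2: "opnorm ?P2 \<le> exp (h + 1)"
  proof -
    have "exp (ln (opnorm ?P2)) \<le> exp (h + 1)" using l h by simp
    then show ?thesis using o1 by simp
  qed
  obtain s1 where s1: "norm s1 = 1" "norm (?P1 *v s1) * opnorm ?P1 = 1" using contracted_direction[OF d(1)] by blast
  obtain s2 where s2: "norm s2 = 1" "norm (?P2 *v s2) * opnorm ?P2 = 1" using contracted_direction[OF d(2)] by blast
  have "quarter_turn s1 \<noteq> 0" using s1(1) norm_quarter_turn[of s1] by (metis norm_zero zero_neq_one)
  then have "?P1 *v quarter_turn s1 \<noteq> 0"
    using det1_norm_le[OF d(1), of "quarter_turn s1"] by (metis mult_zero_right norm_eq_zero norm_le_zero_iff)
  moreover have "s2 \<noteq> 0" using s2(1) by auto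
  ultimately obtain \<theta> \<rho> where \<theta>: "\<And>i. \<bar>\<theta> i\<bar> \<le> \<eta>"
    "controlled T A \<theta> Q ((T ^^ n) x) *v (?P1 *v quarter_turn s1) = \<rho> *\<^sub>R s2"
    using total unfolding reaches_def by blast
  let ?W = "controlled T A \<theta> Q ((T ^^ n) x)"
  define \<theta>1 where "\<theta>1 = (\<lambda>i. if i < n then grid k i else \<theta> (i - n))"
  define \<theta>2 where "\<theta>2 = (\<lambda>i. if i < Q + n then \<theta>1 i else grid l (i - (Q + n)))"
  have "controlled T A \<theta>2 (n + (Q + n)) x = ?P2 ** controlled T A \<theta>1 (Q + n) x"
    unfolding \<theta>2_def by (rule controlled_add)
  also have "controlled T A \<theta>1 (Q + n) x = ?W ** ?P1"
    unfolding \<theta>1_def by (rule controlled_add)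
  finally have prod: "controlled T A \<theta>2 (n + (Q + n)) x = ?P2 ** (?W ** ?P1)" .
  have "opnorm (?P2 ** (?W ** ?P1)) \<le> \<Lambda> ^ Q * (opnorm ?P1 + opnorm ?P2)"
    by (rule opnorm_cancellation[OF d s1 s2 \<theta>(2) controlled_opnorm_le[OF A_bounded]])
  also have "\<dots> \<le> \<Lambda> ^ Q * (exp (h + 1) + exp (h + 1))"
    using P1 P2 Lambda_ge1 by (intro mult_left_mono add_mono) auto
  finally have up: "opnorm (?P2 ** (?W ** ?P1)) \<le> \<Lambda> ^ Q * (2 * exp (h + 1))" by simp
  have "V (n + (Q + n)) x \<le> ln (opnorm (?P2 ** (?W ** ?P1)))"
    unfolding prod[symmetric] by (rule V_le_controlled) (auto simp: \<theta>2_def \<theta>1_def grid_le \<theta>)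
  also have "\<dots> \<le> ln (\<Lambda> ^ Q * (2 * exp (h + 1)))"
  proof -
    have "opnorm (?P2 ** (?W ** ?P1)) \<ge> 1"
      by (intro opnorm_ge_1) (simp add: det_mul det_controlled[OF det1])
    then show ?thesis using up by (intro ln_mono) auto
  qed
  also have "\<dots> = real Q * ln \<Lambda> + ln 2 + h + 1"
    using Lambda_ge1 by (simp add: ln_mult ln_realpow)
  finally show ?thesis .
qed

lemma V_growth_zero:
  assumes D: "D \<in> sets M" "prob D > 0"
    and total: "\<And>x v w. x \<in> D \<Longrightarrow> norm v = 1 \<Longrightarrow> w \<noteq> 0 \<Longrightarrow> reaches T A \<eta> m x v w"
    and "\<epsilon> > 0"
  shows "\<exists>n\<ge>1. expectation (V n) < \<epsilon> * real n"
proof (rule ccontr)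
  assume "\<not> ?thesis"
  then have low: "\<epsilon> * real n \<le> expectation (V n)" if "n \<ge> 1" for n using that by (auto simp: not_less)
  define C where "C = ln \<Lambda>"
  have C0: "C \<ge> 0" using Lambda_ge1 by (simp add: C_def)
  define R where "R = (\<lambda>n. expectation (V n) / real n) ` {1..}"
  define \<gamma> where "\<gamma> = Inf R"
  have R0: "\<epsilon> \<le> r" if "r \<in> R" for r using that low by (auto simp: R_def field_simps)
  have bdd: "bdd_below R" using R0 by (rule bdd_belowI)
  have ne: "R \<noteq> {}" by (auto simp: R_def)
  have geps: "\<gamma> \<ge> \<epsilon>" unfolding \<gamma>_def using ne R0 by (rule cInf_greatest)
  then have l0: "\<gamma> > 0" using \<open>\<epsilon> > 0\<close> by linarith
  have lowl: "\<gamma> * real n \<le> expectation (V n)" if "n \<ge> 1" for n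
  proof -
    have "\<gamma> \<le> expectation (V n) / real n" unfolding \<gamma>_def by (rule cInf_lower[OF _ bdd]) (use that in \<open>auto simp: R_def\<close>)
    then show ?thesis using that by (simp add: field_simps)
  qed
  \<comment> \<open>Two joined blocks will cost about \<open>c * n\<close>, against a mean of at
    least \<open>2 * \<gamma> * n\<close>. Losing \<open>\<gamma> / 4\<close> here and
    \<open>\<gamma> / 4\<close> on the exceptional set leaves \<open>\<gamma> / 2\<close> per unit
    of time for a contradiction.\<close>
  define c where "c = \<gamma> + \<gamma> / 4"
  have "\<exists>r\<in>R. r < c" using cInf_less_iff[OF ne bdd, of c] l0 by (simp add: c_def \<gamma>_def)
  then obtain p where p: "p \<ge> 1" "expectation (V p) < c * real p" by (auto simp: R_def field_simps)
  \<comment> \<open>Three exceptional events on a product of length about \<open>2 * n\<close> cost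
    \<open>6 * \<kappa> * C * n\<close>, at most \<open>\<gamma> / 4 * n\<close>;
    \<open>C + 1\<close> guards against \<open>C = 0\<close>.\<close>
  define \<kappa> where "\<kappa> = \<gamma> / (24 * (C + 1))"
  have k0: "\<kappa> > 0" using l0 C0 by (simp add: \<kappa>_def)
  have kC: "\<kappa> * C \<le> \<gamma> / 24"
  proof -
    have "\<kappa> * C \<le> \<kappa> * (C + 1)" using k0 by simp
    also have "\<dots> = \<gamma> / 24" using C0 unfolding \<kappa>_def by (simp add: divide_simps)
    finally show ?thesis .
  qed
  obtain K :: nat where K: "prob {x \<in> space M. \<exists>n. V n x > c * real n + real K} < \<kappa>"
    using V.kingman_upper_prob[OF p k0] by blast
  define B1 where "B1 = {x \<in> space M. \<exists>n. V n x > c * real n + real K}"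
  have B1: "B1 \<in> sets M" unfolding B1_def by measurable
  define H where "H q = {x \<in> space M. \<forall>r<q. (T ^^ r) x \<notin> D}" for q
  have H: "H q \<in> sets M" for q unfolding H_def using D(1) by measurable
  have "AE x in M. \<exists>q. x \<notin> H q"
    using AE_hits[OF D]
  proof eventually_elim
    case (elim x)
    then obtain r where "(T ^^ r) x \<in> D" by blast
    then have "x \<notin> H (Suc r)" by (auto simp: H_def)
    then show ?case by blast
  qed
  moreover have "H (Suc q) \<subseteq> H q" for q by (auto simp: H_def)
  ultimately obtain q where q: "prob (H q) < \<kappa>" using prob_tendsto_zero[of H] H k0 by metis
  \<comment> \<open>Waiting \<open>r < q\<close> steps for a visit to \<open>D\<close>, steering for
    \<open>m\<close> steps and idling for \<open>q - r\<close> steps takes \<open>Q\<close> steps in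
    total, whatever \<open>r\<close> is.\<close>
  define Q where "Q = q + m"
  define G where "G = real Q * C + ln 2 + real K + 1"
  have main: "real n * (\<gamma> / 2) \<le> G + 3 * \<kappa> * C * real Q" for n
  proof -
    define N where "N = n + (Q + n)"
    \<comment> \<open>Here only the trivial bound on \<open>V\<close> is used: one of the two blocks
      may grow too fast, or \<open>D\<close> may be reached too late.\<close>
    define B where "B = B1 \<union> (T ^^ n) -` H q \<union> (T ^^ (Q + n)) -` B1"
    have B: "B \<in> sets M" unfolding B_def using B1 H funpow_vimage_sets by blast
    have "prob B \<le> prob B1 + prob ((T ^^ n) -` H q) + prob ((T ^^ (Q + n)) -` B1)"
      unfolding B_def using B1 H funpow_vimage_sets
      by (meson add_mono measure_Un_le order_refl order_trans sets.Un)
    also have "\<dots> \<le> 3 * \<kappa>" using K q by (simp add: prob_funpow_vimage B1 H B1_def[symmetric])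
    finally have pB: "prob B \<le> 3 * \<kappa>" .
    have bnd: "V N x \<le> G + c * real n + real N * C * indicator B x" for x
    proof (cases "x \<in> B")
      case True
      have "V N x \<le> real N * C" using V.V_le by (simp add: C_def)
      moreover have "G \<ge> 0" "c * real n \<ge> 0" using C0 l0 by (auto simp: G_def c_def)
      ultimately show ?thesis using True by simp
    next
      case False
      then obtain r where r: "r < q" "(T ^^ r) ((T ^^ n) x) \<in> D" by (auto simp: B_def H_def space_UNIV)
      have "V N x \<le> real Q * ln \<Lambda> + ln 2 + (c * real n + real K) + 1"
        unfolding N_def
      proof (rule V_cancellation)
        fix v w :: "real^2" assume "v \<noteq> 0" "w \<noteq> 0"
        then have "reaches T A \<eta> ((q - r) + (m + r)) ((T ^^ n) x) v w"
          using total[OF r(2)] eta det1 by (intro reaches_total_extend) auto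
        then show "reaches T A \<eta> Q ((T ^^ n) x) v w" using r by (simp add: Q_def add_ac)
      next
        show "V n x \<le> c * real n + real K" "V n ((T ^^ (Q + n)) x) \<le> c * real n + real K"
          using False by (auto simp: B_def B1_def space_UNIV not_less)
      qed
      then show ?thesis using False by (simp add: G_def C_def)
    qed
    have iB: "integrable M (\<lambda>x. real N * C * indicator B x :: real)"
      using B by (intro integrable_mult_right integrable_real_indicator) (auto simp: emeasure_eq_measure)
    show ?thesis
    proof (cases "N = 0")
      case True
      then have "n = 0" by (simp add: N_def)
      then show ?thesis using C0 k0 by (simp add: G_def)
    next
      case False
      have "\<gamma> * real N \<le> expectation (V N)" using lowl[of N] False by simp
      also have "\<dots> \<le> (\<integral>x. G + c * real n + real N * C * indicator B x \<partial>M)"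
        by (intro integral_mono bnd V.V_integrable Bochner_Integration.integrable_add iB) auto
      also have "\<dots> = G + c * real n + real N * C * prob B"
        using iB B by (simp add: prob_space)
      also have "\<dots> \<le> G + c * real n + real N * C * (3 * \<kappa>)"
        using pB C0 by (intro add_left_mono mult_left_mono) auto
      finally have *: "\<gamma> * real N \<le> G + c * real n + real N * C * (3 * \<kappa>)" .
      have "\<gamma> * real N = 2 * \<gamma> * real n + \<gamma> * real Q" by (simp add: N_def algebra_simps)
      moreover have "real N * C * (3 * \<kappa>) = 6 * (\<kappa> * C) * real n + 3 * \<kappa> * C * real Q" by (simp add: N_def algebra_simps)
      moreover have "6 * (\<kappa> * C) * real n \<le> \<gamma> / 4 * real n" using kC by (intro mult_right_mono) auto
      moreover have "c * real n = \<gamma> * real n + \<gamma> / 4 * real n" by (simp add: c_def algebra_simps)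
      moreover have "\<gamma> * real Q \<ge> 0" using l0 by simp
      ultimately have "\<gamma> * real n \<le> G + \<gamma> / 4 * real n + \<gamma> / 4 * real n + 3 * \<kappa> * C * real Q"
        using * by linarith
      then show ?thesis by (simp add: algebra_simps)
    qed
  qed
  have "\<gamma> / 2 > 0" using l0 by simp
  then obtain n :: nat where "G + 3 * \<kappa> * C * real Q < real n * (\<gamma> / 2)" using reals_Archimedean3 by blast
  with main[of n] show False by linarith
qed

end

section \<open>From optimal blocks to a measurable perturbation\<close>

context ergodic_system
begin

lemma inverse_system: "ergodic_system M (inv T)"
proof unfold_locales
  show "inv T \<in> measurable M M" by (rule inv_T_meas)
  show "bij (inv T)" using bij_T by (rule bij_imp_bij_inv)
  show "inv (inv T) \<in> measurable M M" using inv_inv_eq[OF bij_T] T_meas by simp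
  have "distr M M (inv T) = distr (distr M M T) M (inv T)" unfolding preserving ..
  also have "\<dots> = distr M M (inv T \<circ> T)" by (rule distr_distr) auto
  also have "inv T \<circ> T = (\<lambda>x. x)" by auto
  also have "distr M M (\<lambda>x. x) = M" by (rule distr_id)
  finally show "distr M M (inv T) = M" .
  show "prob S = 0 \<or> prob S = 1" if "S \<in> sets M" "inv T -` S = S" for S
  proof (rule ergodic[OF that(1)])
    show "T -` S = S"
    proof (intro set_eqI)
      fix x
      have "T x \<in> S \<longleftrightarrow> inv T (T x) \<in> S" using that(2) by blast
      then show "x \<in> T -` S \<longleftrightarrow> x \<in> S" by simp
    qed
  qed
qed (rule space_UNIV)

lemma inv_funpow_cancel: "(inv T ^^ n) ((T ^^ n) x) = x" "(T ^^ n) ((inv T ^^ n) x) = x"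
proof -
  show "(inv T ^^ n) ((T ^^ n) x) = x"
    by (induction n arbitrary: x) (simp_all add: funpow_swap1[of "inv T"])
  show "(T ^^ n) ((inv T ^^ n) x) = x"
    by (induction n arbitrary: x) (simp_all add: funpow_swap1[of "T"])
qed

lemma inv_funpow_meas [measurable]: "(\<lambda>x. (inv T ^^ n) x) \<in> measurable M M"
proof -
  interpret I: ergodic_system M "inv T" by (rule inverse_system)
  show ?thesis by (rule I.funpow_meas')
qed

text \<open>Looking into the past gives a function of the point that increases by one per step until
  the next visit resets it. For \<open>Z\<close> of positive measure, points with no past visit form
  a null set by \<open>AE_age\<close>.\<close>

definition age :: "'a set \<Rightarrow> 'a \<Rightarrow> nat" where
  "age Z x = (LEAST k. (inv T ^^ k) x \<in> Z)"

lemma age_step: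
  assumes "\<exists>k. (inv T ^^ k) x \<in> Z"
  shows "age Z (T x) = (if T x \<in> Z then 0 else Suc (age Z x))" "\<exists>k. (inv T ^^ k) (T x) \<in> Z"
proof -
  have shift: "(inv T ^^ Suc m) (T x) = (inv T ^^ m) x" for m by (simp add: funpow_swap1[of "inv T"])
  obtain k where "(inv T ^^ k) x \<in> Z" using assms by blast
  then have k: "(inv T ^^ Suc k) (T x) \<in> Z" unfolding shift .
  then show "\<exists>k. (inv T ^^ k) (T x) \<in> Z" by blast
  show "age Z (T x) = (if T x \<in> Z then 0 else Suc (age Z x))"
  proof (cases "T x \<in> Z")
    case True
    then show ?thesis by (auto simp: age_def intro!: Least_equality)
  next
    case False
    have "(LEAST n. (inv T ^^ n) (T x) \<in> Z) = Suc (LEAST m. (inv T ^^ Suc m) (T x) \<in> Z)"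
      by (rule Least_Suc[where P = "\<lambda>n. (inv T ^^ n) (T x) \<in> Z", OF k]) (use False in simp)
    then show ?thesis using False unfolding age_def shift by simp
  qed
qed

lemma age_iterate:
  assumes "\<exists>k. (inv T ^^ k) x \<in> Z" and "\<And>j. 1 \<le> j \<Longrightarrow> j \<le> i \<Longrightarrow> (T ^^ j) x \<notin> Z"
  shows "age Z ((T ^^ i) x) = age Z x + i" "\<exists>k. (inv T ^^ k) ((T ^^ i) x) \<in> Z"
proof -
  have "age Z ((T ^^ i) x) = age Z x + i \<and> (\<exists>k. (inv T ^^ k) ((T ^^ i) x) \<in> Z)"
    using assms(2)
  proof (induction i)
    case (Suc i)
    then have IH: "age Z ((T ^^ i) x) = age Z x + i" "\<exists>k. (inv T ^^ k) ((T ^^ i) x) \<in> Z" by auto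
    have "T ((T ^^ i) x) \<notin> Z" using Suc.prems[of "Suc i"] by simp
    then show ?case using age_step[OF IH(2)] IH(1) by simp
  qed (use assms in auto)
  then show "age Z ((T ^^ i) x) = age Z x + i" "\<exists>k. (inv T ^^ k) ((T ^^ i) x) \<in> Z" by auto
qed

lemma age_orbit: "\<exists>k. (inv T ^^ k) x \<in> Z \<Longrightarrow> \<exists>k. (inv T ^^ k) ((T ^^ i) x) \<in> Z"
  by (induction i) (use age_step(2) in auto)

lemma AE_age:
  assumes "Z \<in> sets M" "prob Z > 0"
  shows "AE x in M. \<exists>k. (inv T ^^ k) x \<in> Z"
proof -
  interpret I: ergodic_system M "inv T" by (rule inverse_system)
  show ?thesis by (rule I.AE_hits[OF assms])
qed

lemma age_meas [measurable]:
  assumes [measurable]: "Z \<in> sets M"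
  shows "age Z \<in> measurable M (count_space UNIV)"
  unfolding age_def by measurable

end

text \<open>With \<open>k\<close> the age and \<open>j < n\<close>, the number of steps until the
  age is next congruent to \<open>j\<close> modulo \<open>n\<close>, that is, until the next block
  may start.\<close>

definition countdown :: "nat \<Rightarrow> nat \<Rightarrow> nat \<Rightarrow> nat" where
  "countdown n j k = (if k mod n \<le> j then j - k mod n else n + j - k mod n)"

lemma countdown:
  assumes "j < n"
  shows "countdown n j k < n" "countdown n j k = 0 \<longleftrightarrow> k mod n = j"
    "countdown n j k > 0 \<Longrightarrow> countdown n j (Suc k) = countdown n j k - 1"
proof -
  define r where "r = k mod n"
  have r: "r < n" using assms by (simp add: r_def)
  have c: "countdown n j k = (if r \<le> j then j - r else n + j - r)" by (simp add: countdown_def r_def)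
  show "countdown n j k < n" "countdown n j k = 0 \<longleftrightarrow> k mod n = j"
    using assms r unfolding c r_def[symmetric] by auto
  have c': "countdown n j (Suc k) = (if Suc r = n then j else if Suc r \<le> j then j - Suc r else n + j - Suc r)"
    by (simp add: countdown_def mod_Suc r_def)
  show "countdown n j (Suc k) = countdown n j k - 1" if "countdown n j k > 0"
    using that assms r unfolding c c' by (auto split: if_splits)
qed

section \<open>Controls assembled over a skyscraper\<close>

context controlled_system
begin

definition block_index :: "real \<Rightarrow> nat \<Rightarrow> 'a \<Rightarrow> nat" where
  "block_index e n y = (LEAST i. ln (opnorm (controlled T A (grid i) n y)) \<le> V n y + e)"

lemma block_index:
  assumes "e > 0"
  shows "ln (opnorm (controlled T A (grid (block_index e n y)) n y)) \<le> V n y + e"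
  unfolding block_index_def by (rule LeastI_ex[OF V_attained[OF assms]])

lemma block_index_meas [measurable]: "block_index e n \<in> measurable M (count_space UNIV)"
  unfolding block_index_def by measurable

text \<open>Along the orbit time is cut into blocks of length \<open>n\<close>, restarted (with offset \<open>j\<close>) at each visit to
  \<open>Z\<close>; on each block a nearly optimal control for its initial point is used.\<close>
definition tower_control :: "real \<Rightarrow> nat \<Rightarrow> nat \<Rightarrow> 'a set \<Rightarrow> 'a \<Rightarrow> real" where
  "tower_control e n j Z x = (if j \<le> age Z x
     then grid (block_index e n ((inv T ^^ ((age Z x - j) mod n)) x)) ((age Z x - j) mod n) else 0)"

lemma tower_control_le: "\<bar>tower_control e n j Z x\<bar> \<le> \<eta>"
  using grid_le eta by (simp add: tower_control_def)

lemma tower_control_meas [measurable]: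
  assumes [measurable]: "Z \<in> sets M"
  shows "tower_control e n j Z \<in> borel_measurable M"
proof -
  have [measurable]: "(\<lambda>x. grid (block_index e n ((inv T ^^ i) x)) i) \<in> borel_measurable M" for i
    by (rule measurable_compose[where N = "count_space UNIV"]) measurable
  have "(\<lambda>x. (\<lambda>i x. grid (block_index e n ((inv T ^^ i) x)) i) ((age Z x - j) mod n) x) \<in> borel_measurable M"
    by (rule measurable_compose_countable) measurable
  then show ?thesis unfolding tower_control_def by measurable
qed

lemma perturbed_system:
  assumes [measurable]: "\<theta> \<in> borel_measurable M"
  shows "controlled_system M T (\<lambda>x. A x ** rot (\<theta> x)) \<Lambda> \<eta>"
proof unfold_locales
  show "(\<lambda>x. A x ** rot (\<theta> x)) \<in> borel_measurable M" by measurable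
  show "det (A x ** rot (\<theta> x)) = 1" for x by (simp add: det_mul det1)
  show "opnorm (A x ** rot (\<theta> x)) \<le> \<Lambda>" for x by (rule order_trans[OF opnorm_mult_rot_le A_bounded])
qed (rule eta)+

lemma perturbed_cocycle: "cocycle T (\<lambda>x. A x ** rot (\<theta> x)) n x = controlled T A (\<lambda>i. \<theta> ((T ^^ i) x)) n x"
  by (induction n) auto

text \<open>With no visit to \<open>Z\<close> inside the block the age just counts up, so every
  point of the block recovers the same starting point \<open>y\<close> and its own position
  \<open>i\<close>; the controls read off are the near-optimal list chosen at
  \<open>y\<close>.\<close>

lemma tower_block:
  assumes e: "e > 0" and hit: "\<exists>k. (inv T ^^ k) y \<in> Z" and base: "age Z y mod n = j"
    and free: "\<And>i. 1 \<le> i \<Longrightarrow> i < n \<Longrightarrow> (T ^^ i) y \<notin> Z"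
  shows "log_growth T (\<lambda>x. A x ** rot (tower_control e n j Z x)) n y \<le> V n y + e"
proof -
  have "tower_control e n j Z ((T ^^ i) y) = grid (block_index e n y) i" if "i < n" for i
  proof -
    have a: "age Z ((T ^^ i) y) = age Z y + i" by (rule age_iterate[OF hit]) (use free that in auto)
    have jk: "j \<le> age Z y" using base by auto
    have "age Z y + i - j = age Z y div n * n + i"
      using div_mult_mod_eq[of "age Z y" n] base by linarith
    then have "(age Z y + i - j) mod n = i" using that by simp
    then show ?thesis using jk by (simp add: tower_control_def a inv_funpow_cancel)
  qed
  then have "controlled T A (\<lambda>i. tower_control e n j Z ((T ^^ i) y)) m y = controlled T A (grid (block_index e n y)) m y"
    if "m \<le> n" for m
    using that by (induction m) auto
  then show ?thesis using block_index[OF e, of n y] by (simp add: perturbed_cocycle)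
qed

text \<open>A potential argument. The weight \<open>w\<close> charges each block start with the cost
  of its block, and the time just before a return to \<open>Z\<close> with
  \<open>2 * real n * ln \<Lambda>\<close>. The \<open>countdown\<close> term prepays the idle steps
  until the next start, and \<open>n\<close> covers an unfinished last block.\<close>

lemma tower_bound:
  assumes e: "e > 0" and j: "j < n" and Z: "Z \<in> sets M" and hit: "\<exists>k. (inv T ^^ k) y \<in> Z"
  defines "w \<equiv> \<lambda>y. (if age Z y mod n = j then V n y + e else 0) + (if T y \<in> Z then 2 * real n * ln \<Lambda> else 0)"
  shows "log_growth T (\<lambda>x. A x ** rot (tower_control e n j Z x)) N y
     \<le> (\<Sum>i<N. w ((T ^^ i) y)) + ln \<Lambda> * real (n + countdown n j (age Z y))"
  using hit
proof (induction N arbitrary: y rule: less_induct)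
  case (less N)
  note hit = less.prems
  let ?B = "\<lambda>x. A x ** rot (tower_control e n j Z x)"
  interpret B: controlled_system M T ?B \<Lambda> \<eta> by (rule perturbed_system[OF tower_control_meas[OF Z]])
  interpret W: subadditive_process M T "log_growth T ?B" "ln \<Lambda>"
    by (rule B.cocycle_process)
  define C where "C = ln \<Lambda>"
  define W where "W m x = log_growth T ?B m x" for m x
  define d where "d x = countdown n j (age Z x)" for x
  have C0: "C \<ge> 0" using Lambda_ge1 by (simp add: C_def)
  have W_le: "W m x \<le> real m * C" for m x using W.V_le by (simp add: W_def C_def)
  have W_split: "W N x \<le> W k x + W (N - k) ((T ^^ k) x)" if "k \<le> N" for k x
    using W.V_add[of "N - k" k x] that by (simp add: W_def)
  have n1: "n \<ge> 1" using j by simp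
  have dn: "d x < n" for x unfolding d_def by (rule countdown(1)[OF j])
  have w0: "w x \<ge> 0" for x unfolding w_def using V.V_nonneg[of n x] e Lambda_ge1 by auto
  have IH: "W (N - k) ((T ^^ k) y) \<le> (\<Sum>i<N - k. w ((T ^^ i) ((T ^^ k) y))) + C * real (n + d ((T ^^ k) y))"
    if "1 \<le> k" "k \<le> N" for k
    using less.IH[of "N - k" "(T ^^ k) y"] that age_orbit[OF hit, of k] by (simp add: W_def C_def d_def)
  \<comment> \<open>It suffices to move forward by some \<open>k \<ge> 1\<close> steps whose growth,
    corrected by the change of the prepaid waiting time, is covered by the charges.\<close>
  have advance: "W N y \<le> (\<Sum>i<N. w ((T ^^ i) y)) + C * real (n + d y)"
    if k: "1 \<le> k" "k \<le> N" and cost: "W k y + C * real (d ((T ^^ k) y)) \<le> (\<Sum>i<k. w ((T ^^ i) y)) + C * real (d y)" for k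
    using W_split[OF k(2), of y] IH[OF k] orbit_sum_split[OF k(2), of w T y] cost by (simp add: algebra_simps)
  have "W N y \<le> (\<Sum>i<N. w ((T ^^ i) y)) + C * real (n + d y)"
  proof (cases "N \<le> n")
    case True
    have "W N y \<le> real N * C" by (rule W_le)
    also have "\<dots> \<le> C * real (n + d y)" using True C0 by (simp add: mult.commute mult_left_mono)
    finally show ?thesis using sum_nonneg[of "{..<N}" "\<lambda>i. w ((T ^^ i) y)"] w0 by simp
  next
    case False
    \<comment> \<open>For a return within \<open>n\<close> steps, half of the charge
      \<open>2 * real n * C\<close> pays for the growth up to the return and half for the new
      waiting time.\<close>
    have hitZ: "W i y + C * real (d ((T ^^ i) y)) \<le> (\<Sum>i<i. w ((T ^^ i) y))"
      if "1 \<le> i" "i \<le> n" "(T ^^ i) y \<in> Z" for i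
    proof -
      have "W i y \<le> real n * C" using W_le[of i y] that C0 by (smt (verit) mult_right_mono of_nat_le_iff)
      moreover have "C * real (d ((T ^^ i) y)) \<le> C * real n" using dn[of "(T ^^ i) y"] C0 by (intro mult_left_mono) auto
      moreover have "2 * real n * C \<le> w ((T ^^ (i - 1)) y)"
      proof -
        have "T ((T ^^ (i - 1)) y) = (T ^^ i) y" using that by (cases i) auto
        then show ?thesis using V.V_nonneg[of n] e that by (auto simp: w_def C_def)
      qed
      moreover have "w ((T ^^ (i - 1)) y) \<le> (\<Sum>i<i. w ((T ^^ i) y))"
        by (rule member_le_sum[of "i - 1" "{..<i}" "\<lambda>i. w ((T ^^ i) y)"]) (use that w0 in auto)
      ultimately show ?thesis by (simp add: algebra_simps)
    qed
    show ?thesis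
    proof (cases "\<exists>i. 1 \<le> i \<and> i < n \<and> d y = 0 \<and> (T ^^ i) y \<in> Z")
      case True
      \<comment> \<open>A block cut off by a return is abandoned at the return.\<close>
      then obtain i where i: "1 \<le> i" "i < n" "d y = 0" "(T ^^ i) y \<in> Z" by blast
      show ?thesis by (rule advance[of i]) (use i hitZ[of i] False in auto)
    next
      case noZ: False
      show ?thesis
      proof (cases "d y = 0")
        case True
        have base: "age Z y mod n = j" using True countdown(2)[OF j] by (simp add: d_def)
        have blk: "W n y \<le> V n y + e"
          unfolding W_def by (rule tower_block[OF e hit base]) (use noZ True in auto)
        have "W n y + C * real (d ((T ^^ n) y)) \<le> (\<Sum>i<n. w ((T ^^ i) y)) + C * real (d y)"
        proof (cases "(T ^^ n) y \<in> Z")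
          case True
          have wy: "V n y + e \<le> w y" using base Lambda_ge1 by (simp add: w_def)
          show ?thesis using hitZ[of n] True n1 C0 by (simp add: add_increasing2)
        next
          case F: False
          have "age Z ((T ^^ n) y) = age Z y + n"
            by (rule age_iterate[OF hit]) (use noZ True F in \<open>auto simp: le_less\<close>)
          then have "d ((T ^^ n) y) = 0" using base countdown(2)[OF j] by (simp add: d_def)
          moreover have "V n y + e \<le> w y" using base Lambda_ge1 by (simp add: w_def)
          moreover have "w y \<le> (\<Sum>i<n. w ((T ^^ i) y))"
            using member_le_sum[of 0 "{..<n}" "\<lambda>i. w ((T ^^ i) y)"] n1 w0 by auto
          ultimately show ?thesis using blk True by simp
        qed
        then show ?thesis by (intro advance[of n]) (use n1 False in auto)
      next
        case dpos: False
        have "W 1 y + C * real (d ((T ^^ 1) y)) \<le> (\<Sum>i<1. w ((T ^^ i) y)) + C * real (d y)"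
        proof (cases "T y \<in> Z")
          case True
          then show ?thesis using hitZ[of 1] n1 C0 by (simp add: add_increasing2)
        next
          case F: False
          have "age Z (T y) = Suc (age Z y)" using age_step(1)[OF hit] F by simp
          then have "d (T y) = d y - 1" using countdown(3)[OF j] dpos by (simp add: d_def)
          \<comment> \<open>An idle step costs at most \<open>C\<close>, exactly what the countdown
            releases.\<close>
          then have "W 1 y + C * real (d (T y)) \<le> C + C * (real (d y) - 1)"
            using W_le[of 1 y] dpos by (simp add: of_nat_diff)
          then show ?thesis using w0[of y] by (simp add: algebra_simps)
        qed
        then show ?thesis by (intro advance[of 1]) (use n1 False in auto)
      qed
    qed
  qed
  then show ?case by (simp add: W_def C_def d_def)
qed

lemma measurable_perturbation:
  assumes small: "\<And>\<zeta>. \<zeta> > 0 \<Longrightarrow> \<exists>Z\<in>sets M. 0 < prob Z \<and> prob Z < \<zeta>"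
    and growth: "\<And>\<epsilon>. \<epsilon> > 0 \<Longrightarrow> \<exists>n\<ge>1. expectation (V n) < \<epsilon> * real n"
    and "\<epsilon> > 0"
  obtains \<theta> N where "\<theta> \<in> borel_measurable M" "\<And>x. \<bar>\<theta> x\<bar> \<le> \<eta>" "N \<ge> 1"
    "(\<integral>x. log_growth T (\<lambda>x. A x ** rot (\<theta> x)) N x \<partial>M) < \<epsilon> * real N"
proof -
  define C where "C = ln \<Lambda>"
  have C0: "C \<ge> 0" using Lambda_ge1 by (simp add: C_def)
  \<comment> \<open>Of the four quarters, two go to the blocks, one to interruptions by returns and
    one to the boundary term.\<close>
  define e where "e = \<epsilon> / 4"
  have e: "e > 0" using \<open>\<epsilon> > 0\<close> by (simp add: e_def)
  obtain n where n: "n \<ge> 1" "expectation (V n) < e * real n" using growth[OF e] by blast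
  have "e / (2 * real n * (C + 1)) > 0" using e n C0 by (intro divide_pos_pos mult_pos_pos) auto
  then obtain Z where Z: "Z \<in> sets M" "0 < prob Z" "prob Z < e / (2 * real n * (C + 1))" using small by blast
  note Z(1) [measurable]
  have nZ: "2 * real n * C * prob Z < e"
  proof -
    have "2 * real n * C * prob Z \<le> 2 * real n * (C + 1) * prob Z"
      using Z n by (intro mult_right_mono mult_left_mono) auto
    also have "\<dots> < e"
    proof -
      have "2 * real n * (C + 1) > 0" using n C0 by (intro mult_pos_pos) auto
      then show ?thesis using Z(3) by (simp only: pos_less_divide_eq mult.commute)
    qed
    finally show ?thesis .
  qed
  define f where "f j x = (if age Z x mod n = j then V n x + e else 0)" for j x
  have f_meas [measurable]: "f j \<in> borel_measurable M" for j unfolding f_def by measurable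
  have f_int: "integrable M (f j)" for j
  proof (rule integrable_bounded[of _ "real n * C + e"])
    show "0 \<le> f j x" "f j x \<le> real n * C + e" for x
      using V.V_nonneg[of n x] V.V_le[of n x] e C0 by (auto simp: f_def C_def)
  qed measurable
  \<comment> \<open>Every point is a block start for exactly one offset, so the functions
    \<open>f j\<close> add up to \<open>V n + e\<close>, and some offset does no worse than the
    average.\<close>
  have "\<exists>j<n. real n * expectation (f j) \<le> expectation (V n) + e"
  proof (rule ccontr)
    assume "\<not> ?thesis"
    then have "expectation (V n) + e < real n * expectation (f j)" if "j < n" for j
      using that by (auto simp: not_le)
    then have "(\<Sum>j<n. expectation (V n) + e) < (\<Sum>j<n. real n * expectation (f j))"
      using n by (intro sum_strict_mono) (auto simp: lessThan_empty_iff)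
    also have "\<dots> = real n * (\<integral>x. (\<Sum>j<n. f j x) \<partial>M)"
      using f_int by (simp add: sum_distrib_left[symmetric])
    also have "(\<lambda>x. (\<Sum>j<n. f j x)) = (\<lambda>x. V n x + e)"
    proof
      fix x
      have "age Z x mod n \<in> {..<n}" using n by simp
      then show "(\<Sum>j<n. f j x) = V n x + e" unfolding f_def by (simp add: sum.delta)
    qed
    also have "(\<integral>x. V n x + e \<partial>M) = expectation (V n) + e"
      using V.V_integrable by (simp add: prob_space)
    finally show False by (simp add: algebra_simps)
  qed
  then obtain j where j: "j < n" "real n * expectation (f j) \<le> expectation (V n) + e" by blast
  have fj: "expectation (f j) < 2 * e"
  proof -
    have "real n * expectation (f j) < e * real n + e" using j(2) n(2) by linarith
    also have "\<dots> \<le> real n * (2 * e)" using n e by (simp add: algebra_simps)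
    finally show ?thesis using n by simp
  qed
  define w where "w y = f j y + (if T y \<in> Z then 2 * real n * C else 0)" for y
  have w_int: "integrable M (\<lambda>x. w ((T ^^ i) x))" for i
  proof (rule integrable_bounded[of _ "real n * C + e + 2 * real n * C"])
    show "(\<lambda>x. w ((T ^^ i) x)) \<in> borel_measurable M" unfolding w_def by measurable
    show "0 \<le> w ((T ^^ i) x)" "w ((T ^^ i) x) \<le> real n * C + e + 2 * real n * C" for x
      using V.V_nonneg[of n "(T ^^ i) x"] V.V_le[of n "(T ^^ i) x"] e C0 by (auto simp: w_def f_def C_def)
  qed
  have w_meas: "w \<in> borel_measurable M" unfolding w_def by measurable
  have iw: "expectation w < 3 * e"
  proof -
    have "expectation w = (\<integral>x. f j x + 2 * real n * C * indicator (T -` Z) x \<partial>M)"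
      unfolding w_def by (intro Bochner_Integration.integral_cong) (auto simp: indicator_def)
    also have "\<dots> = expectation (f j) + 2 * real n * C * prob (T -` Z)"
      using f_int vimage_sets[OF Z(1)]
      by (subst Bochner_Integration.integral_add) (auto intro!: integrable_real_indicator simp: emeasure_eq_measure)
    finally show ?thesis using fj nZ prob_vimage[OF Z(1)] by simp
  qed
  obtain N :: nat where N: "2 * real n * C < real N * e" using reals_Archimedean3[OF e] by blast
  have "0 \<le> 2 * real n * C" using C0 by simp
  then have N1: "N \<ge> 1" using N by (cases N) auto
  let ?\<theta> = "tower_control e n j Z"
  interpret B: controlled_system M T "\<lambda>x. A x ** rot (?\<theta> x)" \<Lambda> \<eta>
    by (rule perturbed_system[OF tower_control_meas[OF Z(1)]])
  interpret W: subadditive_process M T "log_growth T (\<lambda>x. A x ** rot (?\<theta> x))" "ln \<Lambda>"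
    by (rule B.cocycle_process)
  have "(\<integral>x. log_growth T (\<lambda>x. A x ** rot (?\<theta> x)) N x \<partial>M)
      \<le> (\<integral>x. (\<Sum>i<N. w ((T ^^ i) x)) + 2 * real n * C \<partial>M)"
  proof (rule integral_mono_AE)
    show "AE x in M. log_growth T (\<lambda>x. A x ** rot (?\<theta> x)) N x \<le> (\<Sum>i<N. w ((T ^^ i) x)) + 2 * real n * C"
      using AE_age[OF Z(1,2)]
    proof eventually_elim
      case (elim x)
      have "log_growth T (\<lambda>x. A x ** rot (?\<theta> x)) N x
          \<le> (\<Sum>i<N. w ((T ^^ i) x)) + C * real (n + countdown n j (age Z x))"
        using tower_bound[OF e j(1) Z(1) elim, of N] unfolding w_def f_def C_def .
      also have "C * real (n + countdown n j (age Z x)) \<le> C * (2 * real n)"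
        using countdown(1)[OF j(1), of "age Z x"] C0 by (intro mult_left_mono) auto
      finally show ?case by (simp add: mult_ac)
    qed
  qed (use w_int W.V_integrable in auto)
  also have "\<dots> = real N * expectation w + 2 * real n * C"
    using w_int integral_T[OF w_meas] by (simp add: prob_space)
  also have "\<dots> < real N * (3 * e) + real N * e"
    using iw N N1 by (intro add_less_le_mono mult_strict_left_mono) auto
  also have "\<dots> = \<epsilon> * real N" by (simp add: e_def)
  finally show thesis using that[of ?\<theta> N] tower_control_meas[OF Z(1)] tower_control_le N1 by blast
qed

text \<open>If measurable sets cannot be arbitrarily small, an orbit spends a uniformly bounded time
  outside any set of positive measure, so \<open>log_growth T A n\<close> is nearly constant.\<close>
lemma atomic_growth:
  assumes "\<zeta> > 0" and atomic: "\<And>Z. Z \<in> sets M \<Longrightarrow> prob Z > 0 \<Longrightarrow> prob Z \<ge> \<zeta>"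
    and g: "\<And>n. n \<ge> 1 \<Longrightarrow> g * real n \<le> (\<integral>x. log_growth T A n x \<partial>M)"
  obtains D where "\<And>n. AE x in M. g * real n - D \<le> log_growth T A n x"
proof -
  define C where "C = ln \<Lambda>"
  have C0: "C \<ge> 0" using Lambda_ge1 by (simp add: C_def)
  interpret W: subadditive_process M T "log_growth T A" "ln \<Lambda>" by (rule cocycle_process)
  define W where "W m x = log_growth T A m x" for m x
  have W_le: "W m x \<le> real m * C" for m x using W.V_le by (simp add: W_def C_def)
  have W_meas [measurable]: "W m \<in> borel_measurable M" for m unfolding W_def by measurable
  \<comment> \<open>Moving the starting point by \<open>i\<close> steps removes \<open>i\<close>
    factors at one end and adds \<open>i\<close> at the other, each worth at most \<open>C\<close>
    in the logarithm.\<close>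
  have shift: "W n x \<le> W n ((T ^^ i) x) + 2 * real i * C" for n i x
  proof -
    let ?X = "cocycle T A i ((T ^^ n) x)" and ?Y = "cocycle T A n x"
    have dX: "det ?X = 1" by (intro det_cocycle det1)
    have "?Y = matrix_inv ?X ** (?X ** ?Y)" using det1_inverse[OF dX] by (simp add: matrix_mul_assoc)
    then have "opnorm ?Y \<le> opnorm (matrix_inv ?X) * opnorm (?X ** ?Y)" by (metis opnorm_mult)
    also have "\<dots> = opnorm ?X * opnorm (cocycle T A (i + n) x)"
      by (simp add: opnorm_matrix_inv[OF dX] cocycle_add)
    finally have "W n x \<le> ln (opnorm ?X * opnorm (cocycle T A (i + n) x))"
      unfolding W_def using opnorm_ge_1[OF det_cocycle[of A T n x, OF det1]] by (intro ln_mono) auto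
    also have "\<dots> = W i ((T ^^ n) x) + W (n + i) x"
      unfolding W_def using opnorm_ge_1[OF dX] opnorm_ge_1[OF det_cocycle[of A T "i + n" x, OF det1]]
      by (subst ln_mult_pos) (auto simp: add.commute)
    also have "\<dots> \<le> real i * C + (real i * C + W n ((T ^^ i) x))"
      using W_le[of i] W.V_add[of n i x] by (intro add_mono) (auto simp: W_def intro: order_trans add_mono)
    finally show ?thesis by (simp add: algebra_simps)
  qed
  obtain q :: nat where q: "1 < real q * \<zeta>" using reals_Archimedean3[OF \<open>\<zeta> > 0\<close>] by blast
  \<comment> \<open>Up to \<open>q\<close> steps lead to a slow point, at a cost of
    \<open>2 * real q * C\<close>; the extra \<open>1\<close> makes the mean strictly smaller than
    \<open>g\<close> permits.\<close>
  define D where "D = 2 * real q * C + 1"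
  have "AE x in M. g * real n - D \<le> W n x" if n: "n \<ge> 1" for n
  proof -
    define S where "S = {x \<in> space M. W n x < g * real n - D}"
    have S [measurable]: "S \<in> sets M" unfolding S_def by measurable
    have "prob S = 0"
    proof (rule ccontr)
      assume "prob S \<noteq> 0"
      then have pS: "prob S > 0" by (simp add: zero_less_measure_iff)
      define U where "U k = (\<Union>i\<le>k. (T ^^ i) -` S)" for k
      have U: "U k \<in> sets M" for k unfolding U_def using funpow_vimage_sets[OF S] by auto
      \<comment> \<open>An enlargement of the union that is not null gains at least
        \<open>\<zeta>\<close>. A null one means that the union already has full measure: orbits
        reaching \<open>S\<close> can be pulled back inside it step by step.\<close>
      have grow: "prob (U k) = 1 \<or> real (Suc k) * \<zeta> \<le> prob (U k)" for k
      proof (induction k)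
        case 0
        have "U 0 = S" by (auto simp: U_def)
        then show ?case using atomic[OF S pS] by simp
      next
        case (Suc k)
        have sub: "U k \<subseteq> U (Suc k)" unfolding U_def by fastforce
        have diff: "prob (U (Suc k) - U k) = prob (U (Suc k)) - prob (U k)"
          using finite_measure_Diff[OF U U sub] .
        show ?case
        proof (cases "prob (U (Suc k) - U k) = 0")
          case False
          then have "prob (U (Suc k) - U k) \<ge> \<zeta>"
            using atomic[of "U (Suc k) - U k"] U by (auto simp: zero_less_measure_iff)
          then show ?thesis using Suc diff prob_le_1[of "U (Suc k)"] \<open>\<zeta> > 0\<close> by (auto simp: algebra_simps)
        next
          case True
          then have "AE x in M. x \<notin> U (Suc k) - U k" using U by (intro AE_not_in_prob_0) auto
          then have "AE x in M. \<forall>m. (T ^^ m) x \<notin> U (Suc k) - U k" by (rule AE_orbit)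
          with AE_hits[OF S pS] have "AE x in M. x \<in> U k"
          proof eventually_elim
            case (elim x)
            then obtain m where m: "(T ^^ m) x \<in> S" by blast
            have pull: "y \<in> U (Suc k)" if Ty: "T y \<in> U k" for y
            proof -
              obtain i where "i \<le> k" "(T ^^ i) (T y) \<in> S" using Ty by (auto simp: U_def)
              then have "Suc i \<le> Suc k" "(T ^^ Suc i) y \<in> S" by (simp_all add: funpow_swap1)
              then show ?thesis unfolding U_def by blast
            qed
            have "(T ^^ (m - l)) x \<in> U k" if "l \<le> m" for l
              using that
            proof (induction l)
              case 0
              have "(T ^^ m) x \<in> (T ^^ 0) -` S" using m by simp
              then show ?case unfolding U_def by (intro UN_I[of 0]) auto
            next
              case (Suc l)
              have "T ((T ^^ (m - Suc l)) x) = (T ^^ (m - l)) x"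
                using Suc.prems by (metis Suc_diff_Suc Suc_le_eq funpow.simps(2) o_apply)
              then have "(T ^^ (m - Suc l)) x \<in> U (Suc k)" using Suc by (intro pull) auto
              then show ?case using elim by blast
            qed
            from this[of m] show ?case by simp
          qed
          then have "prob (U k) = 1" using U by (simp add: prob_eq_1)
          then show ?thesis using finite_measure_mono[OF sub U] prob_le_1[of "U (Suc k)"] by simp
        qed
      qed
      have "prob (U q) = 1"
      proof -
        have "real (Suc q) * \<zeta> > 1" using q \<open>\<zeta> > 0\<close> by (simp add: algebra_simps)
        then show ?thesis using grow[of q] prob_le_1[of "U q"] by linarith
      qed
      then have "AE x in M. x \<in> U q" using U by (simp add: prob_eq_1)
      then have "AE x in M. W n x \<le> g * real n - 1"
      proof eventually_elim
        case (elim x)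
        then obtain i where i: "i \<le> q" "(T ^^ i) x \<in> S" by (auto simp: U_def)
        have "W n x \<le> W n ((T ^^ i) x) + 2 * real i * C" by (rule shift)
        also have "\<dots> \<le> (g * real n - D) + 2 * real q * C"
          using i C0 by (intro add_mono mult_right_mono) (auto simp: S_def)
        finally show ?case by (simp add: D_def)
      qed
      then have "(\<integral>x. W n x \<partial>M) \<le> (\<integral>x. g * real n - 1 \<partial>M)"
        using W.V_integrable by (intro integral_mono_AE) (auto simp: W_def)
      then show False using g[OF n] by (simp add: prob_space W_def)
    qed
    then have "AE x in M. x \<notin> S" by (rule AE_not_in_prob_0[OF S])
    then show ?thesis by eventually_elim (auto simp: S_def space_UNIV)
  qed
  \<comment> \<open>The hypothesis on the mean starts at \<open>n = 1\<close>; time \<open>0\<close>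
    is settled by \<open>D \<ge> 0\<close>.\<close>
  moreover have "D \<ge> 0" using C0 by (simp add: D_def add_nonneg_nonneg)
  then have "g * real 0 - D \<le> W 0 x" for x by (simp add: W_def opnorm_mat_1)
  ultimately have "AE x in M. g * real n - D \<le> W n x" for n by (cases "n = 0") auto
  then show thesis using that unfolding W_def by blast
qed

end

section \<open>Uniform growth and hyperbolicity\<close>

text \<open>An open set is a countable union of compact sets, and whether the set of solutions meets
  a compact set can be tested on approximate solutions in a countable dense subset.\<close>

lemma measurable_setfield_growth:
  fixes P :: "nat \<Rightarrow> 'a \<Rightarrow> real^2^2"
  assumes [measurable]: "\<And>n. P n \<in> borel_measurable M"
  shows "measurable_setfield M (\<lambda>x. {v. \<forall>n. norm (P n x *v v) \<le> b n * norm v})"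
  unfolding measurable_setfield_def
proof (intro allI impI)
  fix U :: "(real^2) set" assume "open U"
  define E where "E x = {v. \<forall>n. norm (P n x *v v) \<le> b n * norm v}" for x
  have Pv [measurable]: "(\<lambda>x. norm (P n x *v v)) \<in> borel_measurable M" for n v
  proof -
    have "continuous_on UNIV (\<lambda>N :: real^2^2. norm (N *v v))"
      unfolding matrix_vector_mult_def
      by (intro continuous_on_norm continuous_on_vec_lambda continuous_on_sum continuous_on_mult
          continuous_on_component continuous_on_const continuous_on_id)
    then show ?thesis by (intro measurable_compose[OF assms] borel_measurable_continuous_onI)
  qed
  obtain K :: "nat \<Rightarrow> (real^2) set" where K: "\<And>n. compact (K n)" "\<Union>(range K) = U"
    using open_Union_compact_subsets[OF \<open>open U\<close>] by metis
  have "{x \<in> space M. E x \<inter> K j \<noteq> {}} \<in> sets M" for j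
  proof -
    obtain D where D: "countable D" "D \<subseteq> K j" "K j \<subseteq> closure D" using separable by metis
    define g where "g i x v = norm (P i x *v v) - b i * norm v" for i x v
    have gc: "continuous_on UNIV (g i x)" for i x unfolding g_def by (intro continuous_intros)
    \<comment> \<open>Density gives one direction; for the other, a convergent subsequence of
      approximate solutions has a true solution as its limit.\<close>
    have iff: "E x \<inter> K j \<noteq> {} \<longleftrightarrow> (\<forall>p::nat. \<exists>v\<in>D. \<forall>i\<in>{..p}. g i x v < 1 / real (Suc p))" for x
    proof
      assume "E x \<inter> K j \<noteq> {}"
      then obtain v where v: "v \<in> K j" "\<And>i. g i x v \<le> 0" by (auto simp: E_def g_def)
      show "\<forall>p::nat. \<exists>v\<in>D. \<forall>i\<in>{..p}. g i x v < 1 / real (Suc p)"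
      proof
        fix p :: nat
        define Op where "Op = (\<Inter>i\<in>{..p}. {u. g i x u < 1 / real (Suc p)})"
        have "open Op" unfolding Op_def
          by (intro open_INT ballI open_Collect_less gc continuous_on_const) auto
        have "g i x v < 1 / real (Suc p)" for i using v(2)[of i] by (rule le_less_trans) simp
        then have "v \<in> Op" by (simp add: Op_def)
        moreover have "v \<in> closure D" using v D by blast
        ultimately have "Op \<inter> closure D \<noteq> {}" by blast
        then have "Op \<inter> D \<noteq> {}" unfolding open_Int_closure_eq_empty[OF \<open>open Op\<close>] .
        then obtain u where "u \<in> D" "u \<in> Op" by blast
        then have "u \<in> D" "\<forall>i\<in>{..p}. g i x u < 1 / real (Suc p)" by (auto simp: Op_def)
        then show "\<exists>v\<in>D. \<forall>i\<in>{..p}. g i x v < 1 / real (Suc p)" by blast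
      qed
    next
      assume "\<forall>p::nat. \<exists>v\<in>D. \<forall>i\<in>{..p}. g i x v < 1 / real (Suc p)"
      then obtain u where u: "\<And>p. u p \<in> D" "\<And>p i. i \<le> p \<Longrightarrow> g i x (u p) < 1 / real (Suc p)"
        by (metis atMost_iff)
      then have "\<forall>p. u p \<in> K j" using D by blast
      then obtain l r where l: "l \<in> K j" "strict_mono (r :: nat \<Rightarrow> nat)" "(u \<circ> r) \<longlonglongrightarrow> l"
        using K(1)[of j] unfolding compact_def by metis
      have "g i x l \<le> 0" for i
      proof (rule LIMSEQ_le)
        show "(\<lambda>p. g i x ((u \<circ> r) p)) \<longlonglongrightarrow> g i x l"
          by (rule continuous_on_tendsto_compose[OF gc l(3)]) auto
        show "(\<lambda>p. 1 / real (Suc p)) \<longlonglongrightarrow> 0" by (rule LIMSEQ_Suc[OF lim_1_over_n])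
        show "\<exists>N. \<forall>p\<ge>N. g i x ((u \<circ> r) p) \<le> 1 / real (Suc p)"
        proof (intro exI allI impI)
          fix p assume "i \<le> p"
          have rp: "p \<le> r p" by (rule seq_suble[OF l(2)])
          then have "g i x (u (r p)) < 1 / real (Suc (r p))" using u(2)[of i "r p"] \<open>i \<le> p\<close> by simp
          also have "\<dots> \<le> 1 / real (Suc p)" using rp by (simp add: field_simps)
          finally show "g i x ((u \<circ> r) p) \<le> 1 / real (Suc p)" by simp
        qed
      qed
      then have "l \<in> E x" by (simp add: E_def g_def)
      then show "E x \<inter> K j \<noteq> {}" using l by blast
    qed
    have [measurable]: "(\<lambda>x. g i x v) \<in> borel_measurable M" for i v unfolding g_def by measurable
    have "{x \<in> space M. \<exists>v\<in>D. \<forall>i\<in>{..p}. g i x v < 1 / real (Suc p)} \<in> sets M" for p :: nat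
      using D(1) by (intro sets.sets_Collect_countable_Ex') measurable
    then have "{x \<in> space M. \<forall>p::nat. \<exists>v\<in>D. \<forall>i\<in>{..p}. g i x v < 1 / real (Suc p)} \<in> sets M"
      by (rule sets.sets_Collect_countable_All)
    then show ?thesis unfolding iff .
  qed
  then have "(\<Union>j. {x \<in> space M. E x \<inter> K j \<noteq> {}}) \<in> sets M" by blast
  also have "(\<Union>j. {x \<in> space M. E x \<inter> K j \<noteq> {}}) = {x \<in> space M. E x \<inter> U \<noteq> {}}" using K(2) by blast
  finally show "{x \<in> space M. {v. \<forall>n. norm (P n x *v v) \<le> b n * norm v} \<inter> U \<noteq> {}} \<in> sets M"
    by (simp add: E_def)
qed

lemma crs_eq_0_parallel:
  assumes "crs u s = 0" "u \<noteq> 0"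
  obtains k where "s = k *\<^sub>R u"
proof -
  have "norm ((1 / norm u) *\<^sub>R u) = 1" using assms by simp
  from orthonormal_decomp[OF this, of s]
  have "s = inner s ((1 / norm u) *\<^sub>R u) *\<^sub>R ((1 / norm u) *\<^sub>R u)"
    using assms by (simp add: crs_def algebra_simps)
  then show thesis using that by (metis scaleR_scaleR)
qed

lemma crs_basis:
  assumes "crs u s \<noteq> 0"
  shows "v = (crs v s / crs u s) *\<^sub>R u + (crs u v / crs u s) *\<^sub>R s"
proof -
  have "crs u s *\<^sub>R v = crs v s *\<^sub>R u + crs u v *\<^sub>R s"
    by (simp add: vec2_eq_iff crs_def algebra_simps)
  then have "(1 / crs u s) *\<^sub>R (crs u s *\<^sub>R v) = (1 / crs u s) *\<^sub>R (crs v s *\<^sub>R u + crs u v *\<^sub>R s)" by simp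
  then show ?thesis using assms by (simp add: scaleR_add_right)
qed

text \<open>Two vectors bounded along different sequences of times need not have such a sum, so
  linearity is not visible from \<open>recurrent_bounded\<close>; decay makes them bounded at all
  times. The equality joins an explicit, measurable description with a visibly invariant
  one.\<close>

lemma recurrent_bounded_iff_decay:
  assumes decay: "\<And>v n. recurrent_bounded T A x v \<Longrightarrow> norm (cocycle T A n x *v v) \<le> C * \<tau> ^ n * norm v"
    and C: "C > 0" "0 < \<tau>" "\<tau> < 1"
  shows "{v. \<forall>n. norm (cocycle T A n x *v v) \<le> C * \<tau> ^ n * norm v} = {v. recurrent_bounded T A x v}"
    and "subspace {v. recurrent_bounded T A x v}"
proof -
  have bound: "norm (cocycle T A n x *v v) \<le> C * norm v" if "recurrent_bounded T A x v" for v n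
  proof -
    have "norm (cocycle T A n x *v v) \<le> C * \<tau> ^ n * norm v" by (rule decay[OF that])
    also have "\<dots> \<le> C * 1 * norm v" using C by (intro mult_right_mono mult_left_mono power_le_one) auto
    finally show ?thesis by simp
  qed
  have rb: "recurrent_bounded T A x v" if "\<And>n. norm (cocycle T A n x *v v) \<le> B" for v B
    unfolding recurrent_bounded_def using that by blast
  show "{v. \<forall>n. norm (cocycle T A n x *v v) \<le> C * \<tau> ^ n * norm v} = {v. recurrent_bounded T A x v}"
  proof (intro Collect_cong iffI allI)
    fix v assume *: "\<forall>n. norm (cocycle T A n x *v v) \<le> C * \<tau> ^ n * norm v"
    show "recurrent_bounded T A x v"
    proof (rule rb)
      fix n
      have "C * \<tau> ^ n * norm v \<le> C * 1 * norm v" using C by (intro mult_right_mono mult_left_mono power_le_one) auto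
      then show "norm (cocycle T A n x *v v) \<le> C * norm v" using *[rule_format, of n] by simp
    qed
  qed (rule decay)
  show "subspace {v. recurrent_bounded T A x v}"
    unfolding subspace_def mem_Collect_eq
  proof (intro conjI allI impI ballI)
    show "recurrent_bounded T A x 0" by (rule rb[of _ 0]) simp
    show "recurrent_bounded T A x (v + w)" if "v \<in> {v. recurrent_bounded T A x v}" "w \<in> {v. recurrent_bounded T A x v}" for v w
      by (rule rb[of _ "C * norm v + C * norm w"])
        (use that bound norm_triangle_le add_mono in \<open>auto simp: matrix_vector_right_distrib intro!: norm_triangle_le add_mono\<close>)
    show "recurrent_bounded T A x (c *\<^sub>R v)" if "v \<in> {v. recurrent_bounded T A x v}" for c v
      by (rule rb[of _ "\<bar>c\<bar> * (C * norm v)"])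
        (use that bound in \<open>auto simp: matrix_vector_mult_scaleR intro!: mult_left_mono\<close>)
  qed
qed

lemma matrix_inv_unique:
  fixes X Y :: "real^2^2"
  assumes "det X = 1" "X ** Y = mat 1"
  shows "Y = matrix_inv X"
proof -
  have "matrix_inv X ** (X ** Y) = Y"
    unfolding matrix_mul_assoc det1_inverse(1)[OF assms(1)] by simp
  then show ?thesis using assms(2) by simp
qed

section \<open>The backward cocycle and the invariant splitting\<close>

context controlled_system
begin

text \<open>Generator over \<open>inv T\<close> whose products are the negative iterates, so that
  the results on forward growth apply to the past.\<close>

definition A_back :: "'a \<Rightarrow> real^2^2" where "A_back y = matrix_inv (A (inv T y))"

lemma cocycle_neg_eq: "cocycle_neg T A n x = cocycle (inv T) A_back n x"
  by (induction n) (auto simp: A_back_def)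

lemma cocycle_back: "cocycle T A n ((inv T ^^ n) y) ** cocycle (inv T) A_back n y = mat 1"
proof (induction n)
  case (Suc n)
  have "cocycle T A (n + 1) ((inv T ^^ Suc n) y)
      = cocycle T A n ((T ^^ 1) ((inv T ^^ Suc n) y)) ** cocycle T A 1 ((inv T ^^ Suc n) y)"
    by (rule cocycle_add)
  then have 1: "cocycle T A (Suc n) ((inv T ^^ Suc n) y)
      = cocycle T A n ((inv T ^^ n) y) ** A ((inv T ^^ Suc n) y)" by simp
  have "A ((inv T ^^ Suc n) y) ** cocycle (inv T) A_back (Suc n) y = cocycle (inv T) A_back n y"
    using det1_inverse[OF det1] by (simp add: A_back_def matrix_mul_assoc)
  then show ?case unfolding 1 using Suc by (simp only: flip: matrix_mul_assoc)
qed simp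

text \<open>A determinant-one matrix and its inverse have the same norm, so growth at all points of
  an orbit passes to the backward cocycle with unchanged \<open>c\<close> and
  \<open>\<kappa>\<close>.\<close>

lemma opnorm_cocycle_back: "opnorm (cocycle (inv T) A_back n y) = opnorm (cocycle T A n ((inv T ^^ n) y))"
proof -
  let ?X = "cocycle T A n ((inv T ^^ n) y)"
  have d: "det ?X = 1" by (intro det_cocycle det1)
  have "cocycle (inv T) A_back n y = matrix_inv ?X" by (rule matrix_inv_unique[OF d cocycle_back])
  then show ?thesis using opnorm_matrix_inv[OF d] by simp
qed

lemma matrix_inv_meas: "(\<lambda>x. matrix_inv (A x)) \<in> borel_measurable M"
proof -
  \<comment> \<open>The adjugate is the inverse when the determinant is one, and it is continuous in
    the matrix.\<close>
  define adj :: "real^2^2 \<Rightarrow> real^2^2" where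
    "adj N = (\<chi> i j. if i = 1 then (if j = 1 then N$2$2 else - N$1$2) else (if j = 1 then - N$2$1 else N$1$1))" for N
  have "matrix_inv N = adj N" if "det N = 1" for N
  proof -
    have "N ** adj N = mat 1"
      using that by (simp add: vec2_eq_iff adj_def matrix_matrix_mult_def sum_2 mat_def det_2 algebra_simps)
    then show ?thesis using matrix_inv_unique[OF that] by simp
  qed
  then have "(\<lambda>x. matrix_inv (A x)) = (\<lambda>x. adj (A x))" using det1 by auto
  moreover have "continuous_on UNIV adj"
  proof -
    have "continuous_on UNIV (\<lambda>N :: real^2^2. if i = 1 then (if j = 1 then N$2$2 else - N$1$2) else (if j = 1 then - N$2$1 else N$1$1))"
      for i j :: 2
      by (cases "i = 1"; cases "j = 1") (auto intro!: continuous_intros)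
    then show ?thesis unfolding adj_def by (intro continuous_on_vec_lambda)
  qed
  ultimately show ?thesis by (simp add: measurable_compose[OF A_meas borel_measurable_continuous_onI])
qed

lemma uniform_growth_imp_hyperbolic:
  assumes c: "c > 0" "\<kappa> > 1" and growth: "\<And>n. AE x in M. c * \<kappa> ^ n \<le> opnorm (cocycle T A n x)"
  shows "unif_hyperbolic M T A"
proof -
  obtain C \<tau> :: real where Ct: "C > 0" "0 < \<tau>" "\<tau> < 1"
    and decay: "\<And>(S :: 'a \<Rightarrow> 'a) B x v n. (\<And>i. growing_orbit S B ((S ^^ i) x) c \<kappa> \<Lambda>) \<Longrightarrow>
       recurrent_bounded S B x v \<Longrightarrow> norm (cocycle S B n x *v v) \<le> C * \<tau> ^ n * norm v"
    using uniform_decay[OF c Lambda_ge1] by blast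
  interpret I: ergodic_system M "inv T" by (rule inverse_system)
  define G where "G y \<longleftrightarrow> (\<forall>n. c * \<kappa> ^ n \<le> opnorm (cocycle T A n y))" for y
  \<comment> \<open>Growth along the whole two-sided orbit: going \<open>m\<close> back and
    \<open>i\<close> forward expresses it without integer exponents, in a form preserved by
    \<open>T\<close>.\<close>
  define good where "good x \<longleftrightarrow> (\<forall>m i. G ((T ^^ i) ((inv T ^^ m) x)))" for x
  have "AE x in M. G x" unfolding G_def using growth by (simp add: AE_all_countable)
  from I.AE_orbit[OF AE_orbit[OF this]] have AE_good: "AE x in M. good x" unfolding good_def .
  have good_T: "good (T x)" if "good x" for x
    unfolding good_def
  proof (intro allI)
    fix m i
    show "G ((T ^^ i) ((inv T ^^ m) (T x)))"
    proof (cases m)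
      case 0
      then show ?thesis using that[unfolded good_def, rule_format, of "Suc i" 0] by (simp add: funpow_swap1)
    next
      case (Suc m')
      then have "(inv T ^^ m) (T x) = (inv T ^^ m') x" by (simp add: funpow_swap1[of "inv T"])
      then show ?thesis using that by (simp add: good_def)
    qed
  qed
  have back_bounded: "opnorm (A_back y) \<le> \<Lambda>" for y
    unfolding A_back_def opnorm_matrix_inv[OF det1] by (rule A_bounded)
  have fwd: "growing_orbit T A ((T ^^ i) ((inv T ^^ m) x)) c \<kappa> \<Lambda>" if "good x" for x i m
    by unfold_locales (use that c det1 A_bounded in \<open>auto simp: good_def G_def\<close>)
  have bwd: "growing_orbit (inv T) A_back ((inv T ^^ i) x) c \<kappa> \<Lambda>" if "good x" for x i
  proof unfold_locales
    fix n
    have "(inv T ^^ n) ((inv T ^^ i) x) = (T ^^ 0) ((inv T ^^ (n + i)) x)" by (simp add: funpow_add)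
    then have "G ((inv T ^^ n) ((inv T ^^ i) x))" using that unfolding good_def by metis
    then show "c * \<kappa> ^ n \<le> opnorm (cocycle (inv T) A_back n ((inv T ^^ i) x))"
      by (simp add: opnorm_cocycle_back G_def)
  qed (use c back_bounded det1_inverse[OF det1] in \<open>auto simp: A_back_def\<close>)
  define Es where "Es x = {v. \<forall>n. norm (cocycle T A n x *v v) \<le> C * \<tau> ^ n * norm v}" for x
  define Eu where "Eu x = {v. \<forall>n. norm (cocycle_neg T A n x *v v) \<le> C * \<tau> ^ n * norm v}" for x
  have Es_eq: "Es x = {v. recurrent_bounded T A x v}" "subspace (Es x)" if "good x" for x
  proof -
    have d: "norm (cocycle T A n x *v v) \<le> C * \<tau> ^ n * norm v" if "recurrent_bounded T A x v" for v n
      by (rule decay[OF _ that]) (use fwd[OF \<open>good x\<close>, of _ 0] in simp)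
    show "Es x = {v. recurrent_bounded T A x v}" unfolding Es_def
      by (rule recurrent_bounded_iff_decay(1)[OF d Ct])
    then show "subspace (Es x)" using recurrent_bounded_iff_decay(2)[OF d Ct] by simp
  qed
  have Eu_eq: "Eu x = {v. recurrent_bounded (inv T) A_back x v}" "subspace (Eu x)" if "good x" for x
  proof -
    have d: "norm (cocycle (inv T) A_back n x *v v) \<le> C * \<tau> ^ n * norm v"
      if "recurrent_bounded (inv T) A_back x v" for v n
      by (rule decay[OF bwd[OF \<open>good x\<close>] that])
    show "Eu x = {v. recurrent_bounded (inv T) A_back x v}" unfolding Eu_def cocycle_neg_eq
      by (rule recurrent_bounded_iff_decay(1)[OF d Ct])
    then show "subspace (Eu x)" using recurrent_bounded_iff_decay(2)[OF d Ct] by simp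
  qed
  have inv_mult: "A x *v (matrix_inv (A x) *v u) = u" "matrix_inv (A x) *v (A x *v u) = u" for x u
    using det1_inverse[OF det1] by (simp_all add: matrix_vector_mul_assoc)
  have Es_inv: "(\<lambda>v. A x *v v) ` Es x = Es (T x)" if "good x" for x
  proof -
    have *: "A x *v v \<in> Es (T x) \<longleftrightarrow> v \<in> Es x" for v
      using Es_eq(1)[OF that] Es_eq(1)[OF good_T[OF that]] recurrent_bounded_step[of T A x v] by simp
    show ?thesis
    proof (intro set_eqI iffI)
      fix u assume "u \<in> Es (T x)"
      then have "matrix_inv (A x) *v u \<in> Es x" using *[of "matrix_inv (A x) *v u"] by (simp add: inv_mult)
      then show "u \<in> (\<lambda>v. A x *v v) ` Es x" using inv_mult(1)[of x u] by (metis imageI)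
    qed (use * in auto)
  qed
  have Eu_inv: "(\<lambda>v. A x *v v) ` Eu x = Eu (T x)" if "good x" for x
  proof -
    have *: "matrix_inv (A x) *v u \<in> Eu x \<longleftrightarrow> u \<in> Eu (T x)" for u
      using Eu_eq(1)[OF that] Eu_eq(1)[OF good_T[OF that]]
        recurrent_bounded_step[of "inv T" A_back "T x" u] by (simp add: A_back_def)
    show ?thesis
    proof (intro set_eqI iffI)
      fix u assume "u \<in> Eu (T x)"
      then have "matrix_inv (A x) *v u \<in> Eu x" using * by simp
      then show "u \<in> (\<lambda>v. A x *v v) ` Eu x" using inv_mult(1)[of x u] by (metis imageI)
    next
      fix u assume "u \<in> (\<lambda>v. A x *v v) ` Eu x"
      then obtain v where "v \<in> Eu x" "u = A x *v v" by blast
      then show "u \<in> Eu (T x)" using *[of u] inv_mult(2)[of x v] by simp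
    qed
  qed
  have inter: "Eu x \<inter> Es x = {0}" if "good x" for x
  proof -
    have "v = 0" if v: "v \<in> Eu x" "v \<in> Es x" for v
    proof (rule ccontr)
      assume "v \<noteq> 0"
      have "0 < \<tau>\<^sup>2" "\<tau>\<^sup>2 < 1" using Ct by (auto simp: power_less_one_iff)
      then obtain n where n: "(\<tau>\<^sup>2) ^ n < 1 / C\<^sup>2"
        using real_arch_pow_inv[of "1 / C\<^sup>2" "\<tau>\<^sup>2"] Ct by auto
      \<comment> \<open>Going back \<open>n\<close> steps contracts \<open>v\<close> because it lies
        in \<open>Eu x\<close>, and going forward again contracts because it lies in
        \<open>Es x\<close>; the round trip ends at \<open>v\<close>.\<close>
      define w where "w = cocycle_neg T A n x *v v"
      let ?z = "(inv T ^^ n) x"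
      have wv: "cocycle T A n ?z *v w = v"
        using cocycle_back[of n x] by (simp add: w_def cocycle_neg_eq matrix_vector_mul_assoc)
      have "recurrent_bounded T A x v" using v(2) Es_eq(1)[OF \<open>good x\<close>] by simp
      then have "recurrent_bounded T A ?z w"
        using recurrent_bounded_iterate[of T A n ?z w] by (simp add: wv inv_funpow_cancel)
      then have "norm (cocycle T A n ?z *v w) \<le> C * \<tau> ^ n * norm w"
        by (rule decay[OF fwd[OF \<open>good x\<close>]])
      also have "\<dots> \<le> C * \<tau> ^ n * (C * \<tau> ^ n * norm v)"
        using v(1) Ct by (intro mult_left_mono) (auto simp: Eu_def w_def)
      also have "\<dots> = C\<^sup>2 * (\<tau>\<^sup>2) ^ n * norm v" by (simp add: power2_eq_square power_mult_distrib mult_ac)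
      also have "\<dots> < 1 * norm v"
        using n Ct \<open>v \<noteq> 0\<close> by (intro mult_strict_right_mono) (auto simp: field_simps)
      finally show False by (simp add: wv)
    qed
    moreover have "0 \<in> Eu x" "0 \<in> Es x" by (auto simp: Eu_def Es_def)
    ultimately show ?thesis by blast
  qed
  have sum: "Eu x + Es x = UNIV" if g: "good x" for x
  proof -
    obtain s where s: "s \<noteq> 0" "s \<in> Es x"
    proof -
      interpret growing_orbit T A x c \<kappa> \<Lambda> using fwd[OF g, of 0 0] by simp
      show thesis using recurrent_bounded_exists that Es_eq(1)[OF g] by (metis mem_Collect_eq)
    qed
    obtain u where u: "u \<noteq> 0" "u \<in> Eu x"
    proof -
      interpret growing_orbit "inv T" A_back x c \<kappa> \<Lambda> using bwd[OF g, of 0] by simp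
      show thesis using recurrent_bounded_exists that Eu_eq(1)[OF g] by (metis mem_Collect_eq)
    qed
    \<comment> \<open>One nonzero vector in each space suffices, as parallel ones would violate the
      trivial intersection.\<close>
    have "crs u s \<noteq> 0"
    proof
      assume "crs u s = 0"
      then obtain k where "s = k *\<^sub>R u" using crs_eq_0_parallel[OF _ u(1)] by blast
      then have "s \<in> Eu x" using u(2) Eu_eq(2)[OF g] by (simp add: subspace_scale)
      then show False using s inter[OF g] by blast
    qed
    have "v \<in> Eu x + Es x" for v
      by (subst crs_basis[OF \<open>crs u s \<noteq> 0\<close>, of v])
        (intro set_plus_intro subspace_scale Es_eq Eu_eq u s g)
    then show ?thesis by blast
  qed
  have meas: "measurable_setfield M Es" "measurable_setfield M Eu"
  proof -
    have [measurable]: "cocycle_neg T A n \<in> borel_measurable M" for n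
    proof (induction n)
      case (Suc n)
      have "(\<lambda>x. matrix_inv (A ((inv T ^^ Suc n) x))) \<in> borel_measurable M"
        by (rule measurable_compose[OF inv_funpow_meas matrix_inv_meas])
      then have "(\<lambda>x. matrix_inv (A ((inv T ^^ Suc n) x)) ** cocycle_neg T A n x) \<in> borel_measurable M"
        using Suc by (rule borel_measurable_matrix_mult)
      then show ?case by simp
    qed simp
    show "measurable_setfield M Es" unfolding Es_def by (rule measurable_setfield_growth) measurable
    show "measurable_setfield M Eu" unfolding Eu_def by (rule measurable_setfield_growth) measurable
  qed
  show ?thesis
    unfolding unif_hyperbolic_def
  proof (intro exI conjI)
    show "AE x in M. subspace (Eu x) \<and> subspace (Es x) \<and> Eu x + Es x = UNIV \<and> Eu x \<inter> Es x = {0} \<and>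
           (\<lambda>v. A x *v v) ` Eu x = Eu (T x) \<and> (\<lambda>v. A x *v v) ` Es x = Es (T x) \<and>
           (\<forall>n. \<forall>v\<in>Es x. norm (cocycle T A n x *v v) \<le> C * \<tau> ^ n * norm v) \<and>
           (\<forall>n. \<forall>v\<in>Eu x. norm (cocycle_neg T A n x *v v) \<le> C * \<tau> ^ n * norm v)"
      using AE_good
    proof eventually_elim
      case (elim x)
      show ?case
        using Es_eq(2)[OF elim] Eu_eq(2)[OF elim] sum[OF elim] inter[OF elim] Eu_inv[OF elim] Es_inv[OF elim]
        by (auto simp: Es_def Eu_def)
    qed
  qed (use meas Ct in auto)
qed

end

section \<open>Continuous perturbations and genericity\<close>

lemma norm_le_opnorm: "norm (N :: real^2^2) \<le> 4 * opnorm N"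
proof -
  have e: "\<bar>N$i$j\<bar> \<le> opnorm N" for i j
  proof -
    have "\<bar>N$i$j\<bar> = \<bar>(N *v axis j 1)$i\<bar>" by (simp add: matrix_vector_mult_basis column_def)
    also have "\<dots> \<le> norm (N *v axis j 1)" by (rule component_le_norm_cart)
    also have "\<dots> \<le> opnorm N" using opnorm_bound[of N "axis j 1"] by (simp add: norm_axis_1)
    finally show ?thesis .
  qed
  have "norm (N$i) \<le> 2 * opnorm N" for i
    using norm_le_l1_cart[of "N$i"] e[of i 1] e[of i 2] by (simp add: sum_2)
  moreover have "norm N \<le> (\<Sum>i\<in>UNIV. norm (N$i))"
    unfolding norm_vec_def by (rule L2_set_le_sum) simp
  ultimately show ?thesis by (simp add: sum_2) (smt (verit))
qed

section \<open>Approximation in mean by continuous functions; slow cocycles\<close>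

locale topological_system = ergodic_system M T for M :: "'a::t2_space measure" and T +
  assumes compact_space: "compact (UNIV :: 'a set)"
    and borel: "sets M = sets borel" and regular: "regular_measure M"
begin

lemma continuous_meas:
  fixes f :: "'a \<Rightarrow> 'b::topological_space"
  shows "continuous_on UNIV f \<Longrightarrow> f \<in> borel_measurable M"
  using borel_measurable_continuous_onI measurable_cong_sets[OF borel refl] by blast

lemma continuous_bounded:
  fixes f :: "'a \<Rightarrow> 'b::metric_space"
  assumes "continuous_on UNIV f" shows "bounded (range f)"
  using compact_continuous_image[OF assms compact_space] by (rule compact_imp_bounded)

lemma continuous_integrable:
  fixes f :: "'a \<Rightarrow> real"
  assumes "continuous_on UNIV f" shows "integrable M f"
proof -
  obtain B where "\<And>x. norm (f x) \<le> B" using continuous_bounded[OF assms] by (auto simp: bounded_iff)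
  then show ?thesis by (intro integrable_const_bound[of _ B]) (auto intro: continuous_meas assms)
qed

text \<open>Regularity squeezes \<open>S\<close> between a compact and an open set of nearly equal
  measure; a Urysohn function for the two differs from the indicator only on the gap.\<close>

lemma separation:
  assumes S: "S \<in> sets M" and "e > 0"
  obtains g :: "'a \<Rightarrow> real" where "continuous_on UNIV g" "(\<integral>x. \<bar>indicator S x - g x\<bar> \<partial>M) < e"
proof -
  let ?a = "prob S"
  have reg: "emeasure M S = (SUP K\<in>{K. compact K \<and> K \<subseteq> S}. emeasure M K)"
    "emeasure M S = (INF U\<in>{U. open U \<and> S \<subseteq> U}. emeasure M U)"
    using regular S unfolding regular_measure_def by auto
  have open_sets: "U \<in> sets M" if "open U" for U using that borel by auto
  have compact_sets: "K \<in> sets M" if "compact K" for K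
    using borel_closed[OF compact_imp_closed[OF that]] borel by simp
  obtain K where K: "compact K" "K \<subseteq> S" "?a - e / 2 < prob K"
  proof (cases "?a < e / 2")
    \<comment> \<open>The empty set handles small measure, so that \<open>?a - e / 2\<close> is
      nonnegative when it is read in \<open>ennreal\<close>.\<close>
    case True
    then show thesis using that[of "{}"] by simp
  next
    case False
    have "ennreal (?a - e / 2) < emeasure M S"
      using False \<open>e > 0\<close> by (simp add: emeasure_eq_measure ennreal_less_iff)
    then obtain K where "compact K" "K \<subseteq> S" "ennreal (?a - e / 2) < emeasure M K"
      unfolding reg(1) less_SUP_iff by auto
    then show thesis using that[of K] False by (simp add: emeasure_eq_measure ennreal_less_iff)
  qed
  have "emeasure M S < ennreal (?a + e / 2)"
    using \<open>e > 0\<close> by (simp add: emeasure_eq_measure ennreal_less_iff)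
  then obtain U where U: "open U" "S \<subseteq> U" "emeasure M U < ennreal (?a + e / 2)"
    unfolding reg(2) INF_less_iff by auto
  then have pU: "prob U < ?a + e / 2" by (simp add: emeasure_eq_measure ennreal_less_iff)
  have "Hausdorff_space (euclidean :: 'a topology)"
    unfolding Hausdorff_space_def disjnt_def using separation_t2 by auto
  then have "normal_space (euclidean :: 'a topology)"
    using compact_space by (intro compact_Hausdorff_or_regular_imp_normal_space) (auto simp: compact_space_def)
  moreover have "closedin euclidean (- U)" "closedin euclidean K" "disjnt (- U) K"
    using U K compact_imp_closed by (auto simp: disjnt_def)
  ultimately obtain g where g: "continuous_map euclidean (top_of_set {0..1::real}) g" "g ` (- U) \<subseteq> {0}" "g ` K \<subseteq> {1}"
    using Urysohn_lemma[of euclidean "- U" K 0 1] by auto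
  have gc: "continuous_on UNIV g" and g01: "\<And>x. 0 \<le> g x \<and> g x \<le> 1"
    using g(1) by (auto simp: continuous_map_in_subtopology image_subset_iff Pi_iff)
  have "(\<integral>x. \<bar>indicator S x - g x\<bar> \<partial>M) \<le> (\<integral>x. indicator (U - K) x \<partial>M)"
  proof (rule integral_mono)
    show "integrable M (\<lambda>x. \<bar>indicator S x - g x\<bar>)"
      using continuous_integrable[OF gc] S
      by (intro integrable_abs Bochner_Integration.integrable_diff integrable_real_indicator) (auto simp: emeasure_eq_measure)
    show "integrable M (indicator (U - K) :: 'a \<Rightarrow> real)"
      using open_sets[OF U(1)] compact_sets[OF K(1)] by (intro integrable_real_indicator) (auto simp: emeasure_eq_measure)
    fix x
    show "\<bar>indicator S x - g x\<bar> \<le> indicator (U - K) x"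
      using g01[of x] g(2,3) K(2) U(2) by (auto simp: indicator_def image_subset_iff)
  qed
  also have "\<dots> = prob (U - K)" using open_sets[OF U(1)] compact_sets[OF K(1)] by simp
  also have "\<dots> = prob U - prob K" using open_sets[OF U(1)] compact_sets[OF K(1)] K U by (intro finite_measure_Diff) auto
  also have "\<dots> < e" using pU K by linarith
  finally show thesis using that gc by blast
qed

lemma continuous_L1_approx:
  fixes f :: "'a \<Rightarrow> real"
  assumes "integrable M f" "e > 0"
  shows "\<exists>g. continuous_on UNIV g \<and> (\<integral>x. \<bar>f x - g x\<bar> \<partial>M) < e"
  using assms
proof (induction arbitrary: e rule: integrable_induct)
  case (base S c)
  have "e / (\<bar>c\<bar> + 1) > 0" using base by (simp add: add_nonneg_pos)
  then obtain g :: "'a \<Rightarrow> real" where g: "continuous_on UNIV g" "(\<integral>x. \<bar>indicator S x - g x\<bar> \<partial>M) < e / (\<bar>c\<bar> + 1)"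
    using separation[OF base(1)] by blast
  have "(\<integral>x. \<bar>indicator S x *\<^sub>R c - c * g x\<bar> \<partial>M) = \<bar>c\<bar> * (\<integral>x. \<bar>indicator S x - g x\<bar> \<partial>M)"
    by (subst Bochner_Integration.integral_mult_right_zero[symmetric])
      (auto intro!: Bochner_Integration.integral_cong simp: abs_mult[symmetric] algebra_simps)
  also have "\<dots> \<le> (\<bar>c\<bar> + 1) * (\<integral>x. \<bar>indicator S x - g x\<bar> \<partial>M)"
    by (intro mult_right_mono integral_nonneg_AE) auto
  also have "\<dots> < e" using g(2) by (simp add: field_simps add_nonneg_pos)
  finally show ?case using g(1) by (intro exI[of _ "\<lambda>x. c * g x"]) (auto intro: continuous_intros)
next
  case (add f1 f2)
  have "e / 2 > 0" using add by simp
  then obtain g1 g2 where g: "continuous_on UNIV g1" "(\<integral>x. \<bar>f1 x - g1 x\<bar> \<partial>M) < e / 2"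
    "continuous_on UNIV g2" "(\<integral>x. \<bar>f2 x - g2 x\<bar> \<partial>M) < e / 2"
    using add.IH by meson
  note i = add.hyps g(1,3)[THEN continuous_integrable]
  have "(\<integral>x. \<bar>f1 x + f2 x - (g1 x + g2 x)\<bar> \<partial>M) \<le> (\<integral>x. \<bar>f1 x - g1 x\<bar> + \<bar>f2 x - g2 x\<bar> \<partial>M)"
    using i by (intro integral_mono) auto
  also have "\<dots> = (\<integral>x. \<bar>f1 x - g1 x\<bar> \<partial>M) + (\<integral>x. \<bar>f2 x - g2 x\<bar> \<partial>M)"
    using i by (intro Bochner_Integration.integral_add) auto
  finally show ?case using g by (intro exI[of _ "\<lambda>x. g1 x + g2 x"]) (auto intro: continuous_intros)
next
  case (lim f s)
  have "(\<lambda>i. (\<integral>x. \<bar>f x - s i x\<bar> \<partial>M)) \<longlonglongrightarrow> (\<integral>x. (0::real) \<partial>M)"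
  proof (rule integral_dominated_convergence[where w = "\<lambda>x. 3 * \<bar>f x\<bar>"])
    show "AE x in M. (\<lambda>i. \<bar>f x - s i x\<bar>) \<longlonglongrightarrow> 0"
    proof (rule AE_I2)
      fix x assume "x \<in> space M"
      then have "(\<lambda>i. \<bar>f x - s i x\<bar>) \<longlonglongrightarrow> \<bar>f x - f x\<bar>" by (intro tendsto_intros lim.hyps)
      then show "(\<lambda>i. \<bar>f x - s i x\<bar>) \<longlonglongrightarrow> 0" by simp
    qed
    show "AE x in M. norm \<bar>f x - s i x\<bar> \<le> 3 * \<bar>f x\<bar>" for i
    proof (rule AE_I2)
      fix x assume "x \<in> space M"
      then have "\<bar>s i x\<bar> \<le> 2 * \<bar>f x\<bar>" using lim.hyps(3)[of x i] by simp
      then show "norm \<bar>f x - s i x\<bar> \<le> 3 * \<bar>f x\<bar>" by simp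
    qed
  qed (use lim.hyps in auto)
  then have "\<forall>\<^sub>F i in sequentially. (\<integral>x. \<bar>f x - s i x\<bar> \<partial>M) < e / 2"
    using lim.prems by (intro order_tendstoD) auto
  then obtain i where i: "(\<integral>x. \<bar>f x - s i x\<bar> \<partial>M) < e / 2" by (auto simp: eventually_sequentially)
  have "e / 2 > 0" using lim.prems by simp
  then obtain g where g: "continuous_on UNIV g" "(\<integral>x. \<bar>s i x - g x\<bar> \<partial>M) < e / 2" using lim.IH by blast
  note int = lim.hyps(1)[of i] lim.hyps(4) continuous_integrable[OF g(1)]
  have "(\<integral>x. \<bar>f x - g x\<bar> \<partial>M) \<le> (\<integral>x. \<bar>f x - s i x\<bar> + \<bar>s i x - g x\<bar> \<partial>M)"
    using int by (intro integral_mono) auto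
  also have "\<dots> = (\<integral>x. \<bar>f x - s i x\<bar> \<partial>M) + (\<integral>x. \<bar>s i x - g x\<bar> \<partial>M)"
    using int by (intro Bochner_Integration.integral_add) auto
  finally show ?case using g i by (intro exI[of _ g]) auto
qed

text \<open>This is \<open>L(A) < \<epsilon>\<close> with the infimum unfolded. A single finite time
  certifies it, which is what makes the condition open.\<close>

definition slow :: "real \<Rightarrow> ('a \<Rightarrow> real^2^2) \<Rightarrow> bool" where
  "slow \<epsilon> A \<longleftrightarrow> (\<exists>N\<ge>1. (\<integral>x. log_growth T A N x \<partial>M) < \<epsilon> * real N)"

lemma SL2C_system:
  assumes "A \<in> SL2C" "0 < \<eta>" "\<eta> < pi / 2" "\<And>x. opnorm (apply_bcontfun A x) \<le> \<Lambda>"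
  shows "controlled_system M T (apply_bcontfun A) \<Lambda> \<eta>"
proof unfold_locales
  show "apply_bcontfun A \<in> borel_measurable M"
    by (intro continuous_meas continuous_on_apply_bcontfun)
  show "det (apply_bcontfun A x) = 1" for x using assms by (simp add: SL2C_def)
qed (use assms in auto)

lemma SL2C_bounded:
  obtains \<Lambda> where "\<Lambda> \<ge> 1" "\<And>x. opnorm (apply_bcontfun A x) \<le> \<Lambda>"
proof
  have "opnorm (apply_bcontfun A x) \<le> 2 * norm A" for x
    using opnorm_le_norm[of "apply_bcontfun A x"] norm_bounded[of A x] by linarith
  then show "opnorm (apply_bcontfun A x) \<le> max 1 (2 * norm A)" for x by (simp add: le_max_iff_disj)
qed simp

text \<open>Kingman's upper bound holds for every rate \<open>1 / real (Suc k)\<close> and the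
  logarithms are nonnegative, so the limit exists and is zero almost everywhere.\<close>

lemma slow_imp_LE_zero:
  assumes A: "A \<in> SL2C" and slow: "\<And>\<epsilon>. \<epsilon> > 0 \<Longrightarrow> slow \<epsilon> (apply_bcontfun A)"
  shows "LE M T (apply_bcontfun A) = 0"
proof -
  obtain \<Lambda> where \<Lambda>: "\<Lambda> \<ge> 1" "\<And>x. opnorm (apply_bcontfun A x) \<le> \<Lambda>" using SL2C_bounded by blast
  interpret controlled_system M T "apply_bcontfun A" \<Lambda> 1
    by (rule SL2C_system[OF A]) (use pi_gt3 \<Lambda> in auto)
  interpret W: subadditive_process M T "log_growth T (apply_bcontfun A)" "ln \<Lambda>"
    by (rule cocycle_process)
  define W where "W n x = log_growth T (apply_bcontfun A) n x" for n x
  have "AE x in M. \<exists>K. \<forall>n. W n x \<le> 1 / real (Suc k) * real n + K" for k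
  proof -
    obtain N where "N \<ge> 1" "(\<integral>x. W N x \<partial>M) < 1 / real (Suc k) * real N"
      using slow[of "1 / real (Suc k)"] by (auto simp: slow_def W_def)
    then show ?thesis unfolding W_def by (rule W.kingman_upper)
  qed
  then have "AE x in M. \<forall>k. \<exists>K. \<forall>n. W n x \<le> 1 / real (Suc k) * real n + K" by (simp add: AE_all_countable)
  then have "AE x in M. top_lyap T (apply_bcontfun A) x = 0"
  proof eventually_elim
    case (elim x)
    have "(\<lambda>n. W n x / real n) \<longlonglongrightarrow> 0"
    proof (rule LIMSEQ_I)
      fix r :: real assume "r > 0"
      then obtain k where k: "1 / real (Suc k) < r / 2" using nat_approx_posE[of "r / 2"] by auto
      obtain K where K: "\<And>n. W n x \<le> 1 / real (Suc k) * real n + K" using elim by blast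
      obtain n0 :: nat where n0: "2 * \<bar>K\<bar> / r < real n0" using reals_Archimedean2 by blast
      show "\<exists>no. \<forall>n\<ge>no. norm (W n x / real n - 0) < r"
      proof (intro exI allI impI)
        fix n assume "Suc n0 \<le> n"
        then have n: "real n > 0" "2 * \<bar>K\<bar> / r < real n" using n0 by auto
        have "W n x \<le> 1 / real (Suc k) * real n + \<bar>K\<bar>" using K[of n] by linarith
        also have "\<dots> < r / 2 * real n + r / 2 * real n"
          using k n \<open>r > 0\<close> by (intro add_less_le_mono mult_strict_right_mono) (auto simp: field_simps)
        finally have "W n x < r * real n" by simp
        then show "norm (W n x / real n - 0) < r"
          using W.V_nonneg[of n x] n by (simp add: W_def field_simps)
      qed
    qed
    then show ?case unfolding top_lyap_def W_def by (rule limI)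
  qed
  then show ?thesis unfolding LE_def by (rule integral_eq_zero_AE)
qed

text \<open>The time that certifies slowness of \<open>A\<close> serves for nearby cocycles too, as
  the mean at a fixed time is Lipschitz in the uniform distance.\<close>

lemma slow_open:
  assumes A: "A \<in> SL2C" and "slow \<epsilon> (apply_bcontfun A)"
  obtains \<delta> where "\<delta> > 0" "\<And>B. B \<in> SL2C \<Longrightarrow> dist B A < \<delta> \<Longrightarrow> slow \<epsilon> (apply_bcontfun B)"
proof -
  obtain \<Lambda>0 where \<Lambda>0: "\<Lambda>0 \<ge> 1" "\<And>x. opnorm (apply_bcontfun A x) \<le> \<Lambda>0" using SL2C_bounded by blast
  \<comment> \<open>\<open>dist B A < 1\<close> changes the operator norm by at most two, so one
    bound serves both cocycles.\<close>
  define \<Lambda> where "\<Lambda> = \<Lambda>0 + 2"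
  have \<Lambda>1: "\<Lambda> \<ge> 1" using \<Lambda>0 by (simp add: \<Lambda>_def)
  obtain N where N: "N \<ge> 1" "(\<integral>x. log_growth T (apply_bcontfun A) N x \<partial>M) < \<epsilon> * real N"
    using assms by (auto simp: slow_def)
  define gap where "gap = \<epsilon> * real N - (\<integral>x. log_growth T (apply_bcontfun A) N x \<partial>M)"
  have gap: "gap > 0" using N by (simp add: gap_def)
  have den: "\<Lambda> ^ N * (2 * real N) > 0" using \<Lambda>1 N by simp
  define \<delta> where "\<delta> = min 1 (gap / (\<Lambda> ^ N * (2 * real N)))"
  have "\<delta> > 0" using gap den by (simp add: \<delta>_def)
  moreover have "slow \<epsilon> (apply_bcontfun B)" if B: "B \<in> SL2C" "dist B A < \<delta>" for B
  proof -
    let ?A = "apply_bcontfun A" and ?B = "apply_bcontfun B"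
    have d: "opnorm (?B x - ?A x) \<le> 2 * dist B A" for x
      using opnorm_le_norm[of "?B x - ?A x"] dist_bounded[of B x A] by (simp add: dist_norm)
    have bB: "opnorm (?B x) \<le> \<Lambda>" for x
      using opnorm_diff_le[of "?B x" "?A x"] d[of x] \<Lambda>0(2)[of x] B by (simp add: \<Lambda>_def \<delta>_def)
    have bA: "opnorm (?A x) \<le> \<Lambda>" for x using \<Lambda>0(2)[of x] by (simp add: \<Lambda>_def)
    interpret SA: controlled_system M T ?A \<Lambda> 1 by (rule SL2C_system[OF A]) (use pi_gt3 bA in auto)
    interpret SB: controlled_system M T ?B \<Lambda> 1 by (rule SL2C_system[OF B(1)]) (use pi_gt3 bB in auto)
    interpret WA: subadditive_process M T "log_growth T ?A" "ln \<Lambda>" by (rule SA.cocycle_process)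
    interpret WB: subadditive_process M T "log_growth T ?B" "ln \<Lambda>" by (rule SB.cocycle_process)
    have pw: "log_growth T ?B N x \<le> log_growth T ?A N x + \<Lambda> ^ N * (2 * real N) * dist B A" for x
    proof -
      have "log_growth T ?B N x \<le> log_growth T ?A N x
          + \<Lambda> ^ N * (\<Sum>i<N. opnorm (?B ((T ^^ i) x) - ?A ((T ^^ i) x)))"
        unfolding cocycle_matprod by (rule ln_opnorm_matprod_diff) (auto simp: bA bB \<Lambda>1 SA.det1 SB.det1)
      also have "\<dots> \<le> log_growth T ?A N x + \<Lambda> ^ N * (\<Sum>i<N. 2 * dist B A)"
        using \<Lambda>1 by (intro add_left_mono mult_left_mono sum_mono d) auto
      finally show ?thesis by simp
    qed
    have "(\<integral>x. log_growth T ?B N x \<partial>M)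
        \<le> (\<integral>x. log_growth T ?A N x + \<Lambda> ^ N * (2 * real N) * dist B A \<partial>M)"
      using WA.V_integrable WB.V_integrable pw by (intro integral_mono) auto
    also have "\<dots> = (\<integral>x. log_growth T ?A N x \<partial>M) + \<Lambda> ^ N * (2 * real N) * dist B A"
      using WA.V_integrable by (simp add: prob_space)
    also have "\<Lambda> ^ N * (2 * real N) * dist B A < gap"
    proof -
      have "dist B A < gap / (\<Lambda> ^ N * (2 * real N))" using B by (simp add: \<delta>_def)
      then show ?thesis using den by (simp only: pos_less_divide_eq mult.commute)
    qed
    finally show ?thesis using N(1) by (auto simp: slow_def gap_def)
  qed
  ultimately show thesis using that by blast
qed

lemma perturb_to_slow:
  assumes A: "A \<in> SL2C" and not_hyp: "\<not> unif_hyperbolic M T (apply_bcontfun A)"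
    and "\<epsilon> > 0" "\<delta> > 0"
  obtains B where "B \<in> SL2C" "dist B A < \<delta>" "slow \<epsilon> (apply_bcontfun B)"
proof (cases "slow \<epsilon> (apply_bcontfun A)")
  case True
  then show thesis using that[of A] A \<open>\<delta> > 0\<close> by simp
next
  case False
  let ?A = "apply_bcontfun A"
  obtain \<Lambda> where \<Lambda>: "\<Lambda> \<ge> 1" "\<And>x. opnorm (?A x) \<le> \<Lambda>" using SL2C_bounded by blast
  \<comment> \<open>A rotation by at most \<open>\<eta>\<close> moves \<open>A\<close> by at most
    \<open>2 * \<Lambda> * \<eta> \<le> \<delta> / 8\<close> in operator norm, hence by at most
    \<open>\<delta> / 2\<close> in \<open>norm\<close>. The cap \<open>1\<close> is below
    \<open>pi / 2\<close>.\<close>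
  define \<eta> where "\<eta> = min 1 (\<delta> / (16 * \<Lambda>))"
  have eta: "0 < \<eta>" "\<eta> < pi / 2" using \<Lambda> \<open>\<delta> > 0\<close> pi_gt3 by (auto simp: \<eta>_def)
  interpret S: controlled_system M T ?A \<Lambda> \<eta> by (rule SL2C_system[OF A eta \<Lambda>(2)])
  define \<rho> where "\<rho> = (1 + sin \<eta>) / (1 - sin \<eta>)"
  have se: "sin \<eta> > 0" "sin \<eta> < 1" using eta sin_gt_zero[of \<eta>] sin_monotone_2pi[of \<eta> "pi/2"] by auto
  have rho: "\<rho> > 1" using se by (simp add: \<rho>_def field_simps)
  \<comment> \<open>\<open>reaches_or_growth\<close> speaks of squared norms, so the rate for norms
    is a square root.\<close>
  define \<kappa> where "\<kappa> = sqrt \<rho>"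
  have kappa: "\<kappa> > 1" "\<kappa>\<^sup>2 = \<rho>" using rho by (auto simp: \<kappa>_def)
  have te: "tan \<eta> > 0" using eta by (intro tan_gt_zero)
  \<comment> \<open>\<open>c * \<kappa> \<le> tan \<eta>\<close> lowers the exponent from
    \<open>n = Suc m\<close> to \<open>m\<close>, and \<open>c \<le> 1\<close> makes the growth
    bound automatic at \<open>n = 0\<close>.\<close>
  define c where "c = min 1 (tan \<eta> / \<kappa>)"
  have c: "c > 0" "c \<le> 1" "c * \<kappa> \<le> tan \<eta>" using te kappa by (auto simp: c_def min_def field_simps)
  obtain n where n: "\<not> (AE x in M. c * \<kappa> ^ n \<le> opnorm (cocycle T ?A n x))"
    using S.uniform_growth_imp_hyperbolic[OF c(1) kappa(1)] not_hyp by blast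
  define D where "D = {x \<in> space M. opnorm (cocycle T ?A n x) < c * \<kappa> ^ n}"
  have D: "D \<in> sets M" unfolding D_def by measurable
  have pD: "prob D > 0"
  proof (rule ccontr)
    assume "\<not> prob D > 0"
    then have "prob D = 0" by (simp add: zero_less_measure_iff)
    then have "AE x in M. x \<notin> D" by (rule AE_not_in_prob_0[OF D])
    then have "AE x in M. c * \<kappa> ^ n \<le> opnorm (cocycle T ?A n x)"
      by eventually_elim (auto simp: D_def space_UNIV)
    then show False using n by simp
  qed
  have "n \<noteq> 0"
  proof
    assume "n = 0"
    then have "AE x in M. c * \<kappa> ^ n \<le> opnorm (cocycle T ?A n x)" using c by (simp add: opnorm_mat_1)
    then show False using n by simp
  qed
  then obtain m where m: "n = Suc m" by (cases n) auto
  have total: "reaches T ?A \<eta> (Suc (Suc m)) x v w" if "x \<in> D" "norm v = 1" "w \<noteq> 0" for x v w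
  proof (rule reaches_or_growth[OF S.det1 eta that(2) _ that(3)])
    have "norm (cocycle T ?A n x *v v) < c * \<kappa> ^ n"
      using opnorm_bound[of "cocycle T ?A n x" v] that by (simp add: D_def)
    also have "\<dots> = (c * \<kappa>) * \<kappa> ^ m" by (simp add: m)
    also have "\<dots> \<le> tan \<eta> * \<kappa> ^ m" using c kappa by (intro mult_right_mono) auto
    finally have "(norm (cocycle T ?A n x *v v))\<^sup>2 < (tan \<eta> * \<kappa> ^ m)\<^sup>2" by (intro power_strict_mono) auto
    also have "\<dots> = (tan \<eta>)\<^sup>2 * \<rho> ^ m" by (simp add: power_mult_distrib kappa(2)[symmetric] power_mult[symmetric] mult.commute)
    finally show "(norm (cocycle T ?A (Suc m) x *v v))\<^sup>2 < (tan \<eta>)\<^sup>2 * ((1 + sin \<eta>) / (1 - sin \<eta>)) ^ m"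
      by (simp only: m \<rho>_def)
  qed
  have growth: "\<exists>n\<ge>1. expectation (S.V n) < \<epsilon>' * real n" if "\<epsilon>' > 0" for \<epsilon>'
    using S.V_growth_zero[OF D pD total that] .
  show thesis
  proof (cases "\<forall>\<zeta>>0. \<exists>Z\<in>sets M. 0 < prob Z \<and> prob Z < \<zeta>")
    case True
    have small: "\<exists>Z\<in>sets M. 0 < prob Z \<and> prob Z < \<zeta>" if "\<zeta> > 0" for \<zeta> using True that by blast
    have half: "\<epsilon> / 2 > 0" using \<open>\<epsilon> > 0\<close> by simp
    have "\<exists>\<theta> N. \<theta> \<in> borel_measurable M \<and> (\<forall>x. \<bar>\<theta> x\<bar> \<le> \<eta>) \<and> N \<ge> 1 \<and>
      (\<integral>x. log_growth T (\<lambda>x. ?A x ** rot (\<theta> x)) N x \<partial>M) < \<epsilon> / 2 * real N"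
      by (rule S.measurable_perturbation[of "\<epsilon> / 2", OF small growth half]) blast+
    then obtain \<theta> N where \<theta>: "\<theta> \<in> borel_measurable M" "\<And>x. \<bar>\<theta> x\<bar> \<le> \<eta>" "N \<ge> 1"
      "(\<integral>x. log_growth T (\<lambda>x. ?A x ** rot (\<theta> x)) N x \<partial>M) < \<epsilon> / 2 * real N"
      by blast
    have \<theta>_int: "integrable M \<theta>" by (rule integrable_const_bound[of _ \<eta>]) (use \<theta> in auto)
    have den: "\<Lambda> ^ N * (2 * \<Lambda>) > 0" using \<Lambda> by simp
    have "\<epsilon> / 2 / (\<Lambda> ^ N * (2 * \<Lambda>)) > 0" using den \<open>\<epsilon> > 0\<close> by simp
    then obtain g0 where g0: "continuous_on UNIV g0" "(\<integral>x. \<bar>\<theta> x - g0 x\<bar> \<partial>M) < \<epsilon> / 2 / (\<Lambda> ^ N * (2 * \<Lambda>))"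
      using continuous_L1_approx[OF \<theta>_int] by blast
    \<comment> \<open>Clamping keeps the control admissible and cannot increase the distance to
      \<open>\<theta>\<close>, whose values already lie in the interval.\<close>
    define g where "g x = max (- \<eta>) (min \<eta> (g0 x))" for x
    have gc: "continuous_on UNIV g" unfolding g_def using g0(1) by (intro continuous_intros)
    have g_le: "\<bar>g x\<bar> \<le> \<eta>" for x using eta by (auto simp: g_def)
    have g_meas [measurable]: "g \<in> borel_measurable M" by (rule continuous_meas[OF gc])
    note \<theta>(1) [measurable]
    have diff_int: "integrable M (\<lambda>x. \<bar>\<theta> x - g x\<bar>)"
      using \<theta>_int continuous_integrable[OF gc] by auto
    have "(\<integral>x. \<bar>\<theta> x - g x\<bar> \<partial>M) \<le> (\<integral>x. \<bar>\<theta> x - g0 x\<bar> \<partial>M)"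
    proof (intro integral_mono diff_int)
      show "integrable M (\<lambda>x. \<bar>\<theta> x - g0 x\<bar>)" using \<theta>_int continuous_integrable[OF g0(1)] by auto
      show "\<bar>\<theta> x - g x\<bar> \<le> \<bar>\<theta> x - g0 x\<bar>" for x using \<theta>(2)[of x] by (auto simp: g_def max_def min_def)
    qed
    with g0(2) have g_approx: "\<Lambda> ^ N * (2 * \<Lambda>) * (\<integral>x. \<bar>\<theta> x - g x\<bar> \<partial>M) < \<epsilon> / 2"
      using den by (smt (verit) pos_less_divide_eq mult.commute)
    define B where "B = Bcontfun (\<lambda>x. ?A x ** rot (g x))"
    have cont: "continuous_on UNIV (\<lambda>x. ?A x ** rot (g x))"
      by (intro continuous_on_matrix_mult continuous_on_rot gc continuous_on_apply_bcontfun)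
    then have B: "apply_bcontfun B = (\<lambda>x. ?A x ** rot (g x))"
      unfolding B_def by (intro Bcontfun_inverse) (auto simp: bcontfun_def continuous_bounded)
    have "B \<in> SL2C" by (simp add: SL2C_def B det_mul S.det1)
    moreover have "dist B A < \<delta>"
    proof -
      have "dist B A \<le> \<delta> / 2"
      proof (rule dist_bound)
        fix x
        have "opnorm (?A x ** rot (g x) - ?A x) = opnorm (?A x ** (rot (g x) - rot 0))"
          by (simp add: matrix_diff_mult)
        also have "\<dots> \<le> opnorm (?A x) * opnorm (rot (g x) - rot 0)" by (rule opnorm_mult)
        also have "\<dots> \<le> \<Lambda> * (2 * \<bar>g x - 0\<bar>)"
          using \<Lambda> by (intro mult_mono opnorm_rot_diff opnorm_nonneg) auto
        also have "\<dots> \<le> \<Lambda> * (2 * (\<delta> / (16 * \<Lambda>)))"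
          using g_le[of x] \<Lambda> by (intro mult_left_mono) (auto simp: \<eta>_def)
        also have "\<dots> = \<delta> / 8" using \<Lambda> by (simp add: field_simps)
        finally show "dist (apply_bcontfun B x) (?A x) \<le> \<delta> / 2"
          using norm_le_opnorm[of "?A x ** rot (g x) - ?A x"] by (simp add: B dist_norm)
      qed
      then show ?thesis using \<open>\<delta> > 0\<close> by linarith
    qed
    moreover have "slow \<epsilon> (apply_bcontfun B)"
    proof -
      let ?B = "\<lambda>x. ?A x ** rot (g x)" and ?D = "\<lambda>x. ?A x ** rot (\<theta> x)"
      interpret SB: controlled_system M T ?B \<Lambda> \<eta> by (rule S.perturbed_system) measurable
      interpret SD: controlled_system M T ?D \<Lambda> \<eta> by (rule S.perturbed_system) measurable
      interpret WB: subadditive_process M T "log_growth T ?B" "ln \<Lambda>" by (rule SB.cocycle_process)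
      interpret WD: subadditive_process M T "log_growth T ?D" "ln \<Lambda>" by (rule SD.cocycle_process)
      have d: "opnorm (?B x - ?D x) \<le> 2 * \<Lambda> * \<bar>\<theta> x - g x\<bar>" for x
      proof -
        have "opnorm (?B x - ?D x) = opnorm (?A x ** (rot (g x) - rot (\<theta> x)))" by (simp add: matrix_diff_mult)
        also have "\<dots> \<le> opnorm (?A x) * opnorm (rot (g x) - rot (\<theta> x))" by (rule opnorm_mult)
        also have "\<dots> \<le> \<Lambda> * (2 * \<bar>g x - \<theta> x\<bar>)"
          using \<Lambda> by (intro mult_mono opnorm_rot_diff opnorm_nonneg) auto
        finally show ?thesis by (simp add: abs_minus_commute)
      qed
      have pw: "log_growth T ?B N x \<le> log_growth T ?D N x
          + \<Lambda> ^ N * (\<Sum>i<N. 2 * \<Lambda> * \<bar>\<theta> ((T ^^ i) x) - g ((T ^^ i) x)\<bar>)" for x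
      proof -
        have "log_growth T ?B N x \<le> log_growth T ?D N x
            + \<Lambda> ^ N * (\<Sum>i<N. opnorm (?B ((T ^^ i) x) - ?D ((T ^^ i) x)))"
          unfolding cocycle_matprod
          by (rule ln_opnorm_matprod_diff) (use SB.A_bounded SD.A_bounded SB.det1 SD.det1 \<Lambda> in auto)
        also have "\<dots> \<le> log_growth T ?D N x
            + \<Lambda> ^ N * (\<Sum>i<N. 2 * \<Lambda> * \<bar>\<theta> ((T ^^ i) x) - g ((T ^^ i) x)\<bar>)"
          using \<Lambda> by (intro add_left_mono mult_left_mono sum_mono d) auto
        finally show ?thesis .
      qed
      have shift_int: "integrable M (\<lambda>x. \<bar>\<theta> ((T ^^ i) x) - g ((T ^^ i) x)\<bar>)" for i
      proof (rule integrable_bounded[of _ "2 * \<eta>"])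
        show "\<bar>\<theta> ((T ^^ i) x) - g ((T ^^ i) x)\<bar> \<le> 2 * \<eta>" for x
          using \<theta>(2)[of "(T ^^ i) x"] g_le[of "(T ^^ i) x"] by linarith
      qed auto
      have shift_eq: "(\<integral>x. \<bar>\<theta> ((T ^^ i) x) - g ((T ^^ i) x)\<bar> \<partial>M) = (\<integral>x. \<bar>\<theta> x - g x\<bar> \<partial>M)" for i
        by (rule integral_T) measurable
      have "(\<integral>x. log_growth T ?B N x \<partial>M) \<le> (\<integral>x. log_growth T ?D N x
          + \<Lambda> ^ N * (\<Sum>i<N. 2 * \<Lambda> * \<bar>\<theta> ((T ^^ i) x) - g ((T ^^ i) x)\<bar>) \<partial>M)"
        using WB.V_integrable WD.V_integrable shift_int pw by (intro integral_mono) auto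
      also have "\<dots> = (\<integral>x. log_growth T ?D N x \<partial>M) + \<Lambda> ^ N * (\<Sum>i<N. 2 * \<Lambda> * (\<integral>x. \<bar>\<theta> x - g x\<bar> \<partial>M))"
        using WD.V_integrable shift_int shift_eq by simp
      also have "\<dots> = (\<integral>x. log_growth T ?D N x \<partial>M) + real N * (\<Lambda> ^ N * (2 * \<Lambda>) * (\<integral>x. \<bar>\<theta> x - g x\<bar> \<partial>M))"
        by simp
      also have "\<dots> < \<epsilon> / 2 * real N + real N * (\<epsilon> / 2)"
        using \<theta>(3,4) g_approx by (intro add_strict_mono mult_strict_left_mono) auto
      finally show ?thesis unfolding slow_def B using \<theta>(3) by auto
    qed
    ultimately show thesis using that by blast
  next
    case nosmall: False
    then obtain \<zeta> where \<zeta>: "\<zeta> > 0" and no: "\<not> (\<exists>Z\<in>sets M. 0 < prob Z \<and> prob Z < \<zeta>)" by blast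
    have atomic: "prob Z \<ge> \<zeta>" if "Z \<in> sets M" "prob Z > 0" for Z using no that by (meson not_le)
    \<comment> \<open>In this branch \<open>A\<close> is not slow, so it grows uniformly by
      \<open>atomic_growth\<close> and would be hyperbolic, against the assumption.\<close>
    have "\<epsilon> * real n \<le> (\<integral>x. log_growth T ?A n x \<partial>M)" if "n \<ge> 1" for n
      using False that by (auto simp: slow_def not_less)
    then obtain E where E: "\<And>n. AE x in M. \<epsilon> * real n - E \<le> log_growth T ?A n x"
      using S.atomic_growth[OF \<zeta> atomic] by blast
    have "unif_hyperbolic M T ?A"
    proof (rule S.uniform_growth_imp_hyperbolic)
      show "exp (- E) > 0" "exp \<epsilon> > 1" using \<open>\<epsilon> > 0\<close> by auto
      show "AE x in M. exp (- E) * exp \<epsilon> ^ n \<le> opnorm (cocycle T ?A n x)" for n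
        using E[of n]
      proof eventually_elim
        case (elim x)
        have "opnorm (cocycle T ?A n x) \<ge> 1" by (intro opnorm_ge_1 det_cocycle S.det1)
        then have "opnorm (cocycle T ?A n x) = exp (log_growth T ?A n x)" by simp
        also have "\<dots> \<ge> exp (\<epsilon> * real n - E)" using elim by simp
        finally show ?case by (simp add: exp_diff exp_minus field_simps exp_of_nat2_mult)
      qed
    qed
    with not_hyp show thesis by simp
  qed
qed

end

section \<open>The residual set\<close>

lemma ergodic_automorphism_system:
  assumes "space M = UNIV" "prob_space M" "ergodic_automorphism M T"
  shows "ergodic_system M T"
proof -
  interpret prob_space M by fact
  have b: "bij T" using assms by (auto simp: ergodic_automorphism_def bij_def)
  have "the_inv_into (space M) T = inv T"
    using b assms(1) by (auto simp: the_inv_into_f_eq bij_is_inj bij_is_surj surj_f_inv_f)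
  then show ?thesis
    using assms b by unfold_locales (auto simp: ergodic_automorphism_def)
qed

theorem theoremC:
  fixes M :: "'a::t2_space measure" and T :: "'a \<Rightarrow> 'a"
  assumes "compact (UNIV :: 'a set)"
    and "sets M = sets borel"
    and "prob_space M"
    and "regular_measure M"
    and "ergodic_automorphism M T"
  shows "\<exists>R. residual_in (SL2C :: ('a \<Rightarrow>\<^sub>C (real^2^2)) set) R \<and>
           (\<forall>A\<in>R. unif_hyperbolic M T (apply_bcontfun A) \<or> LE M T (apply_bcontfun A) = 0)"
proof -
  have "space M = UNIV" using sets_eq_imp_space_eq[OF assms(2)] by simp
  then interpret ergodic_system M T using assms by (intro ergodic_automorphism_system)
  interpret topological_system M T by unfold_locales (use assms in auto)
  define Q :: "nat \<Rightarrow> ('a \<Rightarrow>\<^sub>C (real^2^2)) set" where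
    "Q n = {A \<in> SL2C. slow (1 / real (Suc n)) (apply_bcontfun A)}" for n
  define U where "U n = Q n \<union> (SL2C - closure (Q n))" for n
  have openQ: "openin (top_of_set SL2C) (Q n)" for n
    unfolding openin_euclidean_subtopology_iff
  proof (intro conjI ballI)
    show "Q n \<subseteq> SL2C" by (auto simp: Q_def)
    fix A assume "A \<in> Q n"
    then obtain \<delta> where "\<delta> > 0" "\<And>B. B \<in> SL2C \<Longrightarrow> dist B A < \<delta> \<Longrightarrow> slow (1 / real (Suc n)) (apply_bcontfun B)"
      using slow_open[of A "1 / real (Suc n)"] by (auto simp: Q_def)
    then show "\<exists>e>0. \<forall>B\<in>SL2C. dist B A < e \<longrightarrow> B \<in> Q n" by (auto simp: Q_def)
  qed
  have openU: "openin (top_of_set SL2C) (U n)" for n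
  proof -
    have "SL2C - closure (Q n) = SL2C \<inter> (- closure (Q n))" by blast
    then have "openin (top_of_set SL2C) (SL2C - closure (Q n))" by (auto intro!: openin_open_Int)
    then show ?thesis unfolding U_def using openQ by (rule openin_Un[rotated])
  qed
  have denseU: "SL2C \<subseteq> closure (U n)" for n
  proof
    fix A :: "'a \<Rightarrow>\<^sub>C (real^2^2)" assume "A \<in> SL2C"
    then have "A \<in> closure (Q n) \<or> A \<in> U n" by (auto simp: U_def)
    then show "A \<in> closure (U n)"
      using closure_mono[of "Q n" "U n"] closure_subset[of "U n"] by (auto simp: U_def)
  qed
  have sub: "(\<Inter>n. U n) \<subseteq> SL2C" by (auto simp: U_def Q_def)
  have "residual_in SL2C (\<Inter>n. U n)"
    unfolding residual_in_def
    by (intro conjI sub exI[of _ U] allI openU denseU order_refl)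
  moreover have "unif_hyperbolic M T (apply_bcontfun A) \<or> LE M T (apply_bcontfun A) = 0"
    if A: "A \<in> (\<Inter>n. U n)" for A
  proof (rule ccontr)
    assume contra: "\<not> (unif_hyperbolic M T (apply_bcontfun A) \<or> LE M T (apply_bcontfun A) = 0)"
    have AS: "A \<in> SL2C" using A sub by blast
    then obtain \<epsilon> where \<epsilon>: "\<epsilon> > 0" "\<not> slow \<epsilon> (apply_bcontfun A)"
      using slow_imp_LE_zero contra by blast
    obtain n where n: "1 / real (Suc n) < \<epsilon>" using nat_approx_posE[OF \<epsilon>(1)] by blast
    have "A \<notin> Q n"
    proof
      assume "A \<in> Q n"
      then obtain N where N: "N \<ge> 1" "(\<integral>x. log_growth T (apply_bcontfun A) N x \<partial>M) < 1 / real (Suc n) * real N"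
        by (auto simp: Q_def slow_def)
      have "1 / real (Suc n) * real N \<le> \<epsilon> * real N" using n by (intro mult_right_mono) auto
      then show False using N \<epsilon>(2) unfolding slow_def by (meson less_le_trans)
    qed
    \<comment> \<open>Membership in \<open>U n\<close> leaves only the exterior of
      \<open>Q n\<close>, yet \<open>perturb_to_slow\<close> finds points of \<open>Q n\<close>
      arbitrarily close to \<open>A\<close>.\<close>
    then have "A \<notin> closure (Q n)" using A by (auto simp: U_def)
    then obtain \<delta> where \<delta>: "\<delta> > 0" "\<And>B. B \<in> Q n \<Longrightarrow> \<not> dist B A < \<delta>"
      unfolding closure_approachable by blast
    obtain B where "B \<in> SL2C" "dist B A < \<delta>" "slow (1 / real (Suc n)) (apply_bcontfun B)"
      using perturb_to_slow[OF AS _ _ \<delta>(1), of "1 / real (Suc n)"] contra by auto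
    then show False using \<delta>(2)[of B] by (simp add: Q_def)
  qed
  ultimately show ?thesis by blast
qed

end
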